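(* Let $\Omega$ be a domain in $\mathbb{R}^n$ such that $\partial\Omega=F^{-1}(1)$, where $F:\mathbb{R}^n\to\mathbb{R}$ is a smooth map and $1$ is a regular value of $F$. Suppose that the outward unit normal vector field $\bar N$ of $\partial\Omega$ satisfies $\bar N=\frac{\nabla F}{|\nabla F|}$. If $\Sigma$ is a compact free-boundary hypersurface contained in $\Omega$, with $\partial\Sigma\subset\partial\Omega$, and $\varphi\in C^\infty(\Sigma)$, then $$\int_{\partial\Sigma}|\nabla F|\varphi\,ds=\int_\Sigma\varphi\,\Delta_\Sigma F\,d\Sigma+\int_\Sigma(1-F)\Delta_\Sigma\varphi\,d\Sigma .$$ In particular, $$\int_{\partial\Sigma}|\nabla F|\,ds=\int_\Sigma\Delta_\Sigma F\,d\Sigma .$$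
   Context: $\Sigma$ is a smooth immersed $(n-1)$-dimensional hypersurface with boundary, $\Sigma\subset\overline{\Omega}$ and $\partial\Sigma\subset\partial\Omega$. $\Sigma$ is free-boundary if it meets $\partial\Omega$ orthogonally along $\partial\Sigma$, i.e. the outward unit conormal $\nu$ of $\partial\Sigma$ in $\Sigma$ satisfies $\nu=\bar N$ along $\partial\Sigma$. $\Delta_\Sigma$ is the Laplace-Beltrami operator of $\Sigma$, and $\Delta_\Sigma F$ means $\Delta_\Sigma(F|_\Sigma)$; $\nabla F$ is the gradient of $F$ in $\mathbb{R}^n$. *)

theory Defs
  imports "HOL-Analysis.Analysis"
begin

primrec Ck_on :: "nat \<Rightarrow> 'a::real_normed_vector set \<Rightarrow> ('a \<Rightarrow> 'b::real_normed_vector) \<Rightarrow> bool" where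
  "Ck_on 0 U f \<longleftrightarrow> continuous_on U f"
| "Ck_on (Suc k) U f \<longleftrightarrow>
     (\<forall>x\<in>U. f differentiable (at x)) \<and> (\<forall>v. Ck_on k U (\<lambda>x. frechet_derivative f (at x) v))"

text \<open>\<^const>\<open>Ck_on\<close> is meant for open sets. On an arbitrary set (such as a relatively open
  subset of a half-space), smooth means locally extendable to a smooth map on an open set; on
  open sets this is the usual notion.\<close>

definition smooth_on :: "'a::real_normed_vector set \<Rightarrow> ('a \<Rightarrow> 'b::real_normed_vector) \<Rightarrow> bool" where
  "smooth_on S f \<longleftrightarrow>
     (\<forall>x\<in>S. \<exists>U g. open U \<and> x \<in> U \<and> (\<forall>k. Ck_on k U g) \<and> (\<forall>y\<in>U \<inter> S. g y = f y))"

definition grad :: "('a::real_inner \<Rightarrow> real) \<Rightarrow> 'a \<Rightarrow> 'a" where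
  "grad F x = (THE D. GDERIV F x :> D)"

definition regular_value :: "('a::real_normed_vector \<Rightarrow> 'b::real_normed_vector) \<Rightarrow> 'b \<Rightarrow> bool" where
  "regular_value F c \<longleftrightarrow> (\<forall>x. F x = c \<longrightarrow> surj (frechet_derivative F (at x)))"

definition is_domain :: "'a::topological_space set \<Rightarrow> bool" where
  "is_domain \<Omega> \<longleftrightarrow> open \<Omega> \<and> connected \<Omega> \<and> \<Omega> \<noteq> {}"

text \<open>Velocities at \<open>q\<close> of smooth curves in \<open>S\<close>; this is the tangent space if \<open>S\<close> is a smooth
  submanifold.\<close>

definition tangent_vectors :: "'a::real_normed_vector set \<Rightarrow> 'a \<Rightarrow> 'a set" where
  "tangent_vectors S q =
     {v. \<exists>\<epsilon>>0. \<exists>\<gamma>::real \<Rightarrow> 'a. smooth_on {-\<epsilon><..<\<epsilon>} \<gamma> \<and> \<gamma> ` {-\<epsilon><..<\<epsilon>} \<subseteq> S \<and>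
          \<gamma> 0 = q \<and> (\<gamma> has_vector_derivative v) (at 0)}"

definition outward_unit_normal :: "'a::real_inner set \<Rightarrow> 'a \<Rightarrow> 'a \<Rightarrow> bool" where
  "outward_unit_normal \<Omega> q N \<longleftrightarrow>
     norm N = 1 \<and>
     (\<forall>v\<in>tangent_vectors (frontier \<Omega>) q. N \<bullet> v = 0) \<and>
     (\<forall>\<^sub>F t in at_right 0. q + t *\<^sub>R N \<notin> closure \<Omega> \<and> q - t *\<^sub>R N \<in> \<Omega>)"

text \<open>A chart is given by its inverse, a local parametrization \<open>\<psi>\<close> defined on a relatively open
  subset \<open>V\<close> of the half-space \<open>{x. 0 \<le> x $ e}\<close>, where \<open>e\<close> is a fixed coordinate index.\<close>

type_synonym ('m, 'k) chart = "(real, 'k) vec set \<times> ((real, 'k) vec \<Rightarrow> 'm)"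

definition halfspace :: "'k::finite \<Rightarrow> (real^'k) set" where
  "halfspace e = {x. 0 \<le> x $ e}"

definition smooth_atlas ::
  "'k::finite \<Rightarrow> 'm::t2_space set \<Rightarrow> ('m, 'k) chart set \<Rightarrow> bool" where
  "smooth_atlas e M A \<longleftrightarrow>
     (\<forall>(V, \<psi>)\<in>A.
        openin (top_of_set (halfspace e)) V \<and>
        openin (top_of_set M) (\<psi> ` V) \<and>
        (\<exists>\<phi>. homeomorphism V (\<psi> ` V) \<psi> \<phi>)) \<and>
     (\<Union>(V, \<psi>)\<in>A. \<psi> ` V) = M \<and>
     (\<forall>(V, \<psi>)\<in>A. \<forall>(W, \<theta>)\<in>A.
        smooth_on (V \<inter> \<psi> -` (\<theta> ` W)) (\<lambda>x. inv_into W \<theta> (\<psi> x)))"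

definition mboundary :: "'k::finite \<Rightarrow> ('m, 'k) chart set \<Rightarrow> 'm set" where
  "mboundary e A = (\<Union>(V, \<psi>)\<in>A. \<psi> ` {x\<in>V. x $ e = 0})"

definition smooth_map ::
  "('m, 'k::finite) chart set \<Rightarrow> ('m \<Rightarrow> 'b::real_normed_vector) \<Rightarrow> bool" where
  "smooth_map A f \<longleftrightarrow> (\<forall>(V, \<psi>)\<in>A. smooth_on V (f \<circ> \<psi>))"

definition immersion :: "('m, 'k::finite) chart set \<Rightarrow> ('m \<Rightarrow> real^'n) \<Rightarrow> bool" where
  "immersion A X \<longleftrightarrow>
     smooth_map A X \<and>
     (\<forall>(V, \<psi>)\<in>A. \<forall>x\<in>V. inj (frechet_derivative (X \<circ> \<psi>) (at x within V)))"

text \<open>A compact hypersurface with boundary, immersed in \<open>\<real>\<^sup>n\<close> by \<open>X\<close>. All metric notions below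
  refer to the metric induced by \<open>X\<close>. The dimension of \<open>M\<close> is the cardinality of the index type
  \<open>'k\<close>.\<close>

definition compact_immersed_hypersurface ::
  "'k::finite \<Rightarrow> 'm::t2_space set \<Rightarrow> ('m, 'k) chart set \<Rightarrow> ('m \<Rightarrow> real^'n) \<Rightarrow> bool" where
  "compact_immersed_hypersurface e M A X \<longleftrightarrow>
     CARD('n) = CARD('k) + 1 \<and> compact M \<and> smooth_atlas e M A \<and> immersion A X"

text \<open>Here \<open>V\<close> is the domain of a parametrization and \<open>\<Psi> = X \<circ> \<psi>\<close>. As \<open>V\<close> is relatively open in
  a half-space, derivatives within \<open>V\<close> are unique, also at boundary points.\<close>

definition partial ::
  "(real^'k::finite) set \<Rightarrow> (real^'k \<Rightarrow> 'b::real_normed_vector) \<Rightarrow> 'k \<Rightarrow> real^'k \<Rightarrow> 'b" where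
  "partial V f i x = frechet_derivative f (at x within V) (axis i 1)"

definition induced_metric ::
  "(real^'k::finite) set \<Rightarrow> (real^'k \<Rightarrow> real^'n) \<Rightarrow> real^'k \<Rightarrow> real^'k^'k" where
  "induced_metric V \<Psi> x = (\<chi> i j. partial V \<Psi> i x \<bullet> partial V \<Psi> j x)"

definition local_laplacian ::
  "(real^'k::finite) set \<Rightarrow> (real^'k \<Rightarrow> real^'n) \<Rightarrow> (real^'k \<Rightarrow> real) \<Rightarrow> real^'k \<Rightarrow> real" where
  "local_laplacian V \<Psi> f x =
     (\<Sum>i\<in>UNIV. partial V
        (\<lambda>y. sqrt (det (induced_metric V \<Psi> y)) *
              (\<Sum>j\<in>UNIV. matrix_inv (induced_metric V \<Psi> y) $ i $ j * partial V f j y)) i x)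
     / sqrt (det (induced_metric V \<Psi> x))"

text \<open>For a smooth function \<open>f\<close>, the value does not depend on the chart chosen at \<open>p\<close>.\<close>

definition laplace_beltrami ::
  "('m, 'k::finite) chart set \<Rightarrow> ('m \<Rightarrow> real^'n) \<Rightarrow> ('m \<Rightarrow> real) \<Rightarrow> 'm \<Rightarrow> real" where
  "laplace_beltrami A X f p =
     (let (V, \<psi>) = (SOME c. c \<in> A \<and> p \<in> snd c ` fst c)
      in local_laplacian V (X \<circ> \<psi>) (f \<circ> \<psi>) (inv_into V \<psi> p))"

text \<open>The Riemannian measure is the Borel measure on \<open>M\<close> with density \<open>sqrt (det g)\<close> in every
  chart.\<close>

definition volume_measure ::
  "'m::t2_space set \<Rightarrow> ('m, 'k::finite) chart set \<Rightarrow> ('m \<Rightarrow> real^'n) \<Rightarrow> 'm measure" where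
  "volume_measure M A X =
     (THE \<mu>. sets \<mu> = sets (restrict_space borel M) \<and>
        (\<forall>(V, \<psi>)\<in>A. \<forall>B\<in>sets \<mu>. B \<subseteq> \<psi> ` V \<longrightarrow>
           emeasure \<mu> B =
             (\<integral>\<^sup>+x. ennreal (sqrt (det (induced_metric V (X \<circ> \<psi>) x))) * indicator (V \<inter> \<psi> -` B) x
                \<partial>lborel)))"

text \<open>Lebesgue measure on the hyperplane \<open>{x. x $ e = 0}\<close>, of dimension one less than \<open>CARD('k)\<close>.
  If this dimension is \<open>0\<close>, it is the unit mass at the origin.\<close>

definition hyperplane_lborel :: "'k::finite \<Rightarrow> (real^'k) measure" where
  "hyperplane_lborel e =
     distr (\<Pi>\<^sub>M i\<in>UNIV - {e}. lborel) borel (\<lambda>y. \<chi> i. if i = e then 0 else y i)"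

text \<open>The matrix of the metric of \<open>\<partial>M\<close> is that of \<open>M\<close> with row and column \<open>e\<close> removed. To stay
  in the same matrix type these are replaced by those of the unit matrix, which
  gives the same determinant.\<close>

definition boundary_metric ::
  "'k::finite \<Rightarrow> (real^'k) set \<Rightarrow> (real^'k \<Rightarrow> real^'n) \<Rightarrow> real^'k \<Rightarrow> real^'k^'k" where
  "boundary_metric e V \<Psi> x =
     (\<chi> i j. if i = e \<or> j = e then (if i = j then 1 else 0) else induced_metric V \<Psi> x $ i $ j)"

definition boundary_measure ::
  "'k::finite \<Rightarrow> ('m::t2_space, 'k) chart set \<Rightarrow> ('m \<Rightarrow> real^'n) \<Rightarrow> 'm measure" where
  "boundary_measure e A X =
     (THE \<sigma>. sets \<sigma> = sets (restrict_space borel (mboundary e A)) \<and>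
        (\<forall>(V, \<psi>)\<in>A. \<forall>B\<in>sets \<sigma>. B \<subseteq> \<psi> ` V \<longrightarrow>
           emeasure \<sigma> B =
             (\<integral>\<^sup>+x. ennreal (sqrt (det (boundary_metric e V (X \<circ> \<psi>) x))) * indicator (V \<inter> \<psi> -` B) x
                \<partial>hyperplane_lborel e)))"

text \<open>\<open>\<nu>\<close> is the outward unit conormal at the boundary point with coordinates \<open>x\<close>: a unit vector
  tangent to the hypersurface, orthogonal to its boundary and pointing out of the half-space.\<close>

definition outward_unit_conormal ::
  "'k::finite \<Rightarrow> (real^'k) set \<Rightarrow> (real^'k \<Rightarrow> real^'n) \<Rightarrow> real^'k \<Rightarrow> real^'n \<Rightarrow> bool" where
  "outward_unit_conormal e V \<Psi> x \<nu> \<longleftrightarrow>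
     (let D = frechet_derivative \<Psi> (at x within V) in
      norm \<nu> = 1 \<and>
      (\<exists>v. v $ e < 0 \<and> \<nu> = D v) \<and>
      (\<forall>w. w $ e = 0 \<longrightarrow> \<nu> \<bullet> D w = 0))"

definition free_boundary ::
  "'k::finite \<Rightarrow> ('m, 'k) chart set \<Rightarrow> ('m \<Rightarrow> real^'n) \<Rightarrow> (real^'n \<Rightarrow> real^'n) \<Rightarrow> bool" where
  "free_boundary e A X N \<longleftrightarrow>
     (\<forall>(V, \<psi>)\<in>A. \<forall>x\<in>V. x $ e = 0 \<longrightarrow> outward_unit_conormal e V (X \<circ> \<psi>) x (N (X (\<psi> x))))"

end

theory Submission
  imports Defs
begin

text \<open>On the boundary \<open>F = 1\<close>, and the free boundary condition makes \<open>|\<nabla>F|\<close> the conormal derivative of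
  \<open>F\<close>. So the claim is the divergence theorem for \<open>\<phi> \<nabla>F + (1 - F) \<nabla>\<phi>\<close>: it is the sum of Green's first
  identity for the pairs \<open>(\<phi>, F)\<close> and \<open>(1 - F, \<phi>)\<close>, whose gradient terms cancel.

  A partition of unity reduces Green's identity to one chart, where it is integration by parts in a
  half-space. The bump functions only need to be continuously differentiable, since only first
  derivatives of the test function occur. Applied to a test function supported in two charts, the
  identity also shows that the coordinate expression of the Laplacian does not depend on the chart,
  so that no second-order transformation formula is needed.\<close>

section \<open>Change of variables for an arbitrary finite index type\<close>

text \<open>\<open>volume_measure\<close> and \<open>boundary_measure\<close> are definite
  descriptions, and \<open>laplace_beltrami\<close> evaluates in a chart picked by choice. The
  descriptions say something only once exactly one measure is known to satisfy them. That is a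
  compatibility statement between charts, hence a change of variables under transition maps, and
  this is why so much measure theory precedes the geometry. On the boundary the change of variables
  would live on a hyperplane; there the transition maps are thickened to maps of the full space.

  The atlas does not postulate that transition maps preserve the boundary. This is derived from the
  invertibility of their differentials, which comes from the immersion.

  The weight 1 - F serves two purposes. It vanishes on \<partial>\<Sigma>, so the second Green
  identity has no boundary term, and its differential is minus that of F, so the gradient terms
  cancel. The single surviving boundary term is evaluated by the free boundary condition: the
  conormal of \<Sigma> is the normalised gradient of F.\<close>

lemma absolutely_integrable_vec1_iff:
  "(\<lambda>x. (\<chi> i. h x) :: real^1) absolutely_integrable_on S \<longleftrightarrow> h absolutely_integrable_on S"
  by (subst absolutely_integrable_componentwise_iff) (simp add: Basis_vec_def inner_axis)

text \<open>The available theorem concerns absolutely integrable vector-valued functions, so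
  \<open>f\<close> is wrapped into \<open>real^1\<close>. One side is then integrable exactly if the
  other is. As \<open>f\<close> is nonnegative, this gives equality in the extended reals, both
  sides being infinite in the remaining case. The measurability hypotheses allow the passage from
  \<open>lebesgue\<close> to \<open>lborel\<close>.\<close>

lemma nn_integral_change_of_variables_wellorder:
  fixes f :: "real^'n::{finite,wellorder} \<Rightarrow> real" and g :: "real^'n::_ \<Rightarrow> real^'n::_"
  assumes S: "S \<in> sets lebesgue"
    and der: "\<And>x. x \<in> S \<Longrightarrow> (g has_derivative g' x) (at x within S)"
    and inj: "inj_on g S"
    and nonneg: "\<And>x. 0 \<le> f x"
    and mf: "(\<lambda>y. indicator (g ` S) y * f y) \<in> borel_measurable borel"
    and mg: "(\<lambda>x. indicator S x * (\<bar>det (matrix (g' x))\<bar> * f (g x))) \<in> borel_measurable borel"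
  shows "(\<integral>\<^sup>+y. ennreal (indicator (g ` S) y * f y) \<partial>lborel) =
    (\<integral>\<^sup>+x. ennreal (indicator S x * (\<bar>det (matrix (g' x))\<bar> * f (g x))) \<partial>lborel)"
proof -
  let ?F = "\<lambda>y. indicator (g ` S) y * f y"
  let ?G = "\<lambda>x. indicator S x * (\<bar>det (matrix (g' x))\<bar> * f (g x))"
  define f1 :: "real^'n::_ \<Rightarrow> real^1" where "f1 y = (\<chi> i. f y)" for y
  have scaled: "c *\<^sub>R (\<chi> i. h) = ((\<chi> i. c * h) :: real^1)" for c h
    by (simp add: vec_eq_iff)
  have "f absolutely_integrable_on (g ` S) \<longleftrightarrow>
      (\<lambda>x. \<bar>det (matrix (g' x))\<bar> * f (g x)) absolutely_integrable_on S" (is "?A \<longleftrightarrow> ?B")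
    using absolutely_integrable_change_of_variables[OF S der inj, of f1]
    by (simp add: f1_def[abs_def] absolutely_integrable_vec1_iff scaled)
  moreover have iF: "?A \<longleftrightarrow> integrable lborel ?F"
    using mf by (simp add: set_integrable_def integrable_completion)
  moreover have iG: "?B \<longleftrightarrow> integrable lborel ?G"
    using mg by (simp add: set_integrable_def integrable_completion)
  ultimately have iff: "integrable lborel ?F \<longleftrightarrow> integrable lborel ?G" by simp
  show ?thesis
  proof (cases "integrable lborel ?F")
    case True
    then have A: ?A and B: ?B using iff iF iG by auto
    then have A1: "f1 absolutely_integrable_on (g ` S)"
      by (simp add: f1_def[abs_def] absolutely_integrable_vec1_iff)
    have B1: "(\<lambda>x. \<bar>det (matrix (g' x))\<bar> *\<^sub>R f1 (g x)) absolutely_integrable_on S"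
      using absolutely_integrable_change_of_variables[OF S der inj, of f1] A1 by simp
    have "integral (g ` S) f = integral (g ` S) f1 $ 1"
      using integral_component_eq_cart[of f1 "g ` S" 1] A1
      by (simp add: f1_def absolutely_integrable_on_def)
    also have "\<dots> = integral S (\<lambda>x. \<bar>det (matrix (g' x))\<bar> *\<^sub>R f1 (g x)) $ 1"
      using integral_change_of_variables[OF S der inj, of f1] A1 by simp
    also have "\<dots> = integral S (\<lambda>x. \<bar>det (matrix (g' x))\<bar> * f (g x))"
      using integral_component_eq_cart[of "\<lambda>x. \<bar>det (matrix (g' x))\<bar> *\<^sub>R f1 (g x)" S 1] B1
      by (simp add: f1_def absolutely_integrable_on_def)
    finally have "integral\<^sup>L lebesgue ?F = integral\<^sup>L lebesgue ?G"
      using set_lebesgue_integral_eq_integral(2)[OF A] set_lebesgue_integral_eq_integral(2)[OF B]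
      by (simp add: set_lebesgue_integral_def)
    then have "integral\<^sup>L lborel ?F = integral\<^sup>L lborel ?G"
      using mf mg by (simp add: integral_completion)
    then show ?thesis
      using True iff nonneg by (simp add: nn_integral_eq_integral)
  next
    case False
    have "(\<integral>\<^sup>+x. ennreal (?F x) \<partial>lborel) = \<infinity>"
    proof (rule ccontr)
      assume "(\<integral>\<^sup>+x. ennreal (?F x) \<partial>lborel) \<noteq> \<infinity>"
      then have "integrable lborel ?F"
        using mf nonneg by (intro integrableI_nonneg) (auto simp: top.not_eq_extremum)
      then show False using False by simp
    qed
    moreover have "(\<integral>\<^sup>+x. ennreal (?G x) \<partial>lborel) = \<infinity>"
    proof (rule ccontr)
      assume "(\<integral>\<^sup>+x. ennreal (?G x) \<partial>lborel) \<noteq> \<infinity>"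
      then have "integrable lborel ?G"
        using mg nonneg by (intro integrableI_nonneg) (auto simp: top.not_eq_extremum)
      then show False using False iff by simp
    qed
    ultimately show ?thesis by simp
  qed
qed

text \<open>The change of variables theorems of the library need a well-ordered index type. This copy
  of a finite type carries an arbitrary such order.\<close>

typedef 'a ordered_copy = "UNIV :: 'a set"
  morphisms of_ordered_copy to_ordered_copy by simp

lemma bij_of_ordered_copy: "bij of_ordered_copy"
  by (metis bij_def injI of_ordered_copy_inject surjI to_ordered_copy_inverse UNIV_I)

lemma to_of_ordered_copy [simp]: "of_ordered_copy (to_ordered_copy i) = i"
  "to_ordered_copy (of_ordered_copy j) = j"
  by (simp_all add: to_ordered_copy_inverse of_ordered_copy_inverse)

lemma bij_to_ordered_copy: "bij to_ordered_copy"
  by (rule o_bij[where g = of_ordered_copy]) (simp_all add: fun_eq_iff)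

definition ordered_copy_index :: "'a::finite ordered_copy \<Rightarrow> nat" where
  "ordered_copy_index = (SOME f. inj f)"

instance ordered_copy :: (finite) finite
proof
  have "(UNIV :: 'a ordered_copy set) = range to_ordered_copy"
    by (rule bij_is_surj[OF bij_to_ordered_copy, symmetric])
  then show "finite (UNIV :: 'a ordered_copy set)"
    by (metis finite finite_imageI)
qed

lemma inj_ordered_copy_index: "inj ordered_copy_index"
proof -
  have "\<exists>f :: 'a ordered_copy \<Rightarrow> nat. inj f"
    using finite_imp_inj_to_nat_seg[of "UNIV :: 'a ordered_copy set"] by auto
  then show ?thesis
    unfolding ordered_copy_index_def by (rule someI_ex)
qed

instantiation ordered_copy :: (finite) wellorder
begin

definition "a \<le> b \<longleftrightarrow> ordered_copy_index a \<le> ordered_copy_index b"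
definition "a < b \<longleftrightarrow> ordered_copy_index a < ordered_copy_index b"

instance
proof
  fix P :: "'a ordered_copy \<Rightarrow> bool" and a :: "'a ordered_copy"
  assume *: "\<And>x. (\<And>y. y < x \<Longrightarrow> P y) \<Longrightarrow> P x"
  show "P a"
    by (induction a rule: measure_induct_rule[where f = ordered_copy_index])
      (auto intro: * simp: less_ordered_copy_def)
qed (auto simp: less_ordered_copy_def less_eq_ordered_copy_def
    dest: injD[OF inj_ordered_copy_index])

end

section \<open>Relabelling coordinates: determinants and Lebesgue measure are unchanged\<close>

definition to_oc :: "real^'k \<Rightarrow> real^('k ordered_copy)" where
  "to_oc x = (\<chi> i. x $ of_ordered_copy i)"

definition of_oc :: "real^('k ordered_copy) \<Rightarrow> real^'k" where
  "of_oc x = (\<chi> i. x $ to_ordered_copy i)"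

lemma to_of_oc [simp]: "to_oc (of_oc y) = y" "of_oc (to_oc x) = x"
  by (simp_all add: to_oc_def of_oc_def vec_eq_iff)

lemma linear_oc: "linear to_oc" "linear of_oc"
  by (auto simp: to_oc_def of_oc_def vec_eq_iff intro!: linearI)

text \<open>Conjugation by \<open>h\<close> is a sign-preserving bijection between the permutations
  of the two index sets, and it matches the terms of the Leibniz formula one by one.\<close>

lemma det_reindex:
  fixes A :: "real^'k^'k" and h :: "'l::finite \<Rightarrow> 'k::finite"
  assumes h: "bij h"
  shows "det (\<chi> i j. A $ h i $ h j) = det A"
proof -
  let ?m = "map_permutation UNIV h"
  have m: "?m p = h \<circ> p \<circ> inv h" for p
    using h by (simp add: map_permutation_def restrict_id_def fun_eq_iff bij_def)
  have bij: "bij_betw ?m {p. p permutes UNIV} {p. p permutes UNIV}"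
  proof (rule bij_betwI[where g = "\<lambda>q. inv h \<circ> q \<circ> h"])
    show "?m \<in> {p. p permutes UNIV} \<rightarrow> {p. p permutes UNIV}"
      using map_permutation_permutes[of h UNIV UNIV] h by auto
    show "(\<lambda>q. inv h \<circ> q \<circ> h) \<in> {p. p permutes UNIV} \<rightarrow> {p. p permutes UNIV}"
      using h by (auto simp: permutes_bij bij_comp bij_imp_bij_inv intro!: bij_imp_permutes)
  qed (use h in \<open>auto simp: m fun_eq_iff bij_def surj_f_inv_f\<close>)
  have "det A = (\<Sum>p | p permutes UNIV. of_int (sign (?m p)) * (\<Prod>i\<in>UNIV. A $ i $ ?m p i))"
    unfolding det_def by (rule sum.reindex_bij_betw[OF bij, symmetric])
  also have "\<dots> = (\<Sum>p | p permutes UNIV. of_int (sign p) * (\<Prod>i\<in>UNIV. A $ h i $ h (p i)))"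
  proof (rule sum.cong[OF refl])
    fix p :: "'l \<Rightarrow> 'l" assume p: "p \<in> {p. p permutes UNIV}"
    have "(\<Prod>i\<in>UNIV. A $ i $ ?m p i) = (\<Prod>i\<in>UNIV. A $ h i $ ?m p (h i))"
      by (rule prod.reindex_bij_betw[OF h, symmetric])
    then show "of_int (sign (?m p)) * (\<Prod>i\<in>UNIV. A $ i $ ?m p i) =
        of_int (sign p) * (\<Prod>i\<in>UNIV. A $ h i $ h (p i))"
      using sign_map_permutation[of h UNIV p] p h by (simp add: m bij_def)
  qed
  finally show ?thesis by (simp add: det_def)
qed

lemma prod_Basis_vec: "(\<Prod>b\<in>Basis. f b) = (\<Prod>i\<in>UNIV. f (axis i (1::real)))"
proof -
  have *: "(Basis :: (real^'k) set) = range (\<lambda>i. axis i 1)"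
    by (auto simp: Basis_vec_def)
  show ?thesis
    unfolding * by (subst prod.reindex) (auto simp: inj_on_def axis_eq_axis)
qed

lemma measurable_oc [measurable]:
  "to_oc \<in> borel_measurable borel" "of_oc \<in> borel_measurable borel"
  using linear_oc by (auto intro!: borel_measurable_continuous_onI linear_continuous_on
    simp: linear_conv_bounded_linear)

text \<open>Lebesgue measure is determined by the volumes of boxes, and relabelling merely permutes
  the side lengths.\<close>

lemma lborel_distr_to_oc: "distr lborel borel to_oc = lborel"
proof (rule lborel_eqI[symmetric])
  fix l u :: "real^('a ordered_copy)"
  assume le: "\<And>b. b \<in> Basis \<Longrightarrow> l \<bullet> b \<le> u \<bullet> b"
  have le': "l $ i \<le> u $ i" for i
    using le[of "axis i 1"] by (simp add: inner_axis)
  have "to_oc -` box l u = box (of_oc l) (of_oc u)"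
    unfolding set_eq_iff
  proof
    fix x :: "real^'a"
    have "x \<in> to_oc -` box l u \<longleftrightarrow> (\<forall>j. l $ j < x $ of_ordered_copy j \<and> x $ of_ordered_copy j < u $ j)"
      by (simp add: to_oc_def mem_box_cart)
    also have "\<dots> \<longleftrightarrow> (\<forall>i. l $ to_ordered_copy i < x $ i \<and> x $ i < u $ to_ordered_copy i)"
      by (metis to_of_ordered_copy)
    finally show "x \<in> to_oc -` box l u \<longleftrightarrow> x \<in> box (of_oc l) (of_oc u)"
      by (simp add: of_oc_def mem_box_cart)
  qed
  then have "emeasure (distr lborel borel to_oc) (box l u) = emeasure lborel (box (of_oc l) (of_oc u))"
    by (simp add: emeasure_distr)
  also have "\<dots> = (\<Prod>b\<in>Basis. (of_oc u - of_oc l) \<bullet> b)"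
    using le' by (intro emeasure_lborel_box)
      (auto simp: Basis_vec_def inner_axis of_oc_def)
  also have "(\<Prod>b\<in>Basis. (of_oc u - of_oc l) \<bullet> b) = (\<Prod>i\<in>UNIV. u $ to_ordered_copy i - l $ to_ordered_copy i)"
    by (simp add: prod_Basis_vec inner_axis of_oc_def)
  also have "\<dots> = (\<Prod>j\<in>UNIV. u $ j - l $ j)"
    by (rule prod.reindex_bij_betw[OF bij_to_ordered_copy])
  finally show "emeasure (distr lborel borel to_oc) (box l u) = (\<Prod>b\<in>Basis. (u - l) \<bullet> b)"
    by (simp add: prod_Basis_vec inner_axis)
qed simp

lemma nn_integral_to_oc:
  fixes h :: "real^('k::finite ordered_copy) \<Rightarrow> ennreal"
  assumes "h \<in> borel_measurable borel"
  shows "(\<integral>\<^sup>+y. h y \<partial>lborel) = (\<integral>\<^sup>+x. h (to_oc x) \<partial>lborel)"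
  using assms by (subst lborel_distr_to_oc[symmetric], subst nn_integral_distr) auto

text \<open>\<open>g\<close> is conjugated by the relabelling of coordinates. Lebesgue measure and
  the Jacobian determinant are invariant under it, so the version for ordered index types carries
  over.\<close>

theorem nn_integral_change_of_variables:
  fixes f :: "real^'k::finite \<Rightarrow> real" and g :: "real^'k \<Rightarrow> real^'k"
  assumes S: "S \<in> sets borel"
    and der: "\<And>x. x \<in> S \<Longrightarrow> (g has_derivative g' x) (at x within S)"
    and inj: "inj_on g S"
    and nonneg: "\<And>x. 0 \<le> f x"
    and mf: "(\<lambda>y. indicator (g ` S) y * f y) \<in> borel_measurable borel"
    and mg: "(\<lambda>x. indicator S x * (\<bar>det (matrix (g' x))\<bar> * f (g x))) \<in> borel_measurable borel"
  shows "(\<integral>\<^sup>+y. ennreal (indicator (g ` S) y * f y) \<partial>lborel) =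
    (\<integral>\<^sup>+x. ennreal (indicator S x * (\<bar>det (matrix (g' x))\<bar> * f (g x))) \<partial>lborel)"
proof -
  let ?S = "to_oc ` S" and ?g = "to_oc \<circ> g \<circ> of_oc" and ?g' = "\<lambda>y. to_oc \<circ> g' (of_oc y) \<circ> of_oc"
  have S_eq: "?S = of_oc -` S"
    by (auto simp: image_iff) (metis to_of_oc)+
  have gS: "?g ` ?S = of_oc -` (g ` S)"
  proof -
    have "?g ` ?S = to_oc ` (g ` S)" unfolding image_comp by (simp add: comp_def)
    also have "\<dots> = of_oc -` (g ` S)" by (auto simp: image_iff) (metis to_of_oc)
    finally show ?thesis .
  qed
  have ind: "indicator (?g ` ?S) (to_oc y) = (indicator (g ` S) y :: real)"
    "indicator ?S (to_oc y) = (indicator S y :: real)" for y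
    using gS S_eq by (simp_all add: indicator_def)
  have d: "det (matrix (?g' (to_oc x))) = det (matrix (g' x))" for x
  proof -
    have "matrix (?g' (to_oc x)) = (\<chi> i j. matrix (g' x) $ of_ordered_copy i $ of_ordered_copy j)"
    proof -
      have *: "of_oc (axis j 1) = (axis (of_ordered_copy j) 1 :: real^'k)" for j
        by (auto simp: of_oc_def axis_def vec_eq_iff)
      have **: "of_oc (\<chi> i. x $ of_ordered_copy i) = x"
        using to_of_oc(2)[of x] by (simp add: to_oc_def)
      show ?thesis
        by (simp add: matrix_def to_oc_def * **)
    qed
    then show ?thesis using det_reindex[OF bij_of_ordered_copy, of "matrix (g' x)"] by simp
  qed
  have S': "?S \<in> sets borel"
    using measurable_sets[OF measurable_oc(2) S] by (simp add: S_eq)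
  have mf': "(\<lambda>y. indicator (?g ` ?S) y * f (of_oc y)) \<in> borel_measurable borel"
    using measurable_compose[OF measurable_oc(2) mf] unfolding gS by (simp add: indicator_vimage[symmetric] comp_def)
  have mg': "(\<lambda>x. indicator ?S x * (\<bar>det (matrix (?g' x))\<bar> * f (of_oc (?g x)))) \<in> borel_measurable borel"
  proof -
    have "(\<lambda>x. indicator ?S x * (\<bar>det (matrix (?g' x))\<bar> * f (of_oc (?g x)))) =
      (\<lambda>x. indicator S x * (\<bar>det (matrix (g' x))\<bar> * f (g x))) \<circ> of_oc"
      unfolding fun_eq_iff
      by (metis (no_types, lifting) comp_apply d ind(2) to_of_oc)
    then show ?thesis
      using measurable_compose[OF measurable_oc(2) mg] by (simp add: comp_def)
  qed
  have "(\<integral>\<^sup>+y. ennreal (indicator (?g ` ?S) y * f (of_oc y)) \<partial>lborel) =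
    (\<integral>\<^sup>+x. ennreal (indicator ?S x * (\<bar>det (matrix (?g' x))\<bar> * f (of_oc (?g x)))) \<partial>lborel)"
  proof (rule nn_integral_change_of_variables_wellorder)
    show "?S \<in> sets lebesgue" using S' by simp
    show "inj_on ?g ?S"
      using inj by (auto simp: inj_on_def) (metis to_of_oc)
    fix y assume y: "y \<in> ?S"
    have "((\<lambda>y. to_oc (g (of_oc y))) has_derivative (\<lambda>v. to_oc (g' (of_oc y) (of_oc v)))) (at y within ?S)"
    proof (rule bounded_linear.has_derivative[where f = to_oc])
      show "bounded_linear to_oc" using linear_oc by (simp add: linear_conv_bounded_linear)
      have "of_oc ` ?S = S" by (auto simp: image_image)
      moreover have "(of_oc has_derivative of_oc) (at y within ?S)"
        by (intro bounded_linear_imp_has_derivative) (simp add: linear_conv_bounded_linear[symmetric] linear_oc)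
      moreover have "(g has_derivative g' (of_oc y)) (at (of_oc y) within S)"
        using y der by (auto simp: S_eq)
      ultimately show "((\<lambda>y. g (of_oc y)) has_derivative (\<lambda>v. g' (of_oc y) (of_oc v))) (at y within ?S)"
        using diff_chain_within[of of_oc of_oc y ?S g] by (simp add: comp_def)
    qed
    then show "(?g has_derivative ?g' y) (at y within ?S)" by (simp add: comp_def)
  qed (use nonneg mf' mg' in auto)
  moreover have "(\<integral>\<^sup>+y. ennreal (indicator (?g ` ?S) y * f (of_oc y)) \<partial>lborel) =
    (\<integral>\<^sup>+y. ennreal (indicator (g ` S) y * f y) \<partial>lborel)"
  proof (subst nn_integral_to_oc)
    show "(\<lambda>y. ennreal (indicator (?g ` ?S) y * f (of_oc y))) \<in> borel_measurable borel"
      using mf' by (intro measurable_compose[OF _ measurable_ennreal])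
  qed (simp only: ind to_of_oc)
  moreover have "(\<integral>\<^sup>+x. ennreal (indicator ?S x * (\<bar>det (matrix (?g' x))\<bar> * f (of_oc (?g x)))) \<partial>lborel)
    = (\<integral>\<^sup>+x. ennreal (indicator S x * (\<bar>det (matrix (g' x))\<bar> * f (g x))) \<partial>lborel)"
  proof (subst nn_integral_to_oc)
    show "(\<lambda>x. ennreal (indicator ?S x * (\<bar>det (matrix (?g' x))\<bar> * f (of_oc (?g x))))) \<in> borel_measurable borel"
      using mg' by (intro measurable_compose[OF _ measurable_ennreal])
  qed (simp only: ind d[unfolded to_of_oc] comp_apply to_of_oc)
  ultimately show ?thesis by simp
qed

section \<open>Integration in a half-space\<close>

text \<open>A parametrized line parallel to axis \<open>i\<close>. The value of \<open>y\<close> at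
  \<open>i\<close> is overwritten, so \<open>y\<close> may range over the product space indexed by
  \<open>UNIV - {i}\<close>, whose elements are \<open>undefined\<close> at
  \<open>i\<close>.\<close>

definition slice :: "'k::finite \<Rightarrow> ('k \<Rightarrow> real) \<Rightarrow> real \<Rightarrow> real^'k" where
  "slice i y t = (\<chi> j. if j = i then t else y j)"

lemma slice_nth [simp]: "slice i y t $ j = (if j = i then t else y j)"
  by (simp add: slice_def)

lemma borel_measurable_vec_lambda:
  assumes "\<And>i. (\<lambda>x. f x i) \<in> borel_measurable M"
  shows "(\<lambda>x. (\<chi> i. f x i) :: real^'k::finite) \<in> borel_measurable M"
  using assms by (subst borel_measurable_euclidean_space) (auto simp: Basis_vec_def inner_axis)

text \<open>Lebesgue measure and the product of the coordinate measures agree on boxes. In product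
  form one coordinate can be split off by Fubini, as integration along lines requires.\<close>

lemma lborel_vec:
  "(lborel :: (real^'k::finite) measure) = distr (\<Pi>\<^sub>M i\<in>UNIV. lborel) borel (\<lambda>f. \<chi> i. f i)"
    (is "_ = distr ?P borel ?h")
proof (rule lborel_eqI)
  have h [measurable]: "?h \<in> ?P \<rightarrow>\<^sub>M borel"
    by (intro borel_measurable_vec_lambda) measurable
  fix l u :: "real^'k" assume "\<And>b. b \<in> Basis \<Longrightarrow> l \<bullet> b \<le> u \<bullet> b"
  from this[of "axis i 1" for i] have le: "l $ i \<le> u $ i" for i by (simp add: inner_axis)
  interpret product_sigma_finite "\<lambda>i::'k. lborel :: real measure" ..
  have "?h -` box l u \<inter> space ?P = (\<Pi>\<^sub>E i\<in>UNIV. {l $ i <..< u $ i})"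
    by (auto simp: mem_box_cart space_PiM PiE_def Pi_iff)
  then have "emeasure (distr ?P borel ?h) (box l u) = (\<Prod>i\<in>UNIV. emeasure lborel {l $ i <..< u $ i})"
    by (simp add: emeasure_distr emeasure_PiM)
  also have "\<dots> = (\<Prod>b\<in>Basis. (u - l) \<bullet> b)"
    using le by (simp add: prod_Basis_vec inner_axis prod_ennreal)
  finally show "emeasure (distr ?P borel ?h) (box l u) = (\<Prod>b\<in>Basis. (u - l) \<bullet> b)" .
qed simp

lemma measurable_vec_PiM: "(\<lambda>f. \<chi> i. f i) \<in> (\<Pi>\<^sub>M i\<in>(UNIV::'k::finite set). (lborel::real measure)) \<rightarrow>\<^sub>M borel"
  by (intro borel_measurable_vec_lambda) measurable

lemma measurable_slice: "(\<lambda>y. slice i y t) \<in> (\<Pi>\<^sub>M j\<in>UNIV - {i}. lborel) \<rightarrow>\<^sub>M (borel :: (real^'k::finite) measure)"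
  unfolding slice_def
proof (intro borel_measurable_vec_lambda)
  fix j show "(\<lambda>y. if j = i then t else y j) \<in> borel_measurable (\<Pi>\<^sub>M j\<in>UNIV - {i}. lborel)"
    by (cases "j = i") auto
qed

lemma nn_integral_lborel_slice:
  fixes f :: "real^'k::finite \<Rightarrow> ennreal"
  assumes [measurable]: "f \<in> borel_measurable borel"
  shows "(\<integral>\<^sup>+x. f x \<partial>lborel) =
    (\<integral>\<^sup>+y. (\<integral>\<^sup>+t. f (slice i y t) \<partial>lborel) \<partial>(\<Pi>\<^sub>M j\<in>UNIV - {i}. lborel))"
proof -
  interpret product_sigma_finite "\<lambda>i::'k. lborel :: real measure" ..
  have ins: "insert i (UNIV - {i}) = UNIV" by auto
  have *: "(\<lambda>y. f (\<chi> i. y i)) \<in> borel_measurable (\<Pi>\<^sub>M i\<in>UNIV. lborel)"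
    by (rule measurable_compose[OF measurable_vec_PiM]) measurable
  have "(\<integral>\<^sup>+x. f x \<partial>lborel) = (\<integral>\<^sup>+y. f (\<chi> i. y i) \<partial>(\<Pi>\<^sub>M i\<in>UNIV. lborel))"
    by (subst lborel_vec) (rule nn_integral_distr[OF measurable_vec_PiM], measurable)
  also have "\<dots> = (\<integral>\<^sup>+y. (\<integral>\<^sup>+t. f (\<chi> j. (y(i := t)) j) \<partial>lborel) \<partial>(\<Pi>\<^sub>M j\<in>UNIV - {i}. lborel))"
    using product_nn_integral_insert[of "UNIV - {i}" i "\<lambda>y. f (\<chi> i. y i)"] * unfolding ins by simp
  finally show ?thesis by (simp add: slice_def fun_upd_def)
qed

lemma integral_lborel_slice:
  fixes f :: "real^'k::finite \<Rightarrow> real"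
  assumes f: "integrable lborel f"
  shows "(\<integral>x. f x \<partial>lborel) =
    (\<integral>y. (\<integral>t. f (slice i y t) \<partial>lborel) \<partial>(\<Pi>\<^sub>M j\<in>UNIV - {i}. lborel))"
proof -
  interpret product_sigma_finite "\<lambda>i::'k. lborel :: real measure" ..
  have ins: "insert i (UNIV - {i}) = UNIV" by auto
  have [measurable]: "f \<in> borel_measurable borel" using f by simp
  have *: "integrable (\<Pi>\<^sub>M i\<in>UNIV. lborel) (\<lambda>y. f (\<chi> i. y i))"
    using f by (subst (asm) lborel_vec) (simp add: integrable_distr_eq[OF measurable_vec_PiM])
  have "(\<integral>x. f x \<partial>lborel) = (\<integral>y. f (\<chi> i. y i) \<partial>(\<Pi>\<^sub>M i\<in>UNIV. lborel))"
    by (subst lborel_vec) (rule integral_distr[OF measurable_vec_PiM], measurable)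
  also have "\<dots> = (\<integral>y. (\<integral>t. f (\<chi> j. (y(i := t)) j) \<partial>lborel) \<partial>(\<Pi>\<^sub>M j\<in>UNIV - {i}. lborel))"
    using product_integral_insert[of "UNIV - {i}" i "\<lambda>y. f (\<chi> i. y i)"] * unfolding ins by simp
  finally show ?thesis by (simp add: slice_def fun_upd_def)
qed

section \<open>Integration over the bounding hyperplane and over the half-space\<close>

definition drop_coord :: "'k::finite \<Rightarrow> real^'k \<Rightarrow> real^'k" where
  "drop_coord e x = (\<chi> i. if i = e then 0 else x $ i)"

lemma linear_drop_coord: "linear (drop_coord e)"
  by (auto simp: drop_coord_def vec_eq_iff intro!: linearI)

lemma drop_coord_id: "x $ e = 0 \<Longrightarrow> drop_coord e x = x"
  by (auto simp: drop_coord_def vec_eq_iff)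

lemma drop_coord_nth [simp]: "drop_coord e x $ e = 0"
  by (simp add: drop_coord_def)

lemma measurable_drop_coord [measurable]: "drop_coord e \<in> borel_measurable borel"
  using linear_drop_coord by (auto intro!: borel_measurable_continuous_onI linear_continuous_on
    simp: linear_conv_bounded_linear)

lemma sets_hyperplane_lborel [simp, measurable_cong]: "sets (hyperplane_lborel e) = sets borel"
  by (simp add: hyperplane_lborel_def)

lemma space_hyperplane_lborel [simp]: "space (hyperplane_lborel e) = UNIV"
  by (simp add: hyperplane_lborel_def)

lemma hyperplane_lborel_slice:
  "hyperplane_lborel e = distr (\<Pi>\<^sub>M j\<in>UNIV - {e}. lborel) borel (\<lambda>y. slice e y 0)"
  by (simp add: hyperplane_lborel_def slice_def)

lemma integral_hyperplane_lborel:
  fixes f :: "real^'k::finite \<Rightarrow> real"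
  assumes [measurable]: "f \<in> borel_measurable borel"
  shows "(\<integral>x. f x \<partial>hyperplane_lborel e) = (\<integral>y. f (slice e y 0) \<partial>(\<Pi>\<^sub>M j\<in>UNIV - {e}. lborel))"
  unfolding hyperplane_lborel_slice by (rule integral_distr[OF measurable_slice]) measurable

text \<open>Thickening the hyperplane to a slab of height one reduces integrals over it to integrals
  over the full space.\<close>

lemma nn_integral_hyperplane_lborel:
  fixes f :: "real^'k::finite \<Rightarrow> ennreal"
  assumes [measurable]: "f \<in> borel_measurable borel"
  shows "(\<integral>\<^sup>+x. f x \<partial>hyperplane_lborel e) =
    (\<integral>\<^sup>+x. indicator {x. 0 < x $ e \<and> x $ e < 1} x * f (drop_coord e x) \<partial>lborel)"
proof -
  have "(\<integral>\<^sup>+x. indicator {x. 0 < x $ e \<and> x $ e < 1} x * f (drop_coord e x) \<partial>lborel) =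
    (\<integral>\<^sup>+y. (\<integral>\<^sup>+t. indicator {0<..<1::real} t * f (slice e y 0) \<partial>lborel) \<partial>(\<Pi>\<^sub>M j\<in>UNIV - {e}. lborel))"
  proof -
    have 1: "indicator {x. 0 < x $ e \<and> x $ e < 1} (slice e y t) = (indicator {0<..<1} t :: ennreal)" for y t
      by (auto simp: indicator_def)
    have 2: "drop_coord e (slice e y t) = slice e y 0" for y t
      by (auto simp: drop_coord_def vec_eq_iff)
    show ?thesis
      by (subst nn_integral_lborel_slice[where i = e], measurable) (simp add: 1 2)
  qed
  also have "\<dots> = (\<integral>\<^sup>+y. f (slice e y 0) \<partial>(\<Pi>\<^sub>M j\<in>UNIV - {e}. lborel))"
    by (simp add: nn_integral_multc)
  also have "\<dots> = (\<integral>\<^sup>+x. f x \<partial>hyperplane_lborel e)"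
    unfolding hyperplane_lborel_slice by (rule nn_integral_distr[OF measurable_slice, symmetric]) measurable
  finally show ?thesis ..
qed

lemma AE_hyperplane_lborel: "AE x in hyperplane_lborel e. x $ e = 0"
  unfolding hyperplane_lborel_slice by (subst AE_distr_iff[OF measurable_slice]) auto

lemma closed_halfspace: "closed (halfspace e)"
  unfolding halfspace_def by (intro closed_Collect_le continuous_intros)

lemma has_vector_derivative_slice:
  fixes Z :: "real^'k::finite \<Rightarrow> real"
  assumes der: "(Z has_derivative Z') (at (slice i y t) within S)"
    and sub: "\<And>s. s \<in> T \<Longrightarrow> slice i y s \<in> S"
  shows "((\<lambda>t. Z (slice i y t)) has_vector_derivative Z' (axis i 1)) (at t within T)"
proof -
  have eq: "slice i y s = slice i y 0 + s *\<^sub>R axis i 1" for s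
    by (auto simp: vec_eq_iff axis_def)
  have "((\<lambda>s. slice i y s) has_derivative (\<lambda>s. s *\<^sub>R axis i 1)) (at t within T)"
    by (subst eq) (auto intro!: derivative_eq_intros)
  moreover have "(Z has_derivative Z') (at (slice i y t) within slice i y ` T)"
    using der sub by (auto intro: has_derivative_subset)
  ultimately have "((\<lambda>t. Z (slice i y t)) has_derivative (\<lambda>s. Z' (s *\<^sub>R axis i 1))) (at t within T)"
    using diff_chain_within[of "slice i y" _ t T Z Z'] by (simp add: comp_def)
  then show ?thesis
    by (simp add: has_vector_derivative_def linear_cmul[OF has_derivative_linear[OF der]])
qed

text \<open>By Fubini, the fundamental theorem of calculus is applied on each line parallel to axis
  \<open>i\<close>. A line in direction \<open>e\<close> enters the half-space at the hyperplane and
  contributes minus the value of \<open>Z\<close> there. Any other line either misses the half-space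
  or leaves the support in both directions, and contributes nothing.\<close>

lemma integral_partial_halfspace:
  fixes Z :: "real^'k::finite \<Rightarrow> real"
  assumes der: "\<And>x. x \<in> halfspace e \<Longrightarrow> (Z has_derivative Z' x) (at x within halfspace e)"
    and cont: "continuous_on (halfspace e) (\<lambda>x. Z' x (axis i 1))"
    and K: "bounded K"
    and supp: "\<And>x. x \<in> halfspace e - K \<Longrightarrow> Z x = 0 \<and> Z' x (axis i 1) = 0"
  shows "(\<integral>x. indicator (halfspace e) x * Z' x (axis i 1) \<partial>lborel) =
    (if i = e then - (\<integral>x. indicator (halfspace e) x * Z x \<partial>hyperplane_lborel e) else 0)"
proof -
  let ?D = "\<lambda>x. indicator (halfspace e) x * Z' x (axis i 1)"
  \<comment> \<open>The points of \<open>K\<close> have norm strictly below \<open>R\<close>. Hence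
    \<open>Z\<close> vanishes wherever a line is cut off at parameter \<open>R\<close> or
    \<open>-R\<close>, as such a point has norm at least \<open>R\<close>.\<close>
  obtain R where R: "0 < R" "\<And>x. x \<in> K \<Longrightarrow> norm x < R"
    using K by (metis bounded_pos_less)
  have out: "Z x = 0 \<and> Z' x (axis i 1) = 0" if "x \<in> halfspace e" "R \<le> norm x" for x
    using supp[of x] R(2)[of x] that by auto
  have le: "\<bar>t\<bar> \<le> norm (slice i y t)" for y t
    using component_le_norm_cart[of "slice i y t" i] by simp
  have "compact (halfspace e \<inter> cball 0 R)"
    by (intro closed_Int_compact closed_halfspace compact_cball)
  then have "integrable lborel (\<lambda>x. indicator (halfspace e \<inter> cball 0 R) x *\<^sub>R Z' x (axis i 1))"
    using cont by (intro borel_integrable_compact) (auto intro: continuous_on_subset)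
  also have "(\<lambda>x. indicator (halfspace e \<inter> cball 0 R) x *\<^sub>R Z' x (axis i 1)) = ?D"
    using out by (simp add: fun_eq_iff indicator_def mem_cball) (meson less_eq_real_def not_le_imp_less)
  finally have int: "integrable lborel ?D" .
  have cs: "continuous_on T (\<lambda>t. Z' (slice i y t) (axis i 1))"
    if "\<And>s. s \<in> T \<Longrightarrow> slice i y s \<in> halfspace e" for y T
  proof (rule continuous_on_compose2[OF cont])
    show "continuous_on T (slice i y)"
      unfolding slice_def
    proof (rule continuous_on_vec_lambda)
      fix j show "continuous_on T (\<lambda>t. if j = i then t else y j)"
        by (cases "j = i") (auto intro: continuous_intros)
    qed
  qed (use that in auto)
  have FTC: "(\<integral>t. indicator {a..R} t *\<^sub>R Z' (slice i y t) (axis i 1) \<partial>lborel) = Z (slice i y R) - Z (slice i y a)"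
    if "\<And>s. s \<in> {a..R} \<Longrightarrow> slice i y s \<in> halfspace e" "a \<le> R" for y a
    by (rule integral_FTC_Icc[OF that(2)]) (use that(1) in \<open>auto intro!: has_vector_derivative_slice der cs\<close>)
  show ?thesis
  proof (cases "i = e")
    case True
    have inner: "(\<integral>t. ?D (slice i y t) \<partial>lborel) = - (indicator (halfspace e) (slice e y 0) * Z (slice e y 0))" for y
    proof -
      have in_hs: "slice i y s \<in> halfspace e \<longleftrightarrow> 0 \<le> s" for s using True by (simp add: halfspace_def)
      have D: "?D (slice i y t) = indicator {0..R} t *\<^sub>R Z' (slice i y t) (axis i 1)" for t
        using out[of "slice i y t"] le[of t y] by (auto simp: indicator_def in_hs)
      have "(\<integral>t. ?D (slice i y t) \<partial>lborel) = Z (slice i y R) - Z (slice i y 0)"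
        unfolding D using FTC[of 0 y] R(1) by (simp add: in_hs)
      moreover have "Z (slice i y R) = 0"
        using out[of "slice i y R"] le[of R y] R(1) in_hs by auto
      ultimately show ?thesis using True in_hs[of 0] by (simp add: indicator_def)
    qed
    have Z: "continuous_on (halfspace e) Z"
      using der by (meson continuous_on_eq_continuous_within has_derivative_continuous)
    have "(\<lambda>x. indicator (halfspace e) x *\<^sub>R Z x) \<in> borel_measurable borel"
      by (rule borel_measurable_continuous_on_indicator[OF _ Z])
         (simp add: borel_closed closed_halfspace)
    then have "(\<integral>x. indicator (halfspace e) x * Z x \<partial>hyperplane_lborel e) =
      (\<integral>y. indicator (halfspace e) (slice e y 0) * Z (slice e y 0) \<partial>(\<Pi>\<^sub>M j\<in>UNIV - {e}. lborel))"
      by (intro integral_hyperplane_lborel) simp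
    then show ?thesis
      using integral_lborel_slice[OF int, of i] True unfolding inner by simp
  next
    case False
    \<comment> \<open>The coordinate \<open>e\<close> is constant along these lines, so the sign of
      \<open>y e\<close> decides whether the whole line lies in the half-space.\<close>
    have inner: "(\<integral>t. ?D (slice i y t) \<partial>lborel) = 0" for y
    proof (cases "0 \<le> y e")
      case True
      then have in_hs: "slice i y s \<in> halfspace e" for s using False by (simp add: halfspace_def)
      have D: "?D (slice i y t) = indicator {-R..R} t *\<^sub>R Z' (slice i y t) (axis i 1)" for t
      proof (cases "R \<le> norm (slice i y t)")
        case True
        then show ?thesis using out[OF in_hs] by simp
      next
        case False
        then have "t \<in> {-R..R}" using le[of t y] by auto
        then show ?thesis using in_hs by simp
      qed
      have "(\<integral>t. ?D (slice i y t) \<partial>lborel) = Z (slice i y R) - Z (slice i y (-R))"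
        unfolding D using FTC[of "-R" y] R(1) by (simp add: in_hs)
      then show ?thesis
        using out[of "slice i y R"] out[of "slice i y (-R)"] le[of R y] le[of "-R" y] R(1) in_hs by auto
    next
      case neg: False
      then have D: "?D (slice i y t) = 0" for t using False by (simp add: halfspace_def)
      show ?thesis unfolding D by simp
    qed
    show ?thesis
      using integral_lborel_slice[OF int, of i] False unfolding inner by simp
  qed
qed

section \<open>Continuously differentiable functions on a half-space\<close>

text \<open>Derivatives are taken within the half-space instead of the chart domain, so that those
  of functions on different domains can be compared and glued. By \<open>at_within_openH\<close>
  this does not alter them on relatively open domains.\<close>

abbreviation dH :: "'k::finite \<Rightarrow> (real^'k \<Rightarrow> 'b::real_normed_vector) \<Rightarrow> real^'k \<Rightarrow> real^'k \<Rightarrow> 'b" where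
  "dH e f x \<equiv> frechet_derivative f (at x within halfspace e)"

abbreviation openH :: "'k::finite \<Rightarrow> (real^'k) set \<Rightarrow> bool" where
  "openH e V \<equiv> openin (top_of_set (halfspace e)) V"

text \<open>Continuity of the derivative is asked for one direction \<open>v\<close> at a time. In
  finite dimension this amounts to continuity in operator norm, and the derivative remains an
  ordinary function.\<close>

definition C1_on :: "'k::finite \<Rightarrow> (real^'k) set \<Rightarrow> (real^'k \<Rightarrow> 'b::real_normed_vector) \<Rightarrow> bool" where
  "C1_on e V f \<longleftrightarrow> (\<forall>x\<in>V. f differentiable (at x within halfspace e)) \<and>
     (\<forall>v. continuous_on V (\<lambda>x. dH e f x v))"

lemma openH_subset: "openH e V \<Longrightarrow> x \<in> V \<Longrightarrow> x \<in> halfspace e"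
  using openin_imp_subset by blast

lemma at_within_openH:
  assumes "openH e V" "x \<in> V"
  shows "at x within V = at x within halfspace e"
proof -
  obtain T where T: "open T" "V = halfspace e \<inter> T"
    using assms(1) by (auto simp: openin_open)
  show ?thesis
    by (rule at_within_nhd[of x T]) (use T assms(2) in auto)
qed

text \<open>A derivative within a set is determined if each coordinate direction admits arbitrarily
  small nonzero steps inside the set. At a boundary point of the half-space the positive steps are
  admissible.\<close>

lemma has_derivative_unique_halfspace:
  assumes "(f has_derivative D) (at x within halfspace e)"
    and "(f has_derivative D') (at x within halfspace e)" and "x \<in> halfspace e"
  shows "D = D'"
proof (rule frechet_derivative_unique_within[OF assms(1,2)])
  fix i :: "real^'a" and r :: real assume i: "i \<in> Basis" and r: "0 < r"
  then obtain j where j: "i = axis j 1" by (auto simp: Basis_vec_def)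
  show "\<exists>d. 0 < \<bar>d\<bar> \<and> \<bar>d\<bar> < r \<and> x + d *\<^sub>R i \<in> halfspace e"
    by (rule exI[of _ "r / 2"]) (use r assms(3) in \<open>auto simp: halfspace_def j axis_def\<close>)
qed

lemma dH_eqI:
  "(f has_derivative D) (at x within halfspace e) \<Longrightarrow> x \<in> halfspace e \<Longrightarrow> dH e f x = D"
  by (metis differentiableI frechet_derivative_works has_derivative_unique_halfspace)

lemma partial_eq_dH: "openH e V \<Longrightarrow> x \<in> V \<Longrightarrow> partial V f i x = dH e f x (axis i 1)"
  by (simp add: partial_def at_within_openH)

lemma linear_axis_expand:
  fixes D :: "real^'k::finite \<Rightarrow> 'b::real_normed_vector"
  assumes "linear D"
  shows "D v = (\<Sum>j\<in>UNIV. v $ j *\<^sub>R D (axis j 1))"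
proof -
  have "v = (\<Sum>j\<in>UNIV. v $ j *\<^sub>R axis j 1)"
    by (simp add: vec_eq_iff axis_def if_distrib cong: if_cong)
  then have "D v = D (\<Sum>j\<in>UNIV. v $ j *\<^sub>R axis j 1)" by simp
  also have "\<dots> = (\<Sum>j\<in>UNIV. v $ j *\<^sub>R D (axis j 1))"
    by (simp add: linear_sum[OF assms] linear_cmul[OF assms])
  finally show ?thesis .
qed

lemma C1_onI:
  assumes "V \<subseteq> halfspace e" "\<And>x. x \<in> V \<Longrightarrow> (f has_derivative D x) (at x within halfspace e)"
    and "\<And>v. continuous_on V (\<lambda>x. D x v)"
  shows "C1_on e V f"
proof -
  have eq: "dH e f x = D x" if "x \<in> V" for x
    using assms that by (intro dH_eqI) auto
  show ?thesis
    unfolding C1_on_def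
  proof (intro conjI ballI allI)
    fix v show "continuous_on V (\<lambda>x. dH e f x v)"
      using assms(3)[of v] by (rule continuous_on_eq) (simp add: eq)
  qed (use assms(2) in \<open>auto simp: differentiable_def\<close>)
qed

lemma C1_on_deriv: "C1_on e V f \<Longrightarrow> x \<in> V \<Longrightarrow> (f has_derivative dH e f x) (at x within halfspace e)"
  by (simp add: C1_on_def frechet_derivative_works)

lemma C1_on_linear: "C1_on e V f \<Longrightarrow> x \<in> V \<Longrightarrow> linear (dH e f x)"
  using C1_on_deriv has_derivative_linear by blast

lemma C1_on_continuous_dH: "C1_on e V f \<Longrightarrow> continuous_on V (\<lambda>x. dH e f x v)"
  by (simp add: C1_on_def)

lemma C1_on_continuous:
  assumes "openH e V" "C1_on e V f" shows "continuous_on V f"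
  using assms unfolding continuous_on_eq_continuous_within
  by (metis C1_on_deriv at_within_openH has_derivative_continuous)

lemma dH_cong:
  assumes "openH e V" "x \<in> V" "\<And>y. y \<in> V \<Longrightarrow> f y = g y"
  shows "dH e f x = dH e g x"
proof -
  have "(f has_derivative D) (at x within V) \<longleftrightarrow> (g has_derivative D) (at x within V)" for D
    using assms(2,3) by (metis has_derivative_transform)
  then show ?thesis
    by (simp add: frechet_derivative_def at_within_openH[OF assms(1,2)])
qed

lemma C1_on_cong:
  assumes "openH e V" "C1_on e V f" "\<And>y. y \<in> V \<Longrightarrow> f y = g y"
  shows "C1_on e V g"
proof (rule C1_onI[where D = "dH e f"])
  show "V \<subseteq> halfspace e" using assms(1) by (rule openin_imp_subset)
  fix x assume x: "x \<in> V"
  have "(g has_derivative dH e f x) (at x within V)"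
    using C1_on_deriv[OF assms(2) x] assms(3) x
    by (metis (no_types, lifting) assms(1) at_within_openH has_derivative_transform)
  then show "(g has_derivative dH e f x) (at x within halfspace e)"
    using assms(1) x by (simp add: at_within_openH)
qed (use assms(2) in \<open>simp add: C1_on_def\<close>)

text \<open>Continuous differentiability is local, and both pieces are relatively open in their
  union. This is the device for extending functions by zero.\<close>

lemma C1_on_Un:
  assumes "openH e V" "openH e W" "C1_on e V f" "C1_on e W f"
  shows "C1_on e (V \<union> W) f"
  unfolding C1_on_def
proof (intro conjI allI)
  fix v
  have "openin (top_of_set (V \<union> W)) V" "openin (top_of_set (V \<union> W)) W"
    using assms(1,2) by (meson openin_imp_subset openin_subset_trans sup.cobounded1 sup.cobounded2 Un_least)+
  then show "continuous_on (V \<union> W) (\<lambda>x. dH e f x v)"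
    using assms(3,4) by (intro continuous_on_Un_local_open) (auto simp: C1_on_def)
qed (use assms(3,4) in \<open>auto simp: C1_on_def\<close>)

lemma C1_on_const: "V \<subseteq> halfspace e \<Longrightarrow> C1_on e V (\<lambda>x. c)"
  by (rule C1_onI[where D = "\<lambda>_ _. 0"]) auto

lemma dH_const: "x \<in> halfspace e \<Longrightarrow> dH e (\<lambda>x. c) x = (\<lambda>v. 0)"
  by (rule dH_eqI) auto

context
  fixes e :: "'k::finite" and V :: "(real^'k) set"
  assumes V: "openH e V"
begin

lemma C1_on_add:
  assumes "C1_on e V f" "C1_on e V g" shows "C1_on e V (\<lambda>x. f x + g x)"
  by (rule C1_onI[where D = "\<lambda>x v. dH e f x v + dH e g x v"])
     (use assms V in \<open>auto intro!: has_derivative_add C1_on_deriv continuous_intros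
        simp: C1_on_continuous_dH openin_imp_subset\<close>)

lemma bilinear_dH:
  assumes "bounded_bilinear p" "C1_on e V f" "C1_on e V g" "x \<in> V"
  shows "dH e (\<lambda>x. p (f x) (g x)) x = (\<lambda>v. p (f x) (dH e g x v) + p (dH e f x v) (g x))"
  by (rule dH_eqI[OF bounded_bilinear.FDERIV[OF assms(1)]])
     (use assms V in \<open>auto intro: C1_on_deriv openH_subset\<close>)

lemma C1_on_bilinear:
  assumes "bounded_bilinear p" "C1_on e V f" "C1_on e V g"
  shows "C1_on e V (\<lambda>x. p (f x) (g x))"
  by (rule C1_onI[where D = "\<lambda>x v. p (f x) (dH e g x v) + p (dH e f x v) (g x)"])
     (use assms V in \<open>auto intro!: bounded_bilinear.FDERIV C1_on_deriv continuous_on_add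
        bounded_bilinear.continuous_on[OF assms(1)]
        simp: C1_on_continuous_dH C1_on_continuous openin_imp_subset\<close>)

lemmas C1_on_mult = C1_on_bilinear[OF bounded_bilinear_mult]
lemmas dH_mult = bilinear_dH[OF bounded_bilinear_mult]
lemmas C1_on_inner = C1_on_bilinear[OF bounded_bilinear_inner]

lemma C1_on_sum:
  assumes "finite I" "\<And>i. i \<in> I \<Longrightarrow> C1_on e V (f i)"
  shows "C1_on e V (\<lambda>x. \<Sum>i\<in>I. f i x)"
  using assms by (induction I) (auto intro!: C1_on_add C1_on_const openin_imp_subset[OF V])

lemma dH_sum:
  assumes "finite I" "\<And>i. i \<in> I \<Longrightarrow> C1_on e V (f i)" "x \<in> V"
  shows "dH e (\<lambda>x. \<Sum>i\<in>I. f i x) x = (\<lambda>v. \<Sum>i\<in>I. dH e (f i) x v)"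
  by (rule dH_eqI[OF has_derivative_sum]) (use assms V in \<open>auto intro: C1_on_deriv openH_subset\<close>)

lemma C1_on_prod:
  fixes f :: "'i \<Rightarrow> real^'k \<Rightarrow> real"
  assumes "finite I" "\<And>i. i \<in> I \<Longrightarrow> C1_on e V (f i)"
  shows "C1_on e V (\<lambda>x. \<Prod>i\<in>I. f i x)"
  using assms by (induction I) (auto intro!: C1_on_mult C1_on_const openin_imp_subset[OF V])

lemma C1_on_real_compose:
  fixes f :: "real^'k \<Rightarrow> real" and h :: "real \<Rightarrow> real"
  assumes f: "C1_on e V f" and h: "\<And>x. x \<in> V \<Longrightarrow> (h has_real_derivative h' (f x)) (at (f x))"
    and h': "continuous_on (f ` V) h'"
  shows "C1_on e V (\<lambda>x. h (f x))"
proof (rule C1_onI[where D = "\<lambda>x v. h' (f x) * dH e f x v"])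
  fix x assume x: "x \<in> V"
  have "((\<lambda>x. h (f x)) has_derivative (\<lambda>v. dH e f x v * h' (f x))) (at x within halfspace e)"
    using has_derivative_compose[OF C1_on_deriv[OF f x], of h "\<lambda>t. h' (f x) * t"] h[OF x]
    by (simp add: has_field_derivative_def mult.commute[of _ "h' (f x)"])
  then show "((\<lambda>x. h (f x)) has_derivative (\<lambda>v. h' (f x) * dH e f x v)) (at x within halfspace e)"
    by (simp add: mult.commute)
next
  fix v
  have "continuous_on V (\<lambda>x. h' (f x))"
    using h' C1_on_continuous[OF V f] by (metis continuous_on_compose2 order_refl)
  then show "continuous_on V (\<lambda>x. h' (f x) * dH e f x v)"
    by (intro continuous_on_mult C1_on_continuous_dH[OF f])
qed (rule openin_imp_subset[OF V])

lemma C1_on_sqrt: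
  assumes "C1_on e V f" "\<And>x. x \<in> V \<Longrightarrow> 0 < f x"
  shows "C1_on e V (\<lambda>x. sqrt (f x))"
proof (rule C1_on_real_compose[OF assms(1), where h' = "\<lambda>t. inverse (sqrt t) / 2"])
  show "continuous_on (f ` V) (\<lambda>t. inverse (sqrt t) / 2)"
    using assms(2) by (intro continuous_intros) (auto dest: less_imp_le simp: less_imp_neq[symmetric])
qed (use assms(2) in \<open>auto intro!: DERIV_real_sqrt\<close>)

lemma C1_on_inverse:
  fixes f :: "real^'k \<Rightarrow> real"
  assumes "C1_on e V f" "\<And>x. x \<in> V \<Longrightarrow> f x \<noteq> 0"
  shows "C1_on e V (\<lambda>x. inverse (f x))"
proof (rule C1_on_real_compose[OF assms(1), where h' = "\<lambda>t. - (inverse (t\<^sup>2))"])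
  show "continuous_on (f ` V) (\<lambda>t. - inverse (t\<^sup>2))"
    using assms(2) by (intro continuous_intros) auto
  fix x assume "x \<in> V"
  then show "(inverse has_real_derivative - inverse ((f x)\<^sup>2)) (at (f x))"
    using DERIV_inverse[of "f x" UNIV] assms(2) by (simp add: power2_eq_square inverse_mult_distrib numeral_2_eq_2)
qed

lemma C1_on_divide:
  fixes f :: "real^'k \<Rightarrow> real"
  assumes "C1_on e V f" "C1_on e V g" "\<And>x. x \<in> V \<Longrightarrow> g x \<noteq> 0"
  shows "C1_on e V (\<lambda>x. f x / g x)"
  unfolding divide_inverse using assms by (intro C1_on_mult C1_on_inverse)

lemma C1_on_det:
  fixes B :: "real^'k \<Rightarrow> real^'l^'l::finite"
  assumes "\<And>i j. C1_on e V (\<lambda>x. B x $ i $ j)"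
  shows "C1_on e V (\<lambda>x. det (B x))"
  unfolding det_def using assms
  by (intro C1_on_sum C1_on_mult C1_on_const C1_on_prod openin_imp_subset[OF V]) auto

context
  fixes W :: "(real^'k) set" and \<tau> :: "real^'k \<Rightarrow> real^'k" and f :: "real^'k \<Rightarrow> 'b::real_normed_vector"
  assumes W: "openH e W" and \<tau>: "C1_on e V \<tau>" and sub: "\<tau> ` V \<subseteq> W" and f: "C1_on e W f"
begin

lemma has_derivative_compose_openH:
  assumes "x \<in> V"
  shows "((\<lambda>x. f (\<tau> x)) has_derivative (\<lambda>v. dH e f (\<tau> x) (dH e \<tau> x v))) (at x within halfspace e)"
proof -
  have "(\<tau> has_derivative dH e \<tau> x) (at x within V)"
    using C1_on_deriv[OF \<tau> assms] by (simp add: at_within_openH[OF V assms])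
  moreover have "(f has_derivative dH e f (\<tau> x)) (at (\<tau> x) within \<tau> ` V)"
    using C1_on_deriv[OF f, of "\<tau> x"] sub assms
    by (metis (no_types, lifting) W at_within_openH has_derivative_subset image_subset_iff)
  ultimately show ?thesis
    using diff_chain_within[of \<tau> "dH e \<tau> x" x V f] by (simp add: comp_def at_within_openH[OF V assms])
qed

lemma dH_compose: "x \<in> V \<Longrightarrow> dH e (\<lambda>x. f (\<tau> x)) x = (\<lambda>v. dH e f (\<tau> x) (dH e \<tau> x v))"
  by (rule dH_eqI[OF has_derivative_compose_openH]) (use V in \<open>auto intro: openH_subset\<close>)

lemma C1_on_compose: "C1_on e V (\<lambda>x. f (\<tau> x))"
proof (rule C1_onI[OF openin_imp_subset[OF V] has_derivative_compose_openH])
  fix v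
  \<comment> \<open>\<open>C1_on\<close> gives continuity only for a fixed direction, whereas the
    direction \<open>dH e \<tau> x v\<close> moves with \<open>x\<close>. Expanding it in the
    coordinate basis reduces to fixed directions.\<close>
  have "continuous_on V (\<lambda>x. \<Sum>j\<in>UNIV. dH e \<tau> x v $ j *\<^sub>R dH e f (\<tau> x) (axis j 1))"
    by (intro continuous_intros C1_on_continuous_dH[OF \<tau>]
        continuous_on_compose2[OF C1_on_continuous_dH[OF f] C1_on_continuous[OF V \<tau>] sub])
  then show "continuous_on V (\<lambda>x. dH e f (\<tau> x) (dH e \<tau> x v))"
    by (rule continuous_on_eq) (use sub f in \<open>auto simp: linear_axis_expand[OF C1_on_linear, symmetric]\<close>)
qed

end

text \<open>Near each point \<open>f\<close> has a smooth extension \<open>g\<close> to an open set.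
  The full derivative of \<open>g\<close> is also a derivative of \<open>f\<close> within the
  half-space, and such derivatives are unique even at boundary points, so it computes
  \<open>dH\<close> whatever the extension. Order \<open>Suc k\<close> for \<open>g\<close> is order
  \<open>k\<close> for its directional derivatives.\<close>

lemma smooth_on_dH:
  assumes f: "smooth_on V f"
  shows "C1_on e V f" and "smooth_on V (\<lambda>x. dH e f x v)"
proof -
  have loc: "\<exists>U g. open U \<and> x \<in> U \<and> (\<forall>k. Ck_on k U g) \<and>
      (\<forall>y\<in>U \<inter> V. (f has_derivative frechet_derivative g (at y)) (at y within halfspace e))" if x: "x \<in> V" for x
  proof -
    obtain U g where U: "open U" "x \<in> U" "\<And>k. Ck_on k U g" and g: "\<And>y. y \<in> U \<inter> V \<Longrightarrow> g y = f y"
      using f x unfolding smooth_on_def by metis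
    have UV: "openH e (U \<inter> V)"
      using V U(1) by (metis inf_commute openin_Int_open)
    have "(f has_derivative frechet_derivative g (at y)) (at y within halfspace e)" if y: "y \<in> U \<inter> V" for y
    proof -
      have "g differentiable at y" using U(3)[of 1] y by simp
      then have "(g has_derivative frechet_derivative g (at y)) (at y within U \<inter> V)"
        by (simp add: frechet_derivative_works has_derivative_at_withinI)
      then have "(f has_derivative frechet_derivative g (at y)) (at y within U \<inter> V)"
        using g y by (metis has_derivative_transform)
      then show ?thesis using at_within_openH[OF UV y] by simp
    qed
    then show ?thesis using U by blast
  qed
  have eq: "dH e f y = D" if "y \<in> V" "(f has_derivative D) (at y within halfspace e)" for y D
    using that V by (intro dH_eqI) (auto intro: openH_subset)
  show "smooth_on V (\<lambda>x. dH e f x v)" for v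
    unfolding smooth_on_def
  proof
    fix x assume "x \<in> V"
    from loc[OF this] obtain U g where U: "open U" "x \<in> U" "\<And>k. Ck_on k U g"
      "\<And>y. y \<in> U \<inter> V \<Longrightarrow> (f has_derivative frechet_derivative g (at y)) (at y within halfspace e)" by metis
    show "\<exists>U g. open U \<and> x \<in> U \<and> (\<forall>k. Ck_on k U g) \<and> (\<forall>y\<in>U \<inter> V. g y = dH e f y v)"
    proof (intro exI conjI allI ballI)
      show "Ck_on k U (\<lambda>x. frechet_derivative g (at x) v)" for k
        using U(3)[of "Suc k"] by simp
      fix y assume "y \<in> U \<inter> V"
      then show "frechet_derivative g (at y) v = dH e f y v" using eq U(4) by fastforce
    qed (use U in auto)
  qed
  then have sm: "smooth_on V (\<lambda>x. dH e f x v)" for v .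
  show "C1_on e V f"
    unfolding C1_on_def
  proof (intro conjI ballI allI)
    show "f differentiable at x within halfspace e" if "x \<in> V" for x
      using loc[OF that] that by (auto simp: differentiable_def)
    fix v
    show "continuous_on V (\<lambda>x. dH e f x v)"
      unfolding continuous_on_eq_continuous_within
    proof
      fix x assume x: "x \<in> V"
      obtain U g where U: "open U" "x \<in> U" "Ck_on 0 U g" "\<forall>y\<in>U \<inter> V. g y = dH e f y v"
        using sm[of v] x unfolding smooth_on_def by metis
      have "continuous_on (U \<inter> V) g"
        using U(3) by (auto intro: continuous_on_subset)
      then have "continuous_on (U \<inter> V) (\<lambda>x. dH e f x v)"
        by (rule continuous_on_eq) (use U(4) in auto)
      moreover have "at x within U \<inter> V = at x within V"
        by (rule at_within_nhd[of x U]) (use U in auto)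
      ultimately show "continuous (at x within V) (\<lambda>x. dH e f x v)"
        using U(2) x by (metis IntI continuous_on_eq_continuous_within)
    qed
  qed
qed

end

section \<open>Gluing measures\<close>

lemma finite_disjoint_cover:
  assumes "finite D" "\<And>d. d \<in> D \<Longrightarrow> S d \<in> sets N"
  shows "\<exists>P. disjoint_family_on P D \<and> (\<forall>d\<in>D. P d \<in> sets N \<and> P d \<subseteq> S d) \<and> (\<Union>d\<in>D. P d) = (\<Union>d\<in>D. S d)"
  using assms
proof (induction D)
  case empty
  then show ?case by (simp add: disjoint_family_on_def)
next
  case (insert d D)
  then obtain P where P: "disjoint_family_on P D" "\<And>d. d \<in> D \<Longrightarrow> P d \<in> sets N \<and> P d \<subseteq> S d"
      "(\<Union>d\<in>D. P d) = (\<Union>d\<in>D. S d)"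
    by auto
  let ?P = "P(d := S d - (\<Union>d\<in>D. S d))"
  have eq: "?P c = P c" if "c \<in> D" for c using that insert by auto
  have "S d - (\<Union>d\<in>D. S d) \<in> sets N"
    using insert by (intro sets.Diff sets.finite_UN) auto
  moreover have "disjoint_family_on ?P (insert d D)"
    unfolding disjoint_family_on_def
  proof (intro ballI impI)
    fix m n assume mn: "m \<in> insert d D" "n \<in> insert d D" "m \<noteq> n"
    have *: "?P d \<inter> P c = {}" if "c \<in> D" for c
      using P(2)[OF that] that by auto
    show "?P m \<inter> ?P n = {}"
      using mn * P(1) insert(2) by (cases "m = d"; cases "n = d") (auto simp: disjoint_family_on_def)
  qed
  moreover have "(\<Union>c\<in>insert d D. ?P c) = (\<Union>c\<in>insert d D. S c)"
  proof -
    have "(\<Union>c\<in>insert d D. ?P c) = ?P d \<union> (\<Union>c\<in>D. ?P c)"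
      by (rule UN_insert)
    also have "(\<Union>c\<in>D. ?P c) = (\<Union>c\<in>D. P c)"
      by (rule SUP_cong[OF refl eq])
    finally show ?thesis unfolding P(3) by auto
  qed
  moreover have "\<forall>c\<in>insert d D. ?P c \<in> sets N \<and> ?P c \<subseteq> S c"
    using P(2) \<open>S d - (\<Union>d\<in>D. S d) \<in> sets N\<close> by auto
  ultimately show ?case by blast
qed

lemma emeasure_finite_partition:
  assumes "finite D" "disjoint_family_on P D" "\<And>d. d \<in> D \<Longrightarrow> P d \<in> sets \<nu>"
    and "B \<in> sets \<nu>" "B \<subseteq> (\<Union>d\<in>D. P d)"
  shows "emeasure \<nu> B = (\<Sum>d\<in>D. emeasure \<nu> (B \<inter> P d))"
proof -
  have "(\<Sum>d\<in>D. emeasure \<nu> (B \<inter> P d)) = emeasure \<nu> (\<Union>d\<in>D. B \<inter> P d)"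
    using assms by (intro sum_emeasure) (auto simp: disjoint_family_on_def)
  also have "(\<Union>d\<in>D. B \<inter> P d) = B" using assms(5) by auto
  finally show ?thesis ..
qed

text \<open>For existence, the space is cut into finitely many disjoint measurable pieces, each
  inside one \<open>S d\<close>, and the local measures of the pieces are added. For uniqueness, any
  candidate is prescribed on every piece. The conclusion has the shape of the definite descriptions
  of the two measures, and it covers all of \<open>C\<close> although only finitely many indices
  enter the construction.\<close>

theorem glue_measures:
  fixes m :: "'c \<Rightarrow> 'a set \<Rightarrow> ennreal" and S :: "'c \<Rightarrow> 'a set"
  assumes S: "\<And>c. c \<in> C \<Longrightarrow> S c \<inter> space N \<in> sets N"
    and m: "\<And>c. c \<in> C \<Longrightarrow> \<exists>\<nu>. sets \<nu> = sets N \<and> (\<forall>B\<in>sets N. B \<subseteq> S c \<longrightarrow> emeasure \<nu> B = m c B)"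
    and compat: "\<And>c d B. c \<in> C \<Longrightarrow> d \<in> C \<Longrightarrow> B \<in> sets N \<Longrightarrow> B \<subseteq> S c \<Longrightarrow> B \<subseteq> S d \<Longrightarrow> m c B = m d B"
    and D: "finite D" "D \<subseteq> C" "space N \<subseteq> (\<Union>d\<in>D. S d)"
  shows "\<exists>!\<mu>. sets \<mu> = sets N \<and> (\<forall>c\<in>C. \<forall>B\<in>sets \<mu>. B \<subseteq> S c \<longrightarrow> emeasure \<mu> B = m c B)"
proof -
  from m have "\<forall>c\<in>C. \<exists>\<nu>. sets \<nu> = sets N \<and> (\<forall>B\<in>sets N. B \<subseteq> S c \<longrightarrow> emeasure \<nu> B = m c B)" by blast
  from bchoice[OF this] obtain \<nu> where
    \<nu>0: "\<forall>c\<in>C. sets (\<nu> c) = sets N \<and> (\<forall>B\<in>sets N. B \<subseteq> S c \<longrightarrow> emeasure (\<nu> c) B = m c B)"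
    by blast
  have \<nu>: "sets (\<nu> c) = sets N" "\<And>B. B \<in> sets N \<Longrightarrow> B \<subseteq> S c \<Longrightarrow> emeasure (\<nu> c) B = m c B"
    if "c \<in> C" for c
    using \<nu>0 that by blast+
  have SD: "d \<in> D \<Longrightarrow> S d \<inter> space N \<in> sets N" for d using S D(2) by blast
  obtain P where P0: "disjoint_family_on P D \<and> (\<forall>d\<in>D. P d \<in> sets N \<and> P d \<subseteq> S d \<inter> space N) \<and>
      (\<Union>d\<in>D. P d) = (\<Union>d\<in>D. S d \<inter> space N)"
    using finite_disjoint_cover[of D "\<lambda>d. S d \<inter> space N" N, OF D(1) SD] by (rule exE)
  have P: "disjoint_family_on P D" "\<And>d. d \<in> D \<Longrightarrow> P d \<in> sets N \<and> P d \<subseteq> S d \<inter> space N"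
      "(\<Union>d\<in>D. P d) = (\<Union>d\<in>D. S d \<inter> space N)"
    using P0 by blast+
  have cover: "B \<subseteq> (\<Union>d\<in>D. P d)" if "B \<in> sets N" for B
    unfolding P(3) using D(3) sets.sets_into_space[OF that] by auto
  have part: "emeasure \<mu> B = (\<Sum>d\<in>D. emeasure \<mu> (B \<inter> P d))" if "sets \<mu> = sets N" "B \<in> sets N" for \<mu> B
    by (rule emeasure_finite_partition[OF D(1) P(1)])
      (use that P(2) cover[OF that(2)] in \<open>simp_all only:\<close>)
  define F where "F B = (\<Sum>d\<in>D. emeasure (\<nu> d) (B \<inter> P d))" for B
  define \<mu> where "\<mu> = measure_of (space N) (sets N) F"
  have sets_\<mu>: "sets \<mu> = sets N"
    by (simp add: \<mu>_def)
  have "emeasure \<mu> B = F B" if "B \<in> sets N" for B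
  proof (rule emeasure_measure_of[OF \<mu>_def])
    show "positive (sets \<mu>) F" by (simp add: positive_def F_def)
    show "countably_additive (sets \<mu>) F"
    proof (rule countably_additiveI)
      fix Q :: "nat \<Rightarrow> 'a set" assume Q: "range Q \<subseteq> sets \<mu>" "disjoint_family Q"
      have "(\<Sum>i. emeasure (\<nu> d) (Q i \<inter> P d)) = emeasure (\<nu> d) ((\<Union>i. Q i) \<inter> P d)" if "d \<in> D" for d
      proof -
        have s: "sets (\<nu> d) = sets N" using \<nu>(1) D(2) that by blast
        have "range (\<lambda>i. Q i \<inter> P d) \<subseteq> sets (\<nu> d)"
          unfolding s using Q(1) P(2)[OF that] unfolding sets_\<mu> by blast
        moreover have "disjoint_family (\<lambda>i. Q i \<inter> P d)"
          by (rule disjoint_family_on_bisimulation[OF Q(2)]) auto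
        ultimately have "(\<Sum>i. emeasure (\<nu> d) (Q i \<inter> P d)) = emeasure (\<nu> d) (\<Union>i. Q i \<inter> P d)"
          by (rule suminf_emeasure)
        also have "(\<Union>i. Q i \<inter> P d) = (\<Union>i. Q i) \<inter> P d" by blast
        finally show ?thesis .
      qed
      then have "(\<Sum>d\<in>D. \<Sum>i. emeasure (\<nu> d) (Q i \<inter> P d)) = F (\<Union>i. Q i)"
        unfolding F_def by (rule sum.cong[OF refl])
      moreover have "(\<Sum>i. F (Q i)) = (\<Sum>d\<in>D. \<Sum>i. emeasure (\<nu> d) (Q i \<inter> P d))"
        unfolding F_def by (rule suminf_sum) simp
      ultimately show "(\<Sum>i. F (Q i)) = F (\<Union>i. Q i)" by simp
    qed
    show "sets N \<subseteq> Pow (space N)" by (rule sets.space_closed)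
    show "B \<in> sets \<mu>" using that sets_\<mu> by simp
  qed
  note F = this
  \<comment> \<open>A set inside \<open>S c\<close> may meet pieces belonging to other indices
    \<open>d\<close>. On each such intersection \<open>compat\<close> exchanges the measure of
    \<open>d\<close> for that of \<open>c\<close>.\<close>
  have em: "emeasure \<mu> B = m c B" if "c \<in> C" "B \<in> sets N" "B \<subseteq> S c" for c B
  proof -
    have "emeasure \<mu> B = (\<Sum>d\<in>D. emeasure (\<nu> d) (B \<inter> P d))"
      unfolding F[OF that(2)] F_def ..
    also have "\<dots> = (\<Sum>d\<in>D. emeasure (\<nu> c) (B \<inter> P d))"
    proof (rule sum.cong[OF refl])
      fix d assume d: "d \<in> D"
      have B: "B \<inter> P d \<in> sets N" "B \<inter> P d \<subseteq> S d" "B \<inter> P d \<subseteq> S c"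
        using P(2)[OF d] that by auto
      have dC: "d \<in> C" using d D(2) by blast
      have "emeasure (\<nu> d) (B \<inter> P d) = m d (B \<inter> P d)"
        by (rule \<nu>(2)[OF dC B(1,2)])
      also have "\<dots> = m c (B \<inter> P d)"
        by (rule compat[OF dC that(1) B])
      also have "\<dots> = emeasure (\<nu> c) (B \<inter> P d)"
        by (rule \<nu>(2)[OF that(1) B(1,3), symmetric])
      finally show "emeasure (\<nu> d) (B \<inter> P d) = emeasure (\<nu> c) (B \<inter> P d)" .
    qed
    also have "\<dots> = emeasure (\<nu> c) B" by (rule part[OF \<nu>(1)[OF that(1)] that(2), symmetric])
    also have "\<dots> = m c B" by (rule \<nu>(2)[OF that])
    finally show ?thesis .
  qed
  show ?thesis
  proof (rule ex1I[of _ \<mu>])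
    show "sets \<mu> = sets N \<and> (\<forall>c\<in>C. \<forall>B\<in>sets \<mu>. B \<subseteq> S c \<longrightarrow> emeasure \<mu> B = m c B)"
      unfolding sets_\<mu> by (intro conjI refl ballI impI em)
    fix \<mu>' assume \<mu>': "sets \<mu>' = sets N \<and> (\<forall>c\<in>C. \<forall>B\<in>sets \<mu>'. B \<subseteq> S c \<longrightarrow> emeasure \<mu>' B = m c B)"
    show "\<mu>' = \<mu>"
    proof (rule measure_eqI)
      show "sets \<mu>' = sets \<mu>" using \<mu>' sets_\<mu> by simp
      fix B assume "B \<in> sets \<mu>'"
      then have B: "B \<in> sets N" using \<mu>' by simp
      have "emeasure \<mu>' (B \<inter> P d) = emeasure \<mu> (B \<inter> P d)" if d: "d \<in> D" for d
      proof -
        have "B \<inter> P d \<in> sets N" "B \<inter> P d \<subseteq> S d" "d \<in> C" using P(2)[OF d] B d D(2) by auto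
        then show ?thesis using em[of d "B \<inter> P d"] \<mu>' by simp
      qed
      then show "emeasure \<mu>' B = emeasure \<mu> B"
        using part[OF _ B, of \<mu>'] part[OF sets_\<mu> B] \<mu>' by simp
    qed
  qed
qed

section \<open>Gram matrices\<close>

text \<open>The target is an arbitrary inner product space, so that differentials into
  \<open>real^'n\<close> and the block diagonal maps into a product with \<open>real\<close> are
  both covered.\<close>

definition gram :: "(real^'k::finite \<Rightarrow> 'b::real_inner) \<Rightarrow> real^'k^'k" where
  "gram D = (\<chi> i j. D (axis i 1) \<bullet> D (axis j 1))"

lemma gram_nth [simp]: "gram D $ i $ j = D (axis i 1) \<bullet> D (axis j 1)"
  by (simp add: gram_def)

lemma matrix_inv_inverse:
  fixes B :: "real^'k^'k::finite"
  assumes "det B \<noteq> 0"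
  shows "B ** matrix_inv B = mat 1" "matrix_inv B ** B = mat 1"
proof -
  have "\<exists>B'. B ** B' = mat 1 \<and> B' ** B = mat 1"
    using assms invertible_det_nz[of B] by (simp add: invertible_def)
  then have "B ** matrix_inv B = mat 1 \<and> matrix_inv B ** B = mat 1"
    unfolding matrix_inv_def by (rule someI_ex)
  then show "B ** matrix_inv B = mat 1" "matrix_inv B ** B = mat 1" by auto
qed

text \<open>Cramer's rule for the columns of the inverse. It exhibits the entries of the inverse as
  quotients of polynomials in the entries of \<open>B\<close>, from which their differentiability
  follows.\<close>

lemma matrix_inv_cramer:
  fixes B :: "real^'k^'k::finite"
  assumes "det B \<noteq> 0"
  shows "matrix_inv B $ i $ j = det (\<chi> a c. if c = i then axis j 1 $ a else B $ a $ c) / det B"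
proof -
  have "B *v (\<chi> i. matrix_inv B $ i $ j) = axis j 1"
    using arg_cong[OF matrix_inv_inverse(1)[OF assms], of "\<lambda>C. \<chi> i. C $ i $ j"]
    by (simp add: matrix_matrix_mult_def matrix_vector_mult_def vec_eq_iff mat_def axis_def)
  then have "(\<chi> i. matrix_inv B $ i $ j) = (\<chi> k. det (\<chi> a c. if c = k then axis j 1 $ a else B $ a $ c) / det B)"
    using cramer[OF assms] by blast
  then show ?thesis by (simp add: vec_eq_iff)
qed

lemma C1_on_matrix_inv:
  fixes B :: "real^'k \<Rightarrow> real^'l^'l::finite"
  assumes V: "openH e V" and B: "\<And>i j. C1_on e V (\<lambda>x. B x $ i $ j)" and det: "\<And>x. x \<in> V \<Longrightarrow> det (B x) \<noteq> 0"
  shows "C1_on e V (\<lambda>x. matrix_inv (B x) $ i $ j)"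
proof (rule C1_on_cong[OF V])
  show "C1_on e V (\<lambda>x. det (\<chi> a c. if c = i then axis j 1 $ a else B x $ a $ c) / det (B x))"
  proof (intro C1_on_divide[OF V] C1_on_det[OF V] B det)
    fix a c show "C1_on e V (\<lambda>x. (\<chi> a c. if c = i then axis j 1 $ a else B x $ a $ c) $ a $ c)"
      using B C1_on_const[OF openin_imp_subset[OF V]] by (cases "c = i") auto
  qed
qed (simp add: matrix_inv_cramer det)

lemma gram_inner:
  assumes "linear D"
  shows "D v \<bullet> D w = v \<bullet> (gram D *v w)"
proof -
  have "D v \<bullet> D w = (\<Sum>i\<in>UNIV. v $ i *\<^sub>R D (axis i 1)) \<bullet> (\<Sum>j\<in>UNIV. w $ j *\<^sub>R D (axis j 1))"
    using linear_axis_expand[OF assms] by metis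
  also have "\<dots> = v \<bullet> (gram D *v w)"
    by (simp add: inner_sum_left inner_sum_right inner_vec_def matrix_vector_mult_def sum_distrib_left mult_ac)
      (rule sum.swap)
  finally show ?thesis .
qed

text \<open>All matrices on the segment from the identity to the Gram matrix are positive definite,
  hence invertible. The determinant is 1 at the start and has no zero on the way, so by the
  intermediate value theorem it stays positive.\<close>

lemma det_gram_pos:
  assumes "linear D" "inj D"
  shows "0 < det (gram D)"
proof -
  define E where "E t = (1 - t) *\<^sub>R mat 1 + t *\<^sub>R gram D" for t :: real
  have nz: "det (E t) \<noteq> 0" if "t \<in> {0..1}" for t
  proof -
    have "v = 0" if "E t *v v = 0" for v
    proof (rule ccontr)
      assume v: "v \<noteq> 0"
      have "0 = v \<bullet> (E t *v v)" using that by simp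
      also have "E t *v v = (1 - t) *\<^sub>R v + t *\<^sub>R (gram D *v v)"
        by (simp add: E_def matrix_vector_mult_add_rdistrib scaleR_matrix_vector_assoc[symmetric])
      also have "v \<bullet> \<dots> = (1 - t) * (v \<bullet> v) + t * (D v \<bullet> D v)"
        by (simp add: inner_add_right gram_inner[OF assms(1)])
      also have "\<dots> > 0"
      proof -
        have "v \<bullet> v > 0" using v by simp
        moreover have "D v \<noteq> 0" using assms v by (metis inj_eq linear_0)
        then have "D v \<bullet> D v > 0" by simp
        ultimately show ?thesis using \<open>t \<in> {0..1}\<close>
          by (cases "t = 0") (auto intro: add_nonneg_pos)
      qed
      finally show False by simp
    qed
    then have "\<exists>B. B ** E t = mat 1" by (simp add: matrix_left_invertible_ker)
    then show ?thesis using invertible_det_nz invertible_left_inverse by blast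
  qed
  have cont: "continuous_on {0..1} (\<lambda>t. det (E t))"
    unfolding E_def det_def by (intro continuous_intros)
  show ?thesis
  proof (rule ccontr)
    assume "\<not> 0 < det (gram D)"
    then have "det (E 1) \<le> 0" "0 \<le> det (E 0)" by (simp_all add: E_def)
    then obtain t where "0 \<le> t" "t \<le> 1" "det (E t) = 0"
      using IVT2'[of "\<lambda>t. det (E t)" 1 0 0] cont by auto
    then show False using nz by auto
  qed
qed

lemma gram_compose:
  assumes "linear D" "linear P"
  shows "gram (D \<circ> P) = transpose (matrix P) ** gram D ** matrix P"
proof -
  have "D (P (axis i 1)) \<bullet> D (P (axis j 1)) = (transpose (matrix P) ** gram D ** matrix P) $ i $ j" for i j
  proof -
    have "D (P (axis i 1)) \<bullet> D (P (axis j 1)) = P (axis i 1) \<bullet> (gram D *v P (axis j 1))"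
      by (rule gram_inner[OF assms(1)])
    also have "\<dots> = (\<Sum>a\<in>UNIV. P (axis i 1) $ a * (\<Sum>b\<in>UNIV. gram D $ a $ b * P (axis j 1) $ b))"
      by (simp add: inner_vec_def matrix_vector_mult_def)
    also have "\<dots> = (transpose (matrix P) ** gram D ** matrix P) $ i $ j"
      unfolding matrix_matrix_mult_def transpose_def matrix_def vec_lambda_beta
      by (simp add: sum_distrib_left sum_distrib_right mult_ac) (rule sum.swap)
    finally show ?thesis .
  qed
  then show ?thesis by (simp add: vec_eq_iff)
qed

lemma sqrt_det_gram_compose:
  assumes "linear D" "linear P"
  shows "sqrt (det (gram (D \<circ> P))) = \<bar>det (matrix P)\<bar> * sqrt (det (gram D))"
  by (simp add: gram_compose[OF assms] det_mul real_sqrt_mult)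

section \<open>The dual metric on covectors and the raising of indices\<close>

definition copair :: "(real^'k::finite \<Rightarrow> 'b::real_inner) \<Rightarrow> (real^'k \<Rightarrow> real) \<Rightarrow> (real^'k \<Rightarrow> real) \<Rightarrow> real" where
  "copair D a b = (\<Sum>i\<in>UNIV. a (axis i 1) * (\<Sum>j\<in>UNIV. matrix_inv (gram D) $ i $ j * b (axis j 1)))"

text \<open>The vector obtained from the covector \<open>b\<close> by raising its index. If
  \<open>b\<close> is the differential of a function, this is its gradient in coordinates, and
  \<open>copair\<close> is the inner product of two gradients.\<close>

definition sharp :: "(real^'k::finite \<Rightarrow> 'b::real_inner) \<Rightarrow> (real^'k \<Rightarrow> real) \<Rightarrow> real^'k" where
  "sharp D b = (\<chi> i. \<Sum>j\<in>UNIV. matrix_inv (gram D) $ i $ j * b (axis j 1))"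

context
  fixes D :: "real^'k::finite \<Rightarrow> 'b::real_inner"
  assumes D: "linear D" "inj D"
begin

lemma sharp_inner:
  assumes "linear b" shows "D (sharp D b) \<bullet> D v = b v"
proof -
  have "gram D *v sharp D b = (gram D ** matrix_inv (gram D)) *v (\<chi> j. b (axis j 1))"
    unfolding matrix_vector_mul_assoc[symmetric]
    by (rule arg_cong[where f = "\<lambda>w. gram D *v w"]) (simp add: sharp_def matrix_vector_mult_def)
  then have "gram D *v sharp D b = (\<chi> j. b (axis j 1))"
    using matrix_inv_inverse[of "gram D"] det_gram_pos[OF D] by simp
  then have "D v \<bullet> D (sharp D b) = (\<Sum>j\<in>UNIV. v $ j * b (axis j 1))"
    by (simp add: gram_inner[OF D(1)] inner_vec_def)
  then show ?thesis
    using linear_axis_expand[OF assms, of v] by (simp add: inner_commute)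
qed

text \<open>Allows a raised covector to be recognised from inner products alone, without inverting
  the Gram matrix.\<close>

lemma sharp_unique:
  assumes "linear b" "\<And>v. D u \<bullet> D v = b v"
  shows "u = sharp D b"
proof -
  have "(D u - D (sharp D b)) \<bullet> D v = 0" for v
    using assms(2)[of v] sharp_inner[OF assms(1), of v] by (simp add: inner_diff_left)
  from this[of "u - sharp D b"] have "D u = D (sharp D b)"
    by (simp add: linear_diff[OF D(1)])
  then show ?thesis using D(2) by (simp add: inj_eq)
qed

lemma copair_eq_sharp:
  assumes "linear a" shows "copair D a b = a (sharp D b)"
  using linear_axis_expand[OF assms, of "sharp D b"] by (simp add: copair_def sharp_def mult.commute)

lemma copair_sym:
  assumes "linear a" "linear b" shows "copair D a b = copair D b a"
proof -
  have "copair D a b = D (sharp D a) \<bullet> D (sharp D b)"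
    by (simp only: copair_eq_sharp[OF assms(1)] sharp_inner[OF assms(1)])
  also have "\<dots> = D (sharp D b) \<bullet> D (sharp D a)" by (rule inner_commute)
  also have "\<dots> = copair D b a"
    by (simp only: copair_eq_sharp[OF assms(2)] sharp_inner[OF assms(2)])
  finally show ?thesis .
qed

end

text \<open>Coordinate independence of the dual metric. The preimage under \<open>P\<close> of the
  raised covector has the inner products that characterise the raised covector in the new
  coordinates, so it is that vector by \<open>sharp_unique\<close>.\<close>

lemma copair_compose:
  fixes D :: "real^'k::finite \<Rightarrow> 'b::real_inner" and P :: "real^'k \<Rightarrow> real^'k"
  assumes D: "linear D" "inj D"  and a: "linear a" and b: "linear b" and P: "linear P" "inj P"
  shows "copair (D \<circ> P) (a \<circ> P) (b \<circ> P) = copair D a b"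
proof -
  note DP = linear_compose[OF P(1) D(1)] inj_compose[OF D(2) P(2)]
  note lin = linear_compose[OF P(1) a] linear_compose[OF P(1) b]
  from linear_injective_imp_surjective[OF P] have "surj P" by simp
  then have "sharp D b \<in> range P" by simp
  then obtain u where u: "sharp D b = P u" by (rule imageE)
  have "(D \<circ> P) u \<bullet> (D \<circ> P) v = (b \<circ> P) v" for v
    using sharp_inner[OF D b, of "P v"] u by simp
  then have "u = sharp (D \<circ> P) (b \<circ> P)"
    by (rule sharp_unique[OF DP lin(2)])
  then show ?thesis
    using copair_eq_sharp[OF DP lin(1)] copair_eq_sharp[OF D a] u by simp
qed

section \<open>Charts of an immersed hypersurface\<close>

definition overlap :: "'a set \<Rightarrow> ('a \<Rightarrow> 'm) \<Rightarrow> 'b set \<Rightarrow> ('b \<Rightarrow> 'm) \<Rightarrow> 'a set" where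
  "overlap V \<psi> W \<theta> = V \<inter> \<psi> -` (\<theta> ` W)"

definition transition :: "'b set \<Rightarrow> ('b \<Rightarrow> 'm) \<Rightarrow> ('a \<Rightarrow> 'm) \<Rightarrow> 'a \<Rightarrow> 'b" where
  "transition W \<theta> \<psi> x = inv_into W \<theta> (\<psi> x)"

locale immersed_hypersurface =
  fixes e :: "'k::finite" and M :: "'m::t2_space set" and A :: "('m, 'k) chart set"
    and X :: "'m \<Rightarrow> real^'n"
  assumes hyp: "compact_immersed_hypersurface e M A X"
begin

lemma compact_M: "compact M"
  using hyp by (simp add: compact_immersed_hypersurface_def)

lemma chart:
  assumes "(V, \<psi>) \<in> A"
  shows "openH e V" and "openin (top_of_set M) (\<psi> ` V)" and "continuous_on V \<psi>" and "inj_on \<psi> V"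
    and "continuous_on (\<psi> ` V) (inv_into V \<psi>)" and "\<psi> ` V \<subseteq> M"
proof -
  have at: "smooth_atlas e M A" using hyp by (simp add: compact_immersed_hypersurface_def)
  then show V: "openH e V" and im: "openin (top_of_set M) (\<psi> ` V)"
    using assms unfolding smooth_atlas_def by fast+
  obtain \<phi> where h: "homeomorphism V (\<psi> ` V) \<psi> \<phi>"
    using at assms unfolding smooth_atlas_def by fast
  then show "continuous_on V \<psi>" by (rule homeomorphism_cont1)
  show inj: "inj_on \<psi> V"
    by (rule inj_on_inverseI[where g = \<phi>]) (rule homeomorphism_apply1[OF h])
  have "continuous_on (\<psi> ` V) \<phi>" using h by (rule homeomorphism_cont2)
  then show "continuous_on (\<psi> ` V) (inv_into V \<psi>)"
    by (rule continuous_on_eq) (use h inj in \<open>auto simp: homeomorphism_apply1\<close>)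
  show "\<psi> ` V \<subseteq> M" using im by (rule openin_imp_subset)
qed

lemma chart_at:
  assumes "p \<in> M" obtains V \<psi> x where "(V, \<psi>) \<in> A" "x \<in> V" "p = \<psi> x"
proof -
  have "(\<Union>(V, \<psi>)\<in>A. \<psi> ` V) = M"
    using hyp unfolding compact_immersed_hypersurface_def smooth_atlas_def by blast
  then show thesis using assms that by blast
qed

lemma C1_param:
  assumes "(V, \<psi>) \<in> A"
  shows "C1_on e V (X \<circ> \<psi>)" and "C1_on e V (\<lambda>x. dH e (X \<circ> \<psi>) x v)"
    and "x \<in> V \<Longrightarrow> linear (dH e (X \<circ> \<psi>) x)" and "x \<in> V \<Longrightarrow> inj (dH e (X \<circ> \<psi>) x)"
proof -
  have imm: "immersion A X" using hyp by (simp add: compact_immersed_hypersurface_def)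
  then have sm: "smooth_on V (X \<circ> \<psi>)" using assms unfolding immersion_def smooth_map_def by fast
  note V = chart(1)[OF assms]
  show C1: "C1_on e V (X \<circ> \<psi>)" by (rule smooth_on_dH(1)[OF V sm])
  show "C1_on e V (\<lambda>x. dH e (X \<circ> \<psi>) x v)"
    by (rule smooth_on_dH(1)[OF V smooth_on_dH(2)[OF V sm]])
  show "x \<in> V \<Longrightarrow> linear (dH e (X \<circ> \<psi>) x)" by (rule C1_on_linear[OF C1])
  assume x: "x \<in> V"
  have "inj (frechet_derivative (X \<circ> \<psi>) (at x within V))"
    using imm assms x unfolding immersion_def by fast
  then show "inj (dH e (X \<circ> \<psi>) x)" by (simp add: at_within_openH[OF V x])
qed

context
  fixes V W :: "(real^'k) set" and \<psi> \<theta> :: "real^'k \<Rightarrow> 'm"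
  assumes c: "(V, \<psi>) \<in> A" and d: "(W, \<theta>) \<in> A"
begin

lemma openH_overlap: "openH e (overlap V \<psi> W \<theta>)"
proof -
  have "openin (top_of_set V) (V \<inter> \<psi> -` (\<theta> ` W))"
    by (rule continuous_openin_preimage[OF chart(3)[OF c] _ chart(2)[OF d]]) (use chart(6)[OF c] in auto)
  then show ?thesis
    unfolding overlap_def using chart(1)[OF c] by (rule openin_trans)
qed

lemma transition_apply:
  assumes "x \<in> overlap V \<psi> W \<theta>"
  shows "transition W \<theta> \<psi> x \<in> W" and "\<theta> (transition W \<theta> \<psi> x) = \<psi> x"
    and "transition W \<theta> \<psi> x \<in> overlap W \<theta> V \<psi>"
    and "transition V \<psi> \<theta> (transition W \<theta> \<psi> x) = x"
proof -
  have x: "x \<in> V" "\<psi> x \<in> \<theta> ` W" using assms by (auto simp: overlap_def)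
  show 1: "transition W \<theta> \<psi> x \<in> W" and 2: "\<theta> (transition W \<theta> \<psi> x) = \<psi> x"
    unfolding transition_def using x by (auto intro: inv_into_into f_inv_into_f)
  show "transition W \<theta> \<psi> x \<in> overlap W \<theta> V \<psi>" using 1 2 x by (auto simp: overlap_def)
  show "transition V \<psi> \<theta> (transition W \<theta> \<psi> x) = x"
    using 2 x chart(4)[OF c] by (simp add: transition_def[of V])
qed

lemma transition_unique:
  assumes "y \<in> W" "\<theta> y = \<psi> x" shows "transition W \<theta> \<psi> x = y"
  using inv_into_f_f[OF chart(4)[OF d] assms(1)] assms(2) by (simp add: transition_def)

lemma C1_transition: "C1_on e (overlap V \<psi> W \<theta>) (transition W \<theta> \<psi>)"
proof -
  have "smooth_on (V \<inter> \<psi> -` (\<theta> ` W)) (\<lambda>x. inv_into W \<theta> (\<psi> x))"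
    using hyp c d unfolding compact_immersed_hypersurface_def smooth_atlas_def by fast
  then show ?thesis
    using smooth_on_dH(1)[OF openH_overlap] by (simp add: overlap_def transition_def[abs_def])
qed

lemma chart_change:
  fixes f :: "'m \<Rightarrow> 'b::real_normed_vector"
  assumes f: "C1_on e W (f \<circ> \<theta>)"
  shows "C1_on e (overlap V \<psi> W \<theta>) (f \<circ> \<psi>)"
    and "x \<in> overlap V \<psi> W \<theta> \<Longrightarrow>
      dH e (f \<circ> \<psi>) x = dH e (f \<circ> \<theta>) (transition W \<theta> \<psi> x) \<circ> dH e (transition W \<theta> \<psi>) x"
proof -
  let ?O = "overlap V \<psi> W \<theta>" and ?t = "transition W \<theta> \<psi>"
  have sub: "?t ` ?O \<subseteq> W" using transition_apply(1) by auto
  have eq: "(f \<circ> \<theta>) (?t y) = (f \<circ> \<psi>) y" if "y \<in> ?O" for y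
    using transition_apply(2)[OF that] by simp
  show "C1_on e ?O (f \<circ> \<psi>)"
    by (rule C1_on_cong[OF openH_overlap C1_on_compose[OF openH_overlap chart(1)[OF d] C1_transition sub f] eq])
  assume x: "x \<in> ?O"
  have "dH e (f \<circ> \<psi>) x = dH e (\<lambda>y. (f \<circ> \<theta>) (?t y)) x"
    by (rule dH_cong[OF openH_overlap x eq[symmetric]])
  also have "\<dots> = (\<lambda>v. dH e (f \<circ> \<theta>) (?t x) (dH e ?t x v))"
    by (rule dH_compose[OF openH_overlap chart(1)[OF d] C1_transition sub f x])
  finally show "dH e (f \<circ> \<psi>) x = dH e (f \<circ> \<theta>) (?t x) \<circ> dH e ?t x"
    by (simp add: fun_eq_iff)
qed

text \<open>The differential of \<open>X \<circ> \<psi>\<close> is injective and factors through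
  that of the transition map, which is therefore injective too.\<close>

lemma dH_transition:
  assumes "x \<in> overlap V \<psi> W \<theta>"
  shows "linear (dH e (transition W \<theta> \<psi>) x)" and "inj (dH e (transition W \<theta> \<psi>) x)"
proof -
  show "linear (dH e (transition W \<theta> \<psi>) x)"
    by (rule C1_on_linear[OF C1_transition assms])
  have "inj (dH e (X \<circ> \<psi>) x)" using C1_param(4)[OF c] assms by (simp add: overlap_def)
  then show "inj (dH e (transition W \<theta> \<psi>) x)"
    unfolding chart_change(2)[OF C1_param(1)[OF d] assms] by (rule inj_on_imageI2)
qed

text \<open>If an interior point were sent to the boundary, the normal coordinate of the transition map
  would have a critical point there, contradicting the invertibility of its derivative.\<close>

lemma transition_interior:
  assumes x: "x \<in> overlap V \<psi> W \<theta>" "0 < x $ e"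
  shows "0 < transition W \<theta> \<psi> x $ e"
proof (rule ccontr)
  let ?O = "overlap V \<psi> W \<theta>" and ?t = "transition W \<theta> \<psi>"
  assume "\<not> 0 < ?t x $ e"
  have nonneg: "0 \<le> ?t y $ e" if "y \<in> ?O" for y
    using openH_subset[OF chart(1)[OF d] transition_apply(1)[OF that]] by (simp add: halfspace_def)
  then have zero: "?t x $ e = 0" using \<open>\<not> 0 < ?t x $ e\<close> nonneg[OF x(1)] by linarith
  obtain T where T: "open T" "?O = halfspace e \<inter> T"
    using openH_overlap unfolding openin_open by blast
  let ?U = "{y :: real^'k. 0 < y $ e} \<inter> T"
  have "open {y :: real^'k. 0 < y $ e}" by (intro open_Collect_less continuous_intros)
  then have U1: "open ?U" using T(1) by (rule open_Int)
  have "x \<in> T" using x(1) T(2) by blast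
  then have U: "open ?U" "x \<in> ?U" "?U \<subseteq> ?O"
    unfolding T(2) halfspace_def using x(2) U1 by auto
  have "at x within ?O = at x"
    by (rule at_within_interior) (use U in \<open>auto intro: interiorI\<close>)
  then have "(?t has_derivative dH e ?t x) (at x)"
    using C1_on_deriv[OF C1_transition x(1)] at_within_openH[OF openH_overlap x(1)] by simp
  then have "((\<lambda>y. ?t y $ e) has_derivative (\<lambda>v. dH e ?t x v $ e)) (at x)"
    by (rule bounded_linear.has_derivative[OF bounded_linear_vec_nth])
  then have "(\<lambda>v. dH e ?t x v $ e) = (\<lambda>v. 0)"
    using U nonneg zero by (intro differential_zero_maxmin[of x ?U]) auto
  then have zero: "dH e ?t x v $ e = 0" for v by (rule fun_cong)
  have "surj (dH e ?t x)"
    using linear_injective_imp_surjective[OF dH_transition[OF x(1)]] by simp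
  then have "axis e 1 \<in> range (dH e ?t x)" by simp
  then obtain v where "axis e 1 = dH e ?t x v" by (rule imageE)
  then show False using zero[of v] axis_nth[of e "1 :: real"] by simp
qed

end

text \<open>Interior points go to interior points under the transition map and under its inverse.
  Consequently membership in \<open>mboundary\<close>, a union over all charts, can be tested in any
  single chart.\<close>

lemma transition_boundary:
  assumes "(V, \<psi>) \<in> A" "(W, \<theta>) \<in> A" "x \<in> overlap V \<psi> W \<theta>"
  shows "transition W \<theta> \<psi> x $ e = 0 \<longleftrightarrow> x $ e = 0"
proof -
  note t = transition_apply[OF assms]
  have "x \<in> halfspace e" "transition W \<theta> \<psi> x \<in> halfspace e"
    by (rule openH_subset[OF openH_overlap[OF assms(1,2)] assms(3)],
        rule openH_subset[OF openH_overlap[OF assms(2,1)] t(3)])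
  moreover have "0 < transition W \<theta> \<psi> x $ e" if "0 < x $ e"
    using transition_interior[OF assms] that by simp
  moreover have "0 < x $ e" if "0 < transition W \<theta> \<psi> x $ e"
    using transition_interior[OF assms(2,1) t(3) that] t(4) by simp
  ultimately show ?thesis by (fastforce simp: halfspace_def)
qed

lemma mboundary_iff:
  assumes "(V, \<psi>) \<in> A" "x \<in> V"
  shows "\<psi> x \<in> mboundary e A \<longleftrightarrow> x $ e = 0"
proof
  assume "\<psi> x \<in> mboundary e A"
  then obtain W \<theta> y where d: "(W, \<theta>) \<in> A" "y \<in> W" "y $ e = 0" "\<psi> x = \<theta> y"
    by (auto simp: mboundary_def)
  then have x: "x \<in> overlap V \<psi> W \<theta>" using assms by (auto simp: overlap_def)
  have "transition W \<theta> \<psi> x = y" by (rule transition_unique[OF assms(1) d(1,2) d(4)[symmetric]])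
  then show "x $ e = 0" using transition_boundary[OF assms(1) d(1) x] d(3) by simp
qed (use assms in \<open>auto simp: mboundary_def\<close>)

lemma mboundary_subset: "mboundary e A \<subseteq> M"
  using chart(6) unfolding mboundary_def by fast

end

section \<open>The measures on the hypersurface and on its boundary\<close>

lemma borel_openH: "openH e V \<Longrightarrow> V \<in> sets borel"
  by (metis (no_types) borel_closed borel_open closed_halfspace openin_open sets.Int)

text \<open>The pushforward of a density, as a measure on the Borel sets of \<open>S\<close>. The
  base measure and the domain are parameters because two cases occur: \<open>lborel\<close> on a
  chart domain, and the hyperplane measure on its face.\<close>

definition chart_measure :: "'a::topological_space measure \<Rightarrow> 'a set \<Rightarrow> ('a \<Rightarrow> 'm::topological_space)
    \<Rightarrow> ('a \<Rightarrow> real) \<Rightarrow> 'm set \<Rightarrow> 'm measure" where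
  "chart_measure l V \<psi> \<rho> S =
     distr (density (restrict_space l V) (\<lambda>x. ennreal (\<rho> x))) (restrict_space borel S) \<psi>"

lemma sets_chart_measure [simp]: "sets (chart_measure l V \<psi> \<rho> S) = sets (restrict_space borel S)"
  by (simp add: chart_measure_def)

context
  fixes l :: "'a::topological_space measure" and V :: "'a set"
    and \<psi> :: "'a \<Rightarrow> 'm::topological_space" and \<rho> :: "'a \<Rightarrow> real" and S :: "'m set"
  assumes l [measurable_cong]: "sets l = sets borel" and V: "V \<in> sets borel" and \<psi>: "continuous_on V \<psi>"
    and im: "\<psi> ` V \<subseteq> S" and \<rho>: "continuous_on V \<rho>" and \<rho>0: "\<And>x. x \<in> V \<Longrightarrow> 0 \<le> \<rho> x"
begin

lemma space_l: "space l = UNIV"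
  using sets_eq_imp_space_eq[OF l] by simp

lemma measurable_chart: "\<psi> \<in> restrict_space l V \<rightarrow>\<^sub>M restrict_space borel S"
proof (rule measurable_restrict_space2)
  show "\<psi> \<in> space (restrict_space l V) \<rightarrow> S" using im by (auto simp: space_restrict_space)
  have "sets (restrict_space l V) = sets (restrict_space borel V)"
    by (rule sets_restrict_space_cong[OF l])
  then show "\<psi> \<in> restrict_space l V \<rightarrow>\<^sub>M borel"
    using borel_measurable_continuous_on_restrict[OF \<psi>] by (simp cong: measurable_cong_sets)
qed

lemma measurable_density: "\<rho> \<in> borel_measurable (restrict_space l V)"
proof -
  have "sets (restrict_space l V) = sets (restrict_space borel V)"
    by (rule sets_restrict_space_cong[OF l])
  then show ?thesis
    using borel_measurable_continuous_on_restrict[OF \<rho>] by (simp cong: measurable_cong_sets)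
qed

lemma measurable_vimage_chart:
  assumes "B \<in> sets (restrict_space borel S)" shows "V \<inter> \<psi> -` B \<in> sets borel"
proof -
  have "\<psi> -` B \<inter> space (restrict_space l V) \<in> sets (restrict_space l V)"
    by (rule measurable_sets[OF measurable_chart assms])
  then have "\<psi> -` B \<inter> V \<in> sets (restrict_space l V)"
    by (simp add: space_restrict_space space_l)
  then show ?thesis
    using V l by (simp add: sets_restrict_space_iff space_l Int_commute)
qed

lemma emeasure_chart_measure:
  assumes B: "B \<in> sets (restrict_space borel S)"
  shows "emeasure (chart_measure l V \<psi> \<rho> S) B =
    (\<integral>\<^sup>+x. ennreal (\<rho> x) * indicator (V \<inter> \<psi> -` B) x \<partial>l)"
proof -
  have m: "\<psi> \<in> density (restrict_space l V) (\<lambda>x. ennreal (\<rho> x)) \<rightarrow>\<^sub>M restrict_space borel S"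
    using measurable_chart by simp
  have *: "\<psi> -` B \<inter> space (restrict_space l V) \<in> sets (restrict_space l V)"
    by (rule measurable_sets[OF measurable_chart B])
  have V': "V \<inter> space l \<in> sets l" using V l by (simp add: space_l)
  have "emeasure (chart_measure l V \<psi> \<rho> S) B =
      (\<integral>\<^sup>+x. ennreal (\<rho> x) * indicator (\<psi> -` B \<inter> space (restrict_space l V)) x \<partial>restrict_space l V)"
    unfolding chart_measure_def using measurable_density *
    by (subst emeasure_distr[OF m B]) (simp add: emeasure_density)
  also have "\<dots> = (\<integral>\<^sup>+x. ennreal (\<rho> x) * indicator (\<psi> -` B \<inter> space (restrict_space l V)) x * indicator V x \<partial>l)"
    by (rule nn_integral_restrict_space[OF V'])
  also have "\<dots> = (\<integral>\<^sup>+x. ennreal (\<rho> x) * indicator (V \<inter> \<psi> -` B) x \<partial>l)"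
    by (rule nn_integral_cong) (auto simp: indicator_def space_restrict_space space_l)
  finally show ?thesis .
qed

lemma integral_chart_measure:
  fixes h :: "'m \<Rightarrow> real"
  assumes h: "h \<in> borel_measurable (restrict_space borel S)"
  shows "(\<integral>p. h p \<partial>chart_measure l V \<psi> \<rho> S) = (\<integral>x. indicator V x * (\<rho> x * h (\<psi> x)) \<partial>l)"
    and "integrable (chart_measure l V \<psi> \<rho> S) h \<longleftrightarrow> integrable l (\<lambda>x. indicator V x * (\<rho> x * h (\<psi> x)))"
proof -
  have m: "\<psi> \<in> density (restrict_space l V) (\<lambda>x. ennreal (\<rho> x)) \<rightarrow>\<^sub>M restrict_space borel S"
    using measurable_chart by simp
  have V': "V \<inter> space l \<in> sets l" using V l by (simp add: space_l)
  have nn: "AE x in restrict_space l V. 0 \<le> \<rho> x"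
    using \<rho>0 by (intro AE_I2) (auto simp: space_restrict_space)
  note hm = measurable_compose[OF measurable_chart h]
  show "(\<integral>p. h p \<partial>chart_measure l V \<psi> \<rho> S) = (\<integral>x. indicator V x * (\<rho> x * h (\<psi> x)) \<partial>l)"
    unfolding chart_measure_def
    by (simp add: integral_distr[OF m h] integral_density[OF hm measurable_density nn]
       integral_restrict_space[OF V'])
  show "integrable (chart_measure l V \<psi> \<rho> S) h \<longleftrightarrow> integrable l (\<lambda>x. indicator V x * (\<rho> x * h (\<psi> x)))"
    unfolding chart_measure_def
    by (simp add: integrable_distr_eq[OF m h] integrable_density[OF hm measurable_density nn]
       integrable_restrict_space[OF V'])
qed

end

text \<open>The two measures have the same restriction to \<open>T\<close>, and only this
  restriction is seen by a function vanishing off \<open>T\<close>. In this way an integral over the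
  hypersurface is computed in one chart.\<close>

lemma integral_eq_local:
  fixes h :: "'a \<Rightarrow> real"
  assumes sets: "sets \<mu> = sets \<nu>" and T: "T \<in> sets \<nu>"
    and em: "\<And>B. B \<in> sets \<nu> \<Longrightarrow> B \<subseteq> T \<Longrightarrow> emeasure \<mu> B = emeasure \<nu> B"
    and h: "\<And>p. p \<in> space \<nu> \<Longrightarrow> p \<notin> T \<Longrightarrow> h p = 0"
  shows "integral\<^sup>L \<mu> h = integral\<^sup>L \<nu> h" and "integrable \<mu> h \<longleftrightarrow> integrable \<nu> h"
proof -
  have sp: "space \<mu> = space \<nu>" by (rule sets_eq_imp_space_eq[OF sets])
  have T': "T \<inter> space \<mu> \<in> sets \<mu>" "T \<inter> space \<nu> \<in> sets \<nu>" using T sets sp by auto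
  have r: "restrict_space \<mu> T = restrict_space \<nu> T"
  proof (rule measure_eqI)
    show "sets (restrict_space \<mu> T) = sets (restrict_space \<nu> T)"
      by (rule sets_restrict_space_cong[OF sets])
    fix B assume "B \<in> sets (restrict_space \<mu> T)"
    then have "B \<in> sets \<nu>" "B \<subseteq> T" using T sets by (auto simp: sets_restrict_space_iff[OF T'(1)])
    then show "emeasure (restrict_space \<mu> T) B = emeasure (restrict_space \<nu> T) B"
      using T' em by (simp add: emeasure_restrict_space)
  qed
  have i: "indicator T p *\<^sub>R h p = h p" if "p \<in> space \<nu>" for p
    using h[OF that] by (auto simp: indicator_def)
  have "integral\<^sup>L \<mu> h = (\<integral>p. indicator T p *\<^sub>R h p \<partial>\<mu>)"
    by (rule Bochner_Integration.integral_cong[OF refl]) (simp only: i sp)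
  also have "\<dots> = (\<integral>p. indicator T p *\<^sub>R h p \<partial>\<nu>)"
    using r integral_restrict_space[OF T'(1), of h] integral_restrict_space[OF T'(2), of h] by simp
  also have "\<dots> = integral\<^sup>L \<nu> h"
    by (rule Bochner_Integration.integral_cong[OF refl]) (simp only: i)
  finally show "integral\<^sup>L \<mu> h = integral\<^sup>L \<nu> h" .
  have "integrable \<mu> h \<longleftrightarrow> integrable \<mu> (\<lambda>p. indicator T p *\<^sub>R h p)"
    by (rule Bochner_Integration.integrable_cong[OF refl]) (simp only: i sp)
  also have "\<dots> \<longleftrightarrow> integrable \<nu> (\<lambda>p. indicator T p *\<^sub>R h p)"
    using r integrable_restrict_space[OF T'(1), of h] integrable_restrict_space[OF T'(2), of h] by simp
  also have "\<dots> \<longleftrightarrow> integrable \<nu> h"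
    by (rule Bochner_Integration.integrable_cong[OF refl]) (simp only: i)
  finally show "integrable \<mu> h \<longleftrightarrow> integrable \<nu> h" .
qed

text \<open>The boundary metric is the Gram matrix of the differential made block diagonal, which turns
  it into an instance of the same construction as the metric itself.\<close>

definition boundary_extend :: "'k::finite \<Rightarrow> (real^'k \<Rightarrow> 'b::real_vector) \<Rightarrow> real^'k \<Rightarrow> real \<times> 'b" where
  "boundary_extend e D v = (v $ e, D (drop_coord e v))"

lemma linear_boundary_extend: "linear D \<Longrightarrow> linear (boundary_extend e D)"
  using linear_drop_coord[of e]
  by (intro linearI) (simp_all add: boundary_extend_def linear_add linear_cmul)

lemma drop_coord_eqD: "drop_coord e v = drop_coord e w \<Longrightarrow> v $ e = w $ e \<Longrightarrow> v = w"
  by (auto simp: drop_coord_def vec_eq_iff) metis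

lemma inj_boundary_extend: "inj D \<Longrightarrow> inj (boundary_extend e D)"
  by (rule injI) (auto simp: boundary_extend_def inj_eq intro: drop_coord_eqD)

lemma drop_coord_axis: "drop_coord e (axis i c) = (if i = e then 0 else axis i c)"
  by (auto simp: drop_coord_def axis_def vec_eq_iff)

section \<open>Densities of the volume and boundary measures in a chart, and their
  transformation\<close>

context immersed_hypersurface
begin

definition Dpar :: "(real^'k \<Rightarrow> 'm) \<Rightarrow> real^'k \<Rightarrow> real^'k \<Rightarrow> real^'n" where
  "Dpar \<psi> x = dH e (X \<circ> \<psi>) x"

definition vdens :: "(real^'k \<Rightarrow> 'm) \<Rightarrow> real^'k \<Rightarrow> real" where
  "vdens \<psi> x = sqrt (det (gram (Dpar \<psi> x)))"

text \<open>The formula makes sense on the whole chart domain and not just on the face, where it is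
  the boundary density. Continuity can thus be stated on the chart domain.\<close>

definition bdens :: "(real^'k \<Rightarrow> 'm) \<Rightarrow> real^'k \<Rightarrow> real" where
  "bdens \<psi> x = sqrt (det (gram (boundary_extend e (Dpar \<psi> x))))"

lemma Dpar:
  assumes "(V, \<psi>) \<in> A" "x \<in> V" shows "linear (Dpar \<psi> x)" "inj (Dpar \<psi> x)"
  using C1_param(3,4)[OF assms(1)] assms(2) by (simp_all add: Dpar_def)

lemma induced_metric_eq:
  assumes "(V, \<psi>) \<in> A" "x \<in> V" shows "induced_metric V (X \<circ> \<psi>) x = gram (Dpar \<psi> x)"
  by (simp add: induced_metric_def gram_def Dpar_def partial_eq_dH[OF chart(1)[OF assms(1)] assms(2)])

lemma boundary_metric_eq:
  assumes "(V, \<psi>) \<in> A" "x \<in> V"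
  shows "boundary_metric e V (X \<circ> \<psi>) x = gram (boundary_extend e (Dpar \<psi> x))"
proof -
  have ax: "axis i (1 :: real) $ e = (if i = e then 1 else 0)" for i :: 'k
    by (simp add: axis_def)
  have D0: "Dpar \<psi> x 0 = 0" by (rule linear_0[OF Dpar(1)[OF assms]])
  have "boundary_metric e V (X \<circ> \<psi>) x $ i $ j = gram (boundary_extend e (Dpar \<psi> x)) $ i $ j" for i j
    unfolding boundary_metric_def induced_metric_eq[OF assms] gram_nth boundary_extend_def
    by (cases "i = e"; cases "j = e") (auto simp: drop_coord_axis ax D0)
  then show ?thesis by (simp add: vec_eq_iff)
qed

lemma C1_gram:
  assumes "(V, \<psi>) \<in> A"
  shows "C1_on e V (\<lambda>x. gram (Dpar \<psi> x) $ i $ j)"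
    and "C1_on e V (\<lambda>x. gram (boundary_extend e (Dpar \<psi> x)) $ i $ j)"
proof -
  note V = chart(1)[OF assms]
  show "C1_on e V (\<lambda>x. gram (Dpar \<psi> x) $ i $ j)"
    unfolding gram_nth Dpar_def by (intro C1_on_inner[OF V] C1_param(2)[OF assms])
  show "C1_on e V (\<lambda>x. gram (boundary_extend e (Dpar \<psi> x)) $ i $ j)"
    unfolding gram_nth Dpar_def boundary_extend_def inner_Pair fst_conv snd_conv
    by (intro C1_on_add[OF V] C1_on_inner[OF V] C1_param(2)[OF assms] C1_on_const[OF openin_imp_subset[OF V]])
qed

lemma dens_pos:
  assumes "(V, \<psi>) \<in> A" "x \<in> V"
  shows "0 < det (gram (Dpar \<psi> x))" and "0 < det (gram (boundary_extend e (Dpar \<psi> x)))"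
    and "0 < vdens \<psi> x" and "0 < bdens \<psi> x"
proof -
  note D = Dpar[OF assms]
  show 1: "0 < det (gram (Dpar \<psi> x))" by (rule det_gram_pos[OF D])
  show 2: "0 < det (gram (boundary_extend e (Dpar \<psi> x)))"
    by (rule det_gram_pos[OF linear_boundary_extend[OF D(1)] inj_boundary_extend[OF D(2)]])
  show "0 < vdens \<psi> x" "0 < bdens \<psi> x" using 1 2 by (simp_all add: vdens_def bdens_def)
qed

lemma C1_dens:
  assumes "(V, \<psi>) \<in> A" shows "C1_on e V (vdens \<psi>)" and "C1_on e V (bdens \<psi>)"
proof -
  note V = chart(1)[OF assms]
  show "C1_on e V (vdens \<psi>)"
    unfolding vdens_def[abs_def]
    by (rule C1_on_sqrt[OF V C1_on_det[OF V C1_gram(1)[OF assms]] dens_pos(1)[OF assms]])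
  show "C1_on e V (bdens \<psi>)"
    unfolding bdens_def[abs_def]
    by (rule C1_on_sqrt[OF V C1_on_det[OF V C1_gram(2)[OF assms]] dens_pos(2)[OF assms]])
qed

lemma vdens_change:
  assumes c: "(V, \<psi>) \<in> A" and d: "(W, \<theta>) \<in> A" and x: "x \<in> overlap V \<psi> W \<theta>"
  shows "vdens \<psi> x = \<bar>det (matrix (dH e (transition W \<theta> \<psi>) x))\<bar> * vdens \<theta> (transition W \<theta> \<psi> x)"
  unfolding vdens_def Dpar_def chart_change(2)[OF c d C1_param(1)[OF d] x]
  by (rule sqrt_det_gram_compose[OF C1_param(3)[OF d transition_apply(1)[OF c d x]] dH_transition(1)[OF c d x]])

abbreviation bd :: "'m set" where "bd \<equiv> mboundary e A"

lemma overlap_of_subset: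
  assumes "B \<subseteq> \<theta> ` W" shows "V \<inter> \<psi> -` B \<subseteq> overlap V \<psi> W \<theta>"
  using assms by (auto simp: overlap_def)

lemma transition_image:
  assumes c: "(V, \<psi>) \<in> A" and d: "(W, \<theta>) \<in> A" and B: "B \<subseteq> \<psi> ` V" "B \<subseteq> \<theta> ` W"
  shows "transition W \<theta> \<psi> ` (V \<inter> \<psi> -` B) = W \<inter> \<theta> -` B"
proof (intro equalityI subsetI)
  fix y assume "y \<in> transition W \<theta> \<psi> ` (V \<inter> \<psi> -` B)"
  then obtain x where x: "x \<in> V \<inter> \<psi> -` B" "y = transition W \<theta> \<psi> x" by auto
  from subsetD[OF overlap_of_subset[OF B(2)] x(1)] have "x \<in> overlap V \<psi> W \<theta>" .
  from transition_apply(1,2)[OF c d this] show "y \<in> W \<inter> \<theta> -` B" using x by simp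
next
  fix y assume y: "y \<in> W \<inter> \<theta> -` B"
  from subsetD[OF overlap_of_subset[OF B(1)] this] have "y \<in> overlap W \<theta> V \<psi>" .
  from transition_apply[OF d c this] have "transition V \<psi> \<theta> y \<in> V \<inter> \<psi> -` B"
    "transition W \<theta> \<psi> (transition V \<psi> \<theta> y) = y" using y by auto
  then show "y \<in> transition W \<theta> \<psi> ` (V \<inter> \<psi> -` B)" by (metis imageI)
qed

lemma chart_context:
  assumes "(V, \<psi>) \<in> A"
  shows "V \<in> sets borel" "continuous_on V (vdens \<psi>)" "continuous_on V (bdens \<psi>)"
    "\<And>x. x \<in> V \<Longrightarrow> 0 \<le> vdens \<psi> x" "\<And>x. x \<in> V \<Longrightarrow> 0 \<le> bdens \<psi> x"
  using borel_openH[OF chart(1)[OF assms]] C1_on_continuous[OF chart(1)[OF assms] C1_dens(1)[OF assms]]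
   C1_on_continuous[OF chart(1)[OF assms] C1_dens(2)[OF assms]] dens_pos[OF assms]
  by (auto intro: less_imp_le)

text \<open>Change of variables under the transition map; by \<open>vdens_change\<close> its
  Jacobian factor is exactly the quotient of the two densities.\<close>

lemma volume_compat:
  assumes c: "(V, \<psi>) \<in> A" and d: "(W, \<theta>) \<in> A"
    and B: "B \<in> sets (restrict_space borel M)" "B \<subseteq> \<psi> ` V" "B \<subseteq> \<theta> ` W"
  shows "(\<integral>\<^sup>+x. ennreal (vdens \<psi> x) * indicator (V \<inter> \<psi> -` B) x \<partial>lborel) =
    (\<integral>\<^sup>+y. ennreal (vdens \<theta> y) * indicator (W \<inter> \<theta> -` B) y \<partial>lborel)"
proof -
  let ?S = "V \<inter> \<psi> -` B" and ?t = "transition W \<theta> \<psi>"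
  \<comment> \<open>Extended by zero, because the change of variables asks for a function that is
    nonnegative everywhere.\<close>
  define f where "f y = (if y \<in> W then vdens \<theta> y else 0)" for y
  have O: "x \<in> overlap V \<psi> W \<theta>" if "x \<in> ?S" for x by (rule subsetD[OF overlap_of_subset[OF B(3)] that])
  have S: "?S \<in> sets borel"
    by (rule measurable_vimage_chart[OF _ chart_context(1)[OF c] chart(3)[OF c] chart(6)[OF c]
        chart_context(2,4)[OF c] B(1), of lborel]) simp
  have T: "W \<inter> \<theta> -` B \<in> sets borel"
    by (rule measurable_vimage_chart[OF _ chart_context(1)[OF d] chart(3)[OF d] chart(6)[OF d]
        chart_context(2,4)[OF d] B(1), of lborel]) simp
  have im: "?t ` ?S = W \<inter> \<theta> -` B" by (rule transition_image[OF c d B(2,3)])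
  have f1: "indicator (W \<inter> \<theta> -` B) y * f y = indicator (W \<inter> \<theta> -` B) y *\<^sub>R vdens \<theta> y" for y
    by (auto simp: indicator_def f_def)
  have f2: "indicator ?S x * (\<bar>det (matrix (dH e ?t x))\<bar> * f (?t x)) = indicator ?S x *\<^sub>R vdens \<psi> x" for x
    using vdens_change[OF c d O, of x] transition_apply(1)[OF c d O, of x]
    by (auto simp: indicator_def f_def)
  have "(\<integral>\<^sup>+y. ennreal (indicator (?t ` ?S) y * f y) \<partial>lborel) =
    (\<integral>\<^sup>+x. ennreal (indicator ?S x * (\<bar>det (matrix (dH e ?t x))\<bar> * f (?t x))) \<partial>lborel)"
  proof (rule nn_integral_change_of_variables[OF S])
    show "(?t has_derivative dH e ?t x) (at x within ?S)" if "x \<in> ?S" for x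
      using C1_on_deriv[OF C1_transition[OF c d] O[OF that]]
        by (rule has_derivative_subset) (use openH_subset[OF chart(1)[OF c]] in auto)
    show "inj_on ?t ?S"
      by (rule inj_on_inverseI[where g = "transition V \<psi> \<theta>"]) (rule transition_apply(4)[OF c d O])
    show "0 \<le> f x" for x using chart_context(4)[OF d, of x] by (simp add: f_def)
    show "(\<lambda>y. indicator (?t ` ?S) y * f y) \<in> borel_measurable borel"
      unfolding im f1
      by (rule borel_measurable_continuous_on_indicator[OF T continuous_on_subset[OF chart_context(2)[OF d]]]) auto
    show "(\<lambda>x. indicator ?S x * (\<bar>det (matrix (dH e ?t x))\<bar> * f (?t x))) \<in> borel_measurable borel"
      unfolding f2
      by (rule borel_measurable_continuous_on_indicator[OF S continuous_on_subset[OF chart_context(2)[OF c]]]) auto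
  qed
  moreover have "ennreal (indicator ?S x *\<^sub>R vdens \<psi> x) = ennreal (vdens \<psi> x) * indicator ?S x" for x
    by (simp add: indicator_def)
  moreover have "ennreal (indicator (W \<inter> \<theta> -` B) y *\<^sub>R vdens \<theta> y) = ennreal (vdens \<theta> y) * indicator (W \<inter> \<theta> -` B) y" for y
    by (simp add: indicator_def)
  ultimately show ?thesis unfolding im f1 f2 by simp
qed

lemma finite_chart_cover:
  obtains D where "finite D" "D \<subseteq> A" "M \<subseteq> (\<Union>c\<in>D. snd c ` fst c)"
proof -
  let ?S = "\<lambda>c::('m, 'k) chart. snd c ` fst c"
  have "\<exists>C'\<subseteq>?S ` A. finite C' \<and> M \<subseteq> \<Union>C'"
  proof -
    have "\<forall>s\<in>?S ` A. openin (top_of_set M) s" using chart(2) by auto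
    moreover have "M \<subseteq> \<Union>(?S ` A)"
    proof
      fix p assume "p \<in> M"
      then obtain V \<psi> x where "(V, \<psi>) \<in> A" "x \<in> V" "p = \<psi> x" by (rule chart_at)
      then show "p \<in> \<Union>(?S ` A)" by force
    qed
    ultimately show ?thesis using compact_M unfolding compact_eq_openin_cover by blast
  qed
  then obtain C' where C': "C' \<subseteq> ?S ` A" "finite C'" "M \<subseteq> \<Union>C'" by blast
  from finite_subset_image[OF C'(2,1)] obtain D where "D \<subseteq> A" "finite D" "C' = ?S ` D" by blast
  then show thesis using C'(3) that by blast
qed

text \<open>\<open>glue_measures\<close> for a finite subcover by charts, in the exact form of the
  definite descriptions. The set \<open>S\<close> will be the hypersurface or its boundary, and
  \<open>m\<close> the respective coordinate integral.\<close>

lemma ex1_chart_measure: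
  fixes m :: "(real^'k) set \<Rightarrow> (real^'k \<Rightarrow> 'm) \<Rightarrow> 'm set \<Rightarrow> ennreal"
  assumes S: "S \<subseteq> M"
    and m: "\<And>V \<psi> B. (V, \<psi>) \<in> A \<Longrightarrow> B \<in> sets (restrict_space borel S) \<Longrightarrow> m V \<psi> B = emeasure (\<nu> V \<psi>) B"
    and \<nu>: "\<And>V \<psi>. sets (\<nu> V \<psi>) = sets (restrict_space borel S)"
    and compat: "\<And>V \<psi> W \<theta> B. (V, \<psi>) \<in> A \<Longrightarrow> (W, \<theta>) \<in> A \<Longrightarrow> B \<in> sets (restrict_space borel S) \<Longrightarrow>
      B \<subseteq> \<psi> ` V \<Longrightarrow> B \<subseteq> \<theta> ` W \<Longrightarrow> m V \<psi> B = m W \<theta> B"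
  shows "\<exists>!\<mu>. sets \<mu> = sets (restrict_space borel S) \<and>
    (\<forall>(V, \<psi>)\<in>A. \<forall>B\<in>sets \<mu>. B \<subseteq> \<psi> ` V \<longrightarrow> emeasure \<mu> B = m V \<psi> B)"
proof -
  let ?N = "restrict_space borel S :: 'm measure"
  let ?T = "\<lambda>c::('m, 'k) chart. snd c ` fst c"
  obtain D where D: "finite D" "D \<subseteq> A" "M \<subseteq> (\<Union>c\<in>D. snd c ` fst c)" by (rule finite_chart_cover)
  have "\<exists>!\<mu>. sets \<mu> = sets ?N \<and>
    (\<forall>c\<in>A. \<forall>B\<in>sets \<mu>. B \<subseteq> ?T c \<longrightarrow> emeasure \<mu> B = m (fst c) (snd c) B)"
  proof (rule glue_measures[OF _ _ _ D(1,2)])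
    show "space ?N \<subseteq> (\<Union>d\<in>D. ?T d)"
      using order_trans[OF S D(3)] by (simp add: space_restrict_space)
    fix c assume "c \<in> A"
    then have c: "(fst c, snd c) \<in> A" by simp
    obtain U where U: "open U" "?T c = M \<inter> U" using chart(2)[OF c] unfolding openin_open by blast
    have "?T c \<inter> space ?N = S \<inter> U" using U(2) S by (auto simp: space_restrict_space)
    then show "?T c \<inter> space ?N \<in> sets ?N" using U(1) by (auto simp: sets_restrict_space)
    show "\<exists>\<nu>. sets \<nu> = sets ?N \<and> (\<forall>B\<in>sets ?N. B \<subseteq> ?T c \<longrightarrow> emeasure \<nu> B = m (fst c) (snd c) B)"
      using m[OF c] \<nu> by (intro exI[of _ "\<nu> (fst c) (snd c)"]) simp
    fix d B assume d: "d \<in> A" and B: "B \<in> sets ?N" "B \<subseteq> ?T c" "B \<subseteq> ?T d"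
    then have "(fst d, snd d) \<in> A" by simp
    then show "m (fst c) (snd c) B = m (fst d) (snd d) B" by (rule compat[OF c _ B])
  qed
  then show ?thesis by (simp add: split_beta)
qed

lemma integral_chart_local:
  fixes h :: "'m \<Rightarrow> real"
  assumes c: "(V, \<psi>) \<in> A" and S: "S \<subseteq> M"
    and sets: "sets \<mu> = sets (restrict_space borel S)" "sets \<nu> = sets (restrict_space borel S)"
    and em: "\<And>B. B \<in> sets (restrict_space borel S) \<Longrightarrow> B \<subseteq> \<psi> ` V \<Longrightarrow> emeasure \<mu> B = emeasure \<nu> B"
    and h: "\<And>p. p \<in> S \<Longrightarrow> p \<notin> \<psi> ` V \<Longrightarrow> h p = 0"
  shows "integral\<^sup>L \<mu> h = integral\<^sup>L \<nu> h" and "integrable \<mu> h \<longleftrightarrow> integrable \<nu> h"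
proof -
  obtain U where U: "open U" "\<psi> ` V = M \<inter> U" using chart(2)[OF c] unfolding openin_open by blast
  have "S \<inter> \<psi> ` V = S \<inter> U" using U(2) S by auto
  then have T: "S \<inter> \<psi> ` V \<in> sets \<nu>" unfolding sets(2) using U(1) by (auto simp: sets_restrict_space)
  have "space \<nu> = S" using sets_eq_imp_space_eq[OF sets(2)] by (simp add: space_restrict_space)
  then show "integral\<^sup>L \<mu> h = integral\<^sup>L \<nu> h" "integrable \<mu> h \<longleftrightarrow> integrable \<nu> h"
    using integral_eq_local[of \<mu> \<nu>, OF _ T] em h by (simp_all add: sets)
qed

lemma volume_measure:
  shows sets_volume_measure: "sets (volume_measure M A X) = sets (restrict_space borel M)"
    and emeasure_volume_measure: "\<And>V \<psi> B. (V, \<psi>) \<in> A \<Longrightarrow> B \<in> sets (restrict_space borel M) \<Longrightarrow> B \<subseteq> \<psi> ` V \<Longrightarrow>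
      emeasure (volume_measure M A X) B = emeasure (chart_measure lborel V \<psi> (vdens \<psi>) M) B"
proof -
  let ?N = "restrict_space borel M :: 'm measure" and ?\<nu> = "\<lambda>V \<psi>. chart_measure lborel V \<psi> (vdens \<psi>) M"
  let ?m = "\<lambda>V \<psi> B. \<integral>\<^sup>+x. ennreal (sqrt (det (induced_metric V (X \<circ> \<psi>) x))) * indicator (V \<inter> \<psi> -` B) x \<partial>lborel"
  have m_eq: "?m V \<psi> B = (\<integral>\<^sup>+x. ennreal (vdens \<psi> x) * indicator (V \<inter> \<psi> -` B) x \<partial>lborel)" if "(V, \<psi>) \<in> A" for V \<psi> B
    by (rule nn_integral_cong) (simp add: indicator_def vdens_def induced_metric_eq[OF that])
  have m: "?m V \<psi> B = emeasure (?\<nu> V \<psi>) B" if c: "(V, \<psi>) \<in> A" and B: "B \<in> sets ?N" for V \<psi> B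
    unfolding m_eq[OF c]
    by (rule emeasure_chart_measure[OF _ chart_context(1)[OF c] chart(3)[OF c] chart(6)[OF c]
      chart_context(2,4)[OF c] B, symmetric]) simp_all
  have "?m V \<psi> B = ?m W \<theta> B"
    if "(V, \<psi>) \<in> A" "(W, \<theta>) \<in> A" "B \<in> sets ?N" "B \<subseteq> \<psi> ` V" "B \<subseteq> \<theta> ` W" for V \<psi> W \<theta> B
    unfolding m_eq[OF that(1)] m_eq[OF that(2)] by (rule volume_compat[OF that])
  \<comment> \<open>Unique existence turns the definite description into its defining
    property.\<close>
  from theI'[OF ex1_chart_measure[where m = ?m and \<nu> = ?\<nu>, OF order_refl m sets_chart_measure this], folded volume_measure_def]
  have *: "sets (volume_measure M A X) = sets ?N \<and>
    (\<forall>(V, \<psi>)\<in>A. \<forall>B\<in>sets (volume_measure M A X). B \<subseteq> \<psi> ` V \<longrightarrow> emeasure (volume_measure M A X) B = ?m V \<psi> B)" .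
  then show "sets (volume_measure M A X) = sets ?N" by simp
  show "emeasure (volume_measure M A X) B = emeasure (?\<nu> V \<psi>) B"
    if "(V, \<psi>) \<in> A" "B \<in> sets ?N" "B \<subseteq> \<psi> ` V" for V \<psi> B
    using * that m[OF that(1,2)] by auto
qed

end

section \<open>The measure on the boundary\<close>

abbreviation face :: "'k::finite \<Rightarrow> (real^'k) set \<Rightarrow> (real^'k) set" where
  "face e V \<equiv> V \<inter> {x. x $ e = 0}"

lemma closed_face: "closed {x :: real^'k. x $ e = 0}"
  by (intro closed_Collect_eq continuous_intros)

context immersed_hypersurface
begin

lemma dH_drop_coord: "x \<in> halfspace e \<Longrightarrow> dH e (drop_coord e) x = drop_coord e"
  by (rule dH_eqI) (auto intro!: bounded_linear_imp_has_derivative simp: linear_conv_bounded_linear[symmetric] linear_drop_coord)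

lemma C1_drop_coord: "V \<subseteq> halfspace e \<Longrightarrow> C1_on e V (drop_coord e)"
  by (rule C1_onI[where D = "\<lambda>_. drop_coord e"])
    (auto intro!: bounded_linear_imp_has_derivative simp: linear_conv_bounded_linear[symmetric] linear_drop_coord)

text \<open>The transition map on the hyperplane times the identity in the normal direction. This
  full-dimensional map makes the change of variables in \<open>real^'k\<close> applicable to
  boundary integrals; \<open>dthicken\<close> is its differential.\<close>

definition thicken :: "(real^'k \<Rightarrow> real^'k) \<Rightarrow> real^'k \<Rightarrow> real^'k" where
  "thicken \<tau> x = \<tau> (drop_coord e x) + x $ e *\<^sub>R axis e 1"

definition dthicken :: "(real^'k \<Rightarrow> real^'k) \<Rightarrow> real^'k \<Rightarrow> real^'k \<Rightarrow> real^'k" where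
  "dthicken \<tau> x v = dH e \<tau> (drop_coord e x) (drop_coord e v) + v $ e *\<^sub>R axis e 1"

context
  fixes V W :: "(real^'k) set" and \<psi> \<theta> :: "real^'k \<Rightarrow> 'm"
  assumes c: "(V, \<psi>) \<in> A" and d: "(W, \<theta>) \<in> A"
begin

abbreviation (input) "Ov \<equiv> overlap V \<psi> W \<theta>"
abbreviation (input) "tr \<equiv> transition W \<theta> \<psi>"

lemma openH_thick: "openH e (halfspace e \<inter> drop_coord e -` overlap V \<psi> W \<theta>)"
proof (rule continuous_openin_preimage)
  show "continuous_on (halfspace e) (drop_coord e)"
    by (rule linear_continuous_on) (simp add: linear_conv_bounded_linear[symmetric] linear_drop_coord)
  show "drop_coord e \<in> halfspace e \<rightarrow> halfspace e" by (simp add: halfspace_def)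
qed (rule openH_overlap[OF c d])

lemma thick_deriv:
  assumes x: "x \<in> halfspace e" "drop_coord e x \<in> overlap V \<psi> W \<theta>"
  shows "((\<lambda>y. transition W \<theta> \<psi> (drop_coord e y)) has_derivative
      (\<lambda>v. dH e (transition W \<theta> \<psi>) (drop_coord e x) (drop_coord e v))) (at x within halfspace e)"
proof -
  have "((\<lambda>y. tr (drop_coord e y)) has_derivative
      (\<lambda>v. dH e tr (drop_coord e x) (dH e (drop_coord e) x v))) (at x within halfspace e)"
    by (rule has_derivative_compose_openH[OF openH_thick openH_overlap[OF c d] C1_drop_coord _ C1_transition[OF c d]])
      (use x in auto)
  then show ?thesis by (simp add: dH_drop_coord[OF x(1)])
qed

text \<open>Transition maps preserve the boundary, so their differentials preserve its tangent space.\<close>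

lemma dH_transition_tangent:
  assumes x: "x \<in> overlap V \<psi> W \<theta>" "x $ e = 0"
  shows "dH e (transition W \<theta> \<psi>) x (drop_coord e v) $ e = 0"
proof -
  let ?T = "halfspace e \<inter> drop_coord e -` Ov"
  have xx: "x \<in> halfspace e" "drop_coord e x = x" using x by (simp_all add: halfspace_def drop_coord_id)
  have xT: "x \<in> ?T" using xx x by simp
  have "((\<lambda>y. tr (drop_coord e y) $ e) has_derivative (\<lambda>v. dH e tr x (drop_coord e v) $ e)) (at x within halfspace e)"
    using thick_deriv[of x] xx x by (intro bounded_linear.has_derivative[OF bounded_linear_vec_nth]) simp
  then have "dH e (\<lambda>y. tr (drop_coord e y) $ e) x = (\<lambda>v. dH e tr x (drop_coord e v) $ e)"
    using xx(1) by (rule dH_eqI)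
  moreover have "dH e (\<lambda>y. tr (drop_coord e y) $ e) x = dH e (\<lambda>y. 0) x"
  proof (rule dH_cong[OF openH_thick xT])
    fix y assume "y \<in> ?T"
    then show "tr (drop_coord e y) $ e = 0"
      using transition_boundary[OF c d, of "drop_coord e y"] by simp
  qed
  ultimately have "(\<lambda>v. dH e tr x (drop_coord e v) $ e) = (\<lambda>v. 0)"
    using dH_const[OF xx(1), of "0 :: real"] by simp
  then show ?thesis by (rule fun_cong)
qed

lemma thicken_deriv:
  assumes x: "x \<in> halfspace e" "drop_coord e x \<in> overlap V \<psi> W \<theta>"
  shows "(thicken (transition W \<theta> \<psi>) has_derivative dthicken (transition W \<theta> \<psi>) x) (at x within halfspace e)"
  unfolding thicken_def[abs_def] dthicken_def[abs_def]
  by (intro has_derivative_add thick_deriv[OF x] bounded_linear_imp_has_derivative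
     bounded_linear_scaleR_left[THEN bounded_linear_compose] bounded_linear_vec_nth)

text \<open>The differential of the transition map sends the hyperplane into itself. Therefore the
  block diagonal map of one chart is that of the other composed with \<open>dthicken\<close>, and
  the transformation rule for Gram determinants applies as it does for the volume density.\<close>

lemma bdens_change:
  assumes x: "x \<in> halfspace e" "drop_coord e x \<in> overlap V \<psi> W \<theta>"
  shows "bdens \<psi> (drop_coord e x) =
    \<bar>det (matrix (dthicken (transition W \<theta> \<psi>) x))\<bar> * bdens \<theta> (transition W \<theta> \<psi> (drop_coord e x))"
proof -
  let ?x = "drop_coord e x" and ?P = "dthicken tr x"
  have lin: "linear ?P" using has_derivative_linear[OF thicken_deriv[OF x]] .
  have xV: "?x \<in> V" using x(2) by (simp add: overlap_def)
  have Dc: "Dpar \<psi> ?x v = Dpar \<theta> (tr ?x) (dH e tr ?x v)" for v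
    unfolding Dpar_def chart_change(2)[OF c d C1_param(1)[OF d] x(2)] by simp
  have "boundary_extend e (Dpar \<psi> ?x) v = boundary_extend e (Dpar \<theta> (tr ?x)) (?P v)" for v
  proof -
    have t0: "dH e tr ?x (drop_coord e v) $ e = 0" using dH_transition_tangent[OF x(2)] by simp
    have "drop_coord e (?P v) = drop_coord e (dH e tr ?x (drop_coord e v))"
      by (simp add: dthicken_def linear_add[OF linear_drop_coord] linear_cmul[OF linear_drop_coord] drop_coord_axis)
    also have "\<dots> = dH e tr ?x (drop_coord e v)" by (rule drop_coord_id[OF t0])
    finally show ?thesis
      using t0 by (simp add: boundary_extend_def Dc dthicken_def axis_nth)
  qed
  then have eq: "boundary_extend e (Dpar \<psi> ?x) = boundary_extend e (Dpar \<theta> (tr ?x)) \<circ> ?P"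
    by (simp add: fun_eq_iff)
  show ?thesis
    unfolding bdens_def eq
    by (rule sqrt_det_gram_compose[OF linear_boundary_extend[OF Dpar(1)[OF d transition_apply(1)[OF c d x(2)]]] lin])
qed

lemma boundary_preimage:
  assumes B: "B \<in> sets (restrict_space borel bd)"
  shows "V \<inter> \<psi> -` B \<subseteq> face e V" "V \<inter> \<psi> -` B = face e V \<inter> \<psi> -` B" "V \<inter> \<psi> -` B \<in> sets borel"
proof -
  have Bb: "B \<subseteq> bd" using sets.sets_into_space[OF B] by (simp add: space_restrict_space)
  show sub: "V \<inter> \<psi> -` B \<subseteq> face e V" using mboundary_iff[OF c] Bb by auto
  then show eq: "V \<inter> \<psi> -` B = face e V \<inter> \<psi> -` B" by auto
  have F: "face e V \<in> sets borel" by (rule sets.Int[OF chart_context(1)[OF c] borel_closed[OF closed_face]])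
  have im: "\<psi> ` face e V \<subseteq> bd" using mboundary_iff[OF c] by auto
  show "V \<inter> \<psi> -` B \<in> sets borel"
    unfolding eq
    by (rule measurable_vimage_chart[OF _ F continuous_on_subset[OF chart(3)[OF c]] im
       continuous_on_subset[OF chart_context(3)[OF c]] _ B, of lborel])
      (use chart_context(5)[OF c] in auto)
qed

end

text \<open>Both integrals are rewritten over slabs of height one. Thickening the transition map
  keeps the height, so it maps the slab over one preimage of \<open>B\<close> onto the slab over the
  other, and the change of variables in the full space gives equality.\<close>

lemma boundary_compat:
  assumes c: "(V, \<psi>) \<in> A" and d: "(W, \<theta>) \<in> A"
    and B: "B \<in> sets (restrict_space borel bd)" "B \<subseteq> \<psi> ` V" "B \<subseteq> \<theta> ` W"
  shows "(\<integral>\<^sup>+x. ennreal (bdens \<psi> x) * indicator (V \<inter> \<psi> -` B) x \<partial>hyperplane_lborel e) =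
    (\<integral>\<^sup>+y. ennreal (bdens \<theta> y) * indicator (W \<inter> \<theta> -` B) y \<partial>hyperplane_lborel e)"
proof -
  define slab where "slab = {x :: real^'k. 0 < x $ e \<and> x $ e < 1}"
  let ?SB = "V \<inter> \<psi> -` B" and ?TB = "W \<inter> \<theta> -` B" and ?t = "transition W \<theta> \<psi>"
  let ?S = "slab \<inter> drop_coord e -` ?SB" and ?T = "slab \<inter> drop_coord e -` ?TB"
  define f where "f y = (if drop_coord e y \<in> W then bdens \<theta> (drop_coord e y) else 0)" for y
  have slab: "slab \<in> sets borel" unfolding slab_def by measurable
  note S0 = boundary_preimage[OF c c B(1)] and T0 = boundary_preimage[OF d d B(1)]
  have S: "?S \<in> sets borel" and T: "?T \<in> sets borel"
    using slab measurable_sets[OF measurable_drop_coord S0(3)] measurable_sets[OF measurable_drop_coord T0(3)] by auto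
  have slabH: "slab \<subseteq> halfspace e" by (auto simp: slab_def halfspace_def)
  have O: "drop_coord e x \<in> overlap V \<psi> W \<theta>" "x \<in> halfspace e" if "x \<in> ?S" for x
    using that slabH by (auto intro: subsetD[OF overlap_of_subset[OF B(3)]])
  have t0: "?t (drop_coord e x) $ e = 0" if "x \<in> ?S" for x
    using transition_boundary[OF c d O(1)[OF that]] by simp
  have drop_th: "drop_coord e (thicken ?t x) = ?t (drop_coord e x)" "thicken ?t x $ e = x $ e" if "x \<in> ?S" for x
    using t0[OF that] drop_coord_id[OF t0[OF that]]
    by (simp_all add: thicken_def linear_add[OF linear_drop_coord] linear_cmul[OF linear_drop_coord] drop_coord_axis axis_nth)
  have im0: "?t ` ?SB = ?TB" by (rule transition_image[OF c d B(2,3)])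
  have im: "thicken ?t ` ?S = ?T"
  proof (intro equalityI subsetI)
    fix y assume "y \<in> thicken ?t ` ?S"
    then obtain x where x: "x \<in> ?S" "y = thicken ?t x" by blast
    have "?t (drop_coord e x) \<in> ?TB" using im0 x(1) by blast
    then show "y \<in> ?T" using x drop_th[OF x(1)] by (simp add: slab_def)
  next
    fix y assume y: "y \<in> ?T"
    then have "drop_coord e y \<in> ?t ` ?SB" using im0 by blast
    then obtain z where z: "z \<in> ?SB" "drop_coord e y = ?t z" by blast
    have z0: "z $ e = 0" using S0(1) z(1) by blast
    \<comment> \<open>The preimage of \<open>y\<close>: its projection is pulled back through the
      transition map and the result is given the height of \<open>y\<close>.\<close>
    define x where "x = z + y $ e *\<^sub>R axis e 1"
    have dx: "drop_coord e x = z" "x $ e = y $ e"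
      using z0 drop_coord_id[OF z0]
      by (simp_all add: x_def linear_add[OF linear_drop_coord] linear_cmul[OF linear_drop_coord] drop_coord_axis axis_nth)
    have xS: "x \<in> ?S" using y z(1) dx by (simp add: slab_def)
    have "thicken ?t x = y"
      by (rule drop_coord_eqD[of e]) (use drop_th[OF xS] dx z(2) in simp_all)
    then show "y \<in> thicken ?t ` ?S" using xS by blast
  qed
  have f1: "indicator ?T y * f y = indicator ?T y *\<^sub>R bdens \<theta> (drop_coord e y)" for y
    by (auto simp: indicator_def f_def)
  have f2: "indicator ?S x * (\<bar>det (matrix (dthicken ?t x))\<bar> * f (thicken ?t x)) =
      indicator ?S x *\<^sub>R bdens \<psi> (drop_coord e x)" for x
    using bdens_change[OF c d O(2,1), of x] transition_apply(1)[OF c d O(1), of x] drop_th[of x]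
    by (auto simp: indicator_def f_def)
  have cd: "continuous_on Z (drop_coord e)" for Z
    by (rule linear_continuous_on) (simp add: linear_conv_bounded_linear[symmetric] linear_drop_coord)
  have mT: "(\<lambda>y. indicator ?T y *\<^sub>R bdens \<theta> (drop_coord e y)) \<in> borel_measurable borel"
    by (rule borel_measurable_continuous_on_indicator[OF T continuous_on_compose2[OF chart_context(3)[OF d] cd]]) auto
  have mS: "(\<lambda>y. indicator ?S y *\<^sub>R bdens \<psi> (drop_coord e y)) \<in> borel_measurable borel"
    by (rule borel_measurable_continuous_on_indicator[OF S continuous_on_compose2[OF chart_context(3)[OF c] cd]]) auto
  have "(\<integral>\<^sup>+y. ennreal (indicator (thicken ?t ` ?S) y * f y) \<partial>lborel) =
    (\<integral>\<^sup>+x. ennreal (indicator ?S x * (\<bar>det (matrix (dthicken ?t x))\<bar> * f (thicken ?t x))) \<partial>lborel)"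
  proof (rule nn_integral_change_of_variables[OF S])
    show "(thicken ?t has_derivative dthicken ?t x) (at x within ?S)" if "x \<in> ?S" for x
      by (rule has_derivative_subset[OF thicken_deriv[OF c d O(2,1)[OF that]]]) (use slabH in auto)
    show "inj_on (thicken ?t) ?S"
    proof (rule inj_onI)
      fix x y assume xy: "x \<in> ?S" "y \<in> ?S" "thicken ?t x = thicken ?t y"
      then have eq: "?t (drop_coord e x) = ?t (drop_coord e y)" "x $ e = y $ e"
        using drop_th[OF xy(1)] drop_th[OF xy(2)] by simp_all
      have "drop_coord e x = transition V \<psi> \<theta> (?t (drop_coord e x))"
        by (rule transition_apply(4)[OF c d O(1)[OF xy(1)], symmetric])
      also have "\<dots> = drop_coord e y"
        unfolding eq(1) by (rule transition_apply(4)[OF c d O(1)[OF xy(2)]])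
      finally show "x = y" using eq(2) by (rule drop_coord_eqD)
    qed
    show "0 \<le> f x" for x using chart_context(5)[OF d, of "drop_coord e x"] by (simp add: f_def)
    show "(\<lambda>y. indicator (thicken ?t ` ?S) y * f y) \<in> borel_measurable borel"
      unfolding im f1 by (rule mT)
    show "(\<lambda>x. indicator ?S x * (\<bar>det (matrix (dthicken ?t x))\<bar> * f (thicken ?t x))) \<in> borel_measurable borel"
      unfolding f2 by (rule mS)
  qed
  then have main: "(\<integral>\<^sup>+y. ennreal (indicator ?T y *\<^sub>R bdens \<theta> (drop_coord e y)) \<partial>lborel) =
     (\<integral>\<^sup>+x. ennreal (indicator ?S x *\<^sub>R bdens \<psi> (drop_coord e x)) \<partial>lborel)"
    unfolding im f1 f2 .
  \<comment> \<open>Passage from the hyperplane to the slab, stated once and used for each of the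
    two charts.\<close>
  have hyp: "(\<integral>\<^sup>+x. ennreal (bdens \<eta> x) * indicator Z x \<partial>hyperplane_lborel e) =
     (\<integral>\<^sup>+x. ennreal (indicator (slab \<inter> drop_coord e -` Z) x *\<^sub>R bdens \<eta> (drop_coord e x)) \<partial>lborel)"
    if Z: "Z \<in> sets borel" "Z \<subseteq> U" and \<eta>: "continuous_on U (bdens \<eta>)" for \<eta> Z U
  proof -
    have "(\<lambda>x. indicator Z x *\<^sub>R bdens \<eta> x) \<in> borel_measurable borel"
      by (rule borel_measurable_continuous_on_indicator[OF Z(1) continuous_on_subset[OF \<eta> Z(2)]])
    then have m: "(\<lambda>x. ennreal (indicator Z x *\<^sub>R bdens \<eta> x)) \<in> borel_measurable borel" by measurable
    have e1: "ennreal (bdens \<eta> x) * indicator Z x = ennreal (indicator Z x *\<^sub>R bdens \<eta> x)" for x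
      by (simp add: indicator_def)
    show ?thesis
      unfolding e1 nn_integral_hyperplane_lborel[OF m] slab_def[symmetric]
      by (rule nn_integral_cong) (auto simp: indicator_def)
  qed
  show ?thesis
    unfolding hyp[OF S0(3) Int_lower1 chart_context(3)[OF c]] hyp[OF T0(3) Int_lower1 chart_context(3)[OF d]]
    by (rule main[symmetric])
qed

lemma face_context:
  assumes "(V, \<psi>) \<in> A"
  shows "face e V \<in> sets borel" "continuous_on (face e V) \<psi>" "\<psi> ` face e V \<subseteq> bd"
    "continuous_on (face e V) (bdens \<psi>)" "\<And>x. x \<in> face e V \<Longrightarrow> 0 \<le> bdens \<psi> x"
proof -
  show "face e V \<in> sets borel"
    by (rule sets.Int[OF chart_context(1)[OF assms] borel_closed[OF closed_face]])
  show "continuous_on (face e V) \<psi>" "continuous_on (face e V) (bdens \<psi>)"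
    by (rule continuous_on_subset[OF chart(3)[OF assms]] continuous_on_subset[OF chart_context(3)[OF assms]], blast)+
  show "\<psi> ` face e V \<subseteq> bd" using mboundary_iff[OF assms] by auto
qed (use chart_context(5)[OF assms] in auto)

lemma boundary_measure:
  shows sets_boundary_measure: "sets (boundary_measure e A X) = sets (restrict_space borel bd)"
    and emeasure_boundary_measure: "\<And>V \<psi> B. (V, \<psi>) \<in> A \<Longrightarrow> B \<in> sets (restrict_space borel bd) \<Longrightarrow> B \<subseteq> \<psi> ` V \<Longrightarrow>
      emeasure (boundary_measure e A X) B = emeasure (chart_measure (hyperplane_lborel e) (face e V) \<psi> (bdens \<psi>) bd) B"
proof -
  let ?N = "restrict_space borel bd :: 'm measure"
    and ?\<nu> = "\<lambda>V \<psi>. chart_measure (hyperplane_lborel e) (face e V) \<psi> (bdens \<psi>) bd"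
  let ?m = "\<lambda>V \<psi> B. \<integral>\<^sup>+x. ennreal (sqrt (det (boundary_metric e V (X \<circ> \<psi>) x))) *
    indicator (V \<inter> \<psi> -` B) x \<partial>hyperplane_lborel e"
  have m_eq: "?m V \<psi> B = (\<integral>\<^sup>+x. ennreal (bdens \<psi> x) * indicator (V \<inter> \<psi> -` B) x \<partial>hyperplane_lborel e)"
    if "(V, \<psi>) \<in> A" for V \<psi> B
    by (rule nn_integral_cong) (simp add: indicator_def bdens_def boundary_metric_eq[OF that])
  have m: "?m V \<psi> B = emeasure (?\<nu> V \<psi>) B" if c: "(V, \<psi>) \<in> A" and B: "B \<in> sets ?N" for V \<psi> B
    unfolding m_eq[OF c] unfolding boundary_preimage(2)[OF c c B]
    by (rule emeasure_chart_measure[OF _ face_context[OF c] B, symmetric]) simp_all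
  have "?m V \<psi> B = ?m W \<theta> B"
    if "(V, \<psi>) \<in> A" "(W, \<theta>) \<in> A" "B \<in> sets ?N" "B \<subseteq> \<psi> ` V" "B \<subseteq> \<theta> ` W" for V \<psi> W \<theta> B
    unfolding m_eq[OF that(1)] m_eq[OF that(2)] by (rule boundary_compat[OF that])
  from theI'[OF ex1_chart_measure[where m = ?m and \<nu> = ?\<nu>, OF mboundary_subset m sets_chart_measure this],
    folded boundary_measure_def]
  have *: "sets (boundary_measure e A X) = sets ?N \<and>
    (\<forall>(V, \<psi>)\<in>A. \<forall>B\<in>sets (boundary_measure e A X). B \<subseteq> \<psi> ` V \<longrightarrow> emeasure (boundary_measure e A X) B = ?m V \<psi> B)" .
  then show "sets (boundary_measure e A X) = sets ?N" by simp
  show "emeasure (boundary_measure e A X) B = emeasure (?\<nu> V \<psi>) B"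
    if "(V, \<psi>) \<in> A" "B \<in> sets ?N" "B \<subseteq> \<psi> ` V" for V \<psi> B
    using * that m[OF that(1,2)] by auto
qed

lemma integral_volume_measure:
  fixes h :: "'m \<Rightarrow> real"
  assumes c: "(V, \<psi>) \<in> A" and h: "h \<in> borel_measurable (restrict_space borel M)"
    and supp: "\<And>p. p \<in> M \<Longrightarrow> p \<notin> \<psi> ` V \<Longrightarrow> h p = 0"
  shows "integral\<^sup>L (volume_measure M A X) h = (\<integral>x. indicator V x * (vdens \<psi> x * h (\<psi> x)) \<partial>lborel)"
    and "integrable (volume_measure M A X) h \<longleftrightarrow> integrable lborel (\<lambda>x. indicator V x * (vdens \<psi> x * h (\<psi> x)))"
proof -
  let ?\<nu> = "chart_measure lborel V \<psi> (vdens \<psi>) M"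
  have loc: "integral\<^sup>L (volume_measure M A X) h = integral\<^sup>L ?\<nu> h" "integrable (volume_measure M A X) h \<longleftrightarrow> integrable ?\<nu> h"
    by (rule integral_chart_local[OF c order_refl sets_volume_measure sets_chart_measure];
        (rule emeasure_volume_measure[OF c] | rule supp); assumption)+
  show "integral\<^sup>L (volume_measure M A X) h = (\<integral>x. indicator V x * (vdens \<psi> x * h (\<psi> x)) \<partial>lborel)"
    unfolding loc
    by (rule integral_chart_measure(1)[OF _ chart_context(1)[OF c] chart(3)[OF c] chart(6)[OF c]
         chart_context(2,4)[OF c] h]) simp_all
  show "integrable (volume_measure M A X) h \<longleftrightarrow> integrable lborel (\<lambda>x. indicator V x * (vdens \<psi> x * h (\<psi> x)))"
    unfolding loc
    by (rule integral_chart_measure(2)[OF _ chart_context(1)[OF c] chart(3)[OF c] chart(6)[OF c]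
         chart_context(2,4)[OF c] h]) simp_all
qed

lemma integral_boundary_measure:
  fixes h :: "'m \<Rightarrow> real"
  assumes c: "(V, \<psi>) \<in> A" and h: "h \<in> borel_measurable (restrict_space borel bd)"
    and supp: "\<And>p. p \<in> bd \<Longrightarrow> p \<notin> \<psi> ` V \<Longrightarrow> h p = 0"
  shows "integral\<^sup>L (boundary_measure e A X) h =
      (\<integral>x. indicator (face e V) x * (bdens \<psi> x * h (\<psi> x)) \<partial>hyperplane_lborel e)"
    and "integrable (boundary_measure e A X) h \<longleftrightarrow>
      integrable (hyperplane_lborel e) (\<lambda>x. indicator (face e V) x * (bdens \<psi> x * h (\<psi> x)))"
proof -
  let ?\<nu> = "chart_measure (hyperplane_lborel e) (face e V) \<psi> (bdens \<psi>) bd"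
  have loc: "integral\<^sup>L (boundary_measure e A X) h = integral\<^sup>L ?\<nu> h" "integrable (boundary_measure e A X) h \<longleftrightarrow> integrable ?\<nu> h"
    by (rule integral_chart_local[OF c mboundary_subset sets_boundary_measure sets_chart_measure];
        (rule emeasure_boundary_measure[OF c] | rule supp); assumption)+
  show "integral\<^sup>L (boundary_measure e A X) h =
      (\<integral>x. indicator (face e V) x * (bdens \<psi> x * h (\<psi> x)) \<partial>hyperplane_lborel e)"
    unfolding loc by (rule integral_chart_measure(1)[OF _ face_context[OF c] h]) simp_all
  show "integrable (boundary_measure e A X) h \<longleftrightarrow>
      integrable (hyperplane_lborel e) (\<lambda>x. indicator (face e V) x * (bdens \<psi> x * h (\<psi> x)))"
    unfolding loc by (rule integral_chart_measure(2)[OF _ face_context[OF c] h]) simp_all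
qed

end

section \<open>Partitions of unity\<close>

text \<open>The profile of the bump functions. Away from 0 it is locally constant or a square; at 0
  the difference quotient equals \<open>max 0 h\<close>, which tends to 0.\<close>

lemma DERIV_max_zero_sq: "((\<lambda>t::real. (max 0 t)\<^sup>2) has_real_derivative 2 * max 0 t) (at t)"
proof -
  consider "t < 0" | "t = 0" | "0 < t" by linarith
  then show ?thesis
  proof cases
    case 1
    have "((\<lambda>t::real. 0) has_real_derivative 2 * max 0 t) (at t)" using 1 by simp
    then show ?thesis
      by (rule DERIV_cong_ev[THEN iffD1, OF refl _ refl, rotated])
        (use 1 eventually_nhds_in_open[of "{..<0}" t] in \<open>auto elim!: eventually_mono\<close>)
  next
    case 3
    have "((\<lambda>t::real. t\<^sup>2) has_real_derivative 2 * max 0 t) (at t)"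
      using 3 by (auto intro!: derivative_eq_intros)
    then show ?thesis
      by (rule DERIV_cong_ev[THEN iffD1, OF refl _ refl, rotated])
        (use 3 eventually_nhds_in_open[of "{0<..}" t] in \<open>auto elim!: eventually_mono\<close>)
  next
    case 2
    have "((\<lambda>h::real. max 0 h) \<longlongrightarrow> 0) (at 0)"
      using tendsto_max[OF tendsto_const[of 0] tendsto_ident_at[of "0::real" UNIV]] by simp
    moreover have "((max 0 (0 + h))\<^sup>2 - (max 0 0)\<^sup>2) / h = max 0 h" if "h \<noteq> 0" for h :: real
      using that by (simp add: max_def power2_eq_square)
    ultimately have "((\<lambda>h::real. ((max 0 (0 + h))\<^sup>2 - (max 0 0)\<^sup>2) / h) \<longlongrightarrow> 0) (at 0)"
      by (subst tendsto_cong[where g = "\<lambda>h. max 0 h"]) (auto simp: eventually_at_filter)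
    then show ?thesis unfolding 2 DERIV_def by simp
  qed
qed

lemma integrable_compact_support:
  fixes f :: "real^'k::finite \<Rightarrow> real"
  assumes K: "compact K" "K \<subseteq> V" and f: "continuous_on V f" and supp: "\<And>x. x \<in> V - K \<Longrightarrow> f x = 0"
  shows "integrable lborel (\<lambda>x. indicator V x * f x)"
proof -
  have "integrable lborel (\<lambda>x. indicator K x *\<^sub>R f x)"
    by (rule borel_integrable_compact[OF K(1) continuous_on_subset[OF f K(2)]])
  also have "(\<lambda>x. indicator K x *\<^sub>R f x) = (\<lambda>x. indicator V x * f x)"
    unfolding fun_eq_iff using supp K(2) by (auto simp: indicator_def)
  finally show ?thesis .
qed

text \<open>A bounded measurable function on a set of finite measure. The finiteness is read off
  from the slab of height one over \<open>K\<close>, which is a bounded set.\<close>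

lemma integrable_hyperplane_compact_support:
  fixes f :: "real^'k::finite \<Rightarrow> real"
  assumes K: "compact K" "K \<subseteq> V" and f: "continuous_on V f" and supp: "\<And>x. x \<in> V - K \<Longrightarrow> f x = 0"
  shows "integrable (hyperplane_lborel e) (\<lambda>x. indicator V x * f x)"
proof -
  have fK: "continuous_on K f" by (rule continuous_on_subset[OF f K(2)])
  have Kb: "K \<in> sets borel" using K(1) by (simp add: borel_compact)
  have m: "(\<lambda>x. indicator K x *\<^sub>R f x) \<in> borel_measurable borel"
    by (rule borel_measurable_continuous_on_indicator[OF Kb fK])
  have "compact (f ` K)" by (rule compact_continuous_image[OF fK K(1)])
  then obtain C where C: "\<And>x. x \<in> K \<Longrightarrow> norm (f x) \<le> C"
    using compact_imp_bounded bounded_iff by (metis (no_types) imageI)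
  have fin: "emeasure (hyperplane_lborel e) K < \<infinity>"
  proof -
    obtain R where R: "\<And>x. x \<in> K \<Longrightarrow> norm x \<le> R"
      using compact_imp_bounded[OF K(1)] by (auto simp: bounded_iff)
    have "emeasure (hyperplane_lborel e) K = (\<integral>\<^sup>+x. indicator K x \<partial>hyperplane_lborel e)"
      using Kb by simp
    also have "\<dots> = (\<integral>\<^sup>+x. indicator {x. 0 < x $ e \<and> x $ e < 1} x * indicator K (drop_coord e x) \<partial>lborel)"
      by (rule nn_integral_hyperplane_lborel) (use Kb in measurable)
    \<comment> \<open>Points over \<open>K\<close> arise from points of norm at most
      \<open>R\<close> by adding a normal vector of length below 1.\<close>
    also have "\<dots> \<le> (\<integral>\<^sup>+x. indicator (cball (0 :: real^'k) (R + 1)) x \<partial>lborel)"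
    proof (rule nn_integral_mono)
      fix x :: "real^'k"
      have "x \<in> cball 0 (R + 1)" if x: "0 < x $ e" "x $ e < 1" "drop_coord e x \<in> K"
      proof -
        have "x = drop_coord e x + x $ e *\<^sub>R axis e 1"
          by (auto simp: drop_coord_def axis_def vec_eq_iff)
        then have "norm x \<le> norm (drop_coord e x) + norm (x $ e *\<^sub>R axis e (1::real))"
          by (metis norm_triangle_ineq)
        then show ?thesis using R[OF x(3)] x by simp
      qed
      then show "indicator {x. 0 < x $ e \<and> x $ e < 1} x * indicator K (drop_coord e x) \<le> (indicator (cball 0 (R + 1)) x :: ennreal)"
        by (auto simp: indicator_def)
    qed
    also have "\<dots> = emeasure lborel (cball (0 :: real^'k) (R + 1))" by simp
    also have "\<dots> < \<infinity>" by (rule emeasure_bounded_finite) simp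
    finally show ?thesis .
  qed
  have "integrable (hyperplane_lborel e) (\<lambda>x. indicator K x *\<^sub>R (indicator K x *\<^sub>R f x))"
  proof (rule integrableI_bounded_set_indicator[OF _ _ fin])
    show "AE x in hyperplane_lborel e. x \<in> K \<longrightarrow> norm (indicator K x *\<^sub>R f x) \<le> C"
      using C by (intro AE_I2) (auto simp: indicator_def)
  qed (use Kb m in simp_all)
  also have "(\<lambda>x. indicator K x *\<^sub>R (indicator K x *\<^sub>R f x)) = (\<lambda>x. indicator V x * f x)"
    unfolding fun_eq_iff using supp K(2) by (auto simp: indicator_def)
  finally show ?thesis .
qed

lemma openH_Diff_compact: "openH e V \<Longrightarrow> compact K \<Longrightarrow> openH e (V - K)"
  by (metis closedin_closed_Int closed_closedin compact_imp_closed inf_commute openin_diff Diff_Int_distrib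
     Diff_eq openin_Int_open open_Compl)

lemma dH_zero_off_support:
  assumes V: "openH e V" and K: "compact K" and supp: "\<And>x. x \<in> V - K \<Longrightarrow> f x = 0" and x: "x \<in> V - K"
  shows "dH e f x = (\<lambda>v. 0)"
proof -
  note VK = openH_Diff_compact[OF V K]
  have "dH e f x = dH e (\<lambda>x. 0) x" by (rule dH_cong[OF VK x supp])
  then show ?thesis using dH_const[OF openH_subset[OF VK x]] by simp
qed

text \<open>The extension of \<open>f\<close> by zero is continuously differentiable on the whole
  half-space, because it is so on \<open>V\<close> and on the complement of \<open>K\<close>, which
  are relatively open and cover the half-space. The formula for the full half-space then
  applies.\<close>

lemma integral_partial_openH:
  fixes f :: "real^'k::finite \<Rightarrow> real"
  assumes V: "openH e V" and f: "C1_on e V f" and K: "compact K" "K \<subseteq> V"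
    and supp: "\<And>x. x \<in> V - K \<Longrightarrow> f x = 0"
  shows "(\<integral>x. indicator V x * dH e f x (axis i 1) \<partial>lborel) =
    (if i = e then - (\<integral>x. indicator V x * f x \<partial>hyperplane_lborel e) else 0)"
proof -
  define Z where "Z x = (if x \<in> V then f x else 0)" for x
  define Z' where "Z' x = (if x \<in> V then dH e f x else (\<lambda>v. 0))" for x
  have VH: "V \<subseteq> halfspace e" by (rule openin_imp_subset[OF V])
  have HK: "openH e (halfspace e - K)" by (rule openH_Diff_compact[OF _ K(1)]) simp
  have Z0: "Z x = 0" if "x \<in> halfspace e - K" for x using supp that by (simp add: Z_def)
  have Z'0: "Z' x = (\<lambda>v. 0)" if "x \<in> halfspace e - K" for x
    using dH_zero_off_support[OF V K(1) supp] that by (simp add: Z'_def)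
  have 1: "C1_on e V Z" by (rule C1_on_cong[OF V f]) (simp add: Z_def)
  have 2: "C1_on e (halfspace e - K) Z"
    by (rule C1_on_cong[OF HK C1_on_const[of _ _ 0]]) (use Z0 in auto)
  have "V \<union> (halfspace e - K) = halfspace e" using VH K(2) by auto
  then have C1: "C1_on e (halfspace e) Z" using C1_on_Un[OF V HK 1 2] by simp
  have dZ: "dH e Z x = Z' x" if x: "x \<in> halfspace e" for x
  proof (cases "x \<in> V")
    case True
    have "dH e Z x = dH e f x" by (rule dH_cong[OF V True]) (simp add: Z_def)
    then show ?thesis using True by (simp add: Z'_def)
  next
    case False
    then have xK: "x \<in> halfspace e - K" using x K(2) by auto
    have "dH e Z x = dH e (\<lambda>x. 0) x" by (rule dH_cong[OF HK xK Z0])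
    then show ?thesis using dH_const[OF x] False by (simp add: Z'_def)
  qed
  have "(\<integral>x. indicator (halfspace e) x * dH e Z x (axis i 1) \<partial>lborel) =
    (if i = e then - (\<integral>x. indicator (halfspace e) x * Z x \<partial>hyperplane_lborel e) else 0)"
  proof (rule integral_partial_halfspace[OF C1_on_deriv[OF C1] C1_on_continuous_dH[OF C1] compact_imp_bounded[OF K(1)]])
    fix x assume x: "x \<in> halfspace e - K"
    then show "Z x = 0 \<and> dH e Z x (axis i 1) = 0" using Z0 dZ Z'0[OF x] by simp
  qed
  moreover have "indicator (halfspace e) x * dH e Z x (axis i 1) = indicator V x * dH e f x (axis i 1)" for x
    using VH dZ[of x] by (auto simp: indicator_def Z'_def)
  moreover have "indicator (halfspace e) x * Z x = indicator V x * f x" for x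
    using VH by (auto simp: indicator_def Z_def)
  ultimately show ?thesis by simp
qed

lemma continuous_on_openin_cover:
  fixes M :: "'a::t2_space set"
  assumes "\<And>p. p \<in> M \<Longrightarrow> \<exists>T. openin (top_of_set M) T \<and> p \<in> T \<and> continuous_on T f"
  shows "continuous_on M f"
  unfolding continuous_on_eq_continuous_within
proof
  fix p assume p: "p \<in> M"
  then obtain T where T: "openin (top_of_set M) T" "p \<in> T" "continuous_on T f" using assms by blast
  then obtain U where U: "open U" "T = M \<inter> U" unfolding openin_open by blast
  have "at p within T = at p within M"
    by (rule at_within_nhd[of p U]) (use T U in auto)
  moreover have "continuous (at p within T) f"
    using T(2,3) continuous_on_eq_continuous_within by blast
  ultimately show "continuous (at p within M) f" by simp
qed

section \<open>Functions on the hypersurface that are continuously differentiable in every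
  chart\<close>

context immersed_hypersurface
begin

definition C1M :: "('m \<Rightarrow> real) \<Rightarrow> bool" where
  "C1M f \<longleftrightarrow> (\<forall>(V, \<psi>)\<in>A. C1_on e V (f \<circ> \<psi>))"

lemma C1M_D: "C1M f \<Longrightarrow> (V, \<psi>) \<in> A \<Longrightarrow> C1_on e V (f \<circ> \<psi>)"
  unfolding C1M_def by fast

lemma C1M_I: "(\<And>V \<psi>. (V, \<psi>) \<in> A \<Longrightarrow> C1_on e V (f \<circ> \<psi>)) \<Longrightarrow> C1M f"
  unfolding C1M_def by fast

lemma C1M_const: "C1M (\<lambda>p. c)"
  by (rule C1M_I) (simp add: comp_def C1_on_const openin_imp_subset[OF chart(1)])

lemma C1M_add: "C1M f \<Longrightarrow> C1M g \<Longrightarrow> C1M (\<lambda>p. f p + g p)"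
  using C1_on_add[OF chart(1)] C1M_D by (intro C1M_I) (fastforce simp: comp_def)

lemma C1M_mult: "C1M f \<Longrightarrow> C1M g \<Longrightarrow> C1M (\<lambda>p. f p * g p)"
  using C1_on_mult[OF chart(1)] C1M_D by (intro C1M_I) (fastforce simp: comp_def)

lemma C1M_sum: "finite I \<Longrightarrow> (\<And>i. i \<in> I \<Longrightarrow> C1M (f i)) \<Longrightarrow> C1M (\<lambda>p. \<Sum>i\<in>I. f i p)"
  by (induction I rule: finite_induct) (auto intro: C1M_const C1M_add)

lemma C1M_divide:
  assumes "C1M f" "C1M g" "\<And>p. p \<in> M \<Longrightarrow> g p \<noteq> 0" shows "C1M (\<lambda>p. f p / g p)"
proof (rule C1M_I)
  fix V \<psi> assume c: "(V, \<psi>) \<in> A"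
  have "C1_on e V (\<lambda>x. (f \<circ> \<psi>) x / (g \<circ> \<psi>) x)"
    by (rule C1_on_divide[OF chart(1)[OF c] C1M_D[OF assms(1) c] C1M_D[OF assms(2) c]])
      (use assms(3) chart(6)[OF c] in auto)
  then show "C1_on e V ((\<lambda>p. f p / g p) \<circ> \<psi>)" by (simp add: comp_def)
qed

lemma continuous_on_chart_image:
  assumes c: "(V, \<psi>) \<in> A" and f: "continuous_on V (f \<circ> \<psi>)"
  shows "continuous_on (\<psi> ` V) f"
proof -
  have "continuous_on (\<psi> ` V) (\<lambda>p. (f \<circ> \<psi>) (inv_into V \<psi> p))"
    by (rule continuous_on_compose2[OF f chart(5)[OF c]]) (auto intro: inv_into_into)
  then show ?thesis
    by (rule continuous_on_eq) (use f_inv_into_f[of _ \<psi> V] in auto)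
qed

lemma continuous_on_M:
  assumes "\<And>V \<psi>. (V, \<psi>) \<in> A \<Longrightarrow> continuous_on V (f \<circ> \<psi>)" shows "continuous_on M f"
proof (rule continuous_on_openin_cover)
  fix p assume "p \<in> M"
  then obtain V \<psi> x where c: "(V, \<psi>) \<in> A" "x \<in> V" "p = \<psi> x" by (rule chart_at)
  then show "\<exists>T. openin (top_of_set M) T \<and> p \<in> T \<and> continuous_on T f"
    using chart(2)[OF c(1)] continuous_on_chart_image[OF c(1) assms[OF c(1)]] by blast
qed

lemma C1M_continuous: "C1M f \<Longrightarrow> continuous_on M f"
  by (intro continuous_on_M C1_on_continuous[OF chart(1)] C1M_D)

text \<open>The image of \<open>K\<close> is compact, hence closed by the Hausdorff
  property.\<close>

lemma openin_compl_compact: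
  assumes c: "(V, \<psi>) \<in> A" and K: "compact K" "K \<subseteq> V"
  shows "openin (top_of_set M) (M - \<psi> ` K)"
proof -
  have "compact (\<psi> ` K)"
    by (rule compact_continuous_image[OF continuous_on_subset[OF chart(3)[OF c] K(2)] K(1)])
  then have "open (- (\<psi> ` K))" by (intro open_Compl compact_imp_closed)
  then have "openin (top_of_set M) (M \<inter> - (\<psi> ` K))" by (rule openin_open_Int)
  then show ?thesis by (simp add: Diff_eq)
qed

text \<open>The domain of any other chart is covered by its overlap with \<open>V\<close>, where the
  chain rule applies, and by the preimage of the complement of the support, where \<open>f\<close>
  is zero. Both are relatively open.\<close>

lemma C1M_extend_zero:
  assumes c: "(V, \<psi>) \<in> A" and K: "compact K" "K \<subseteq> V"
    and f: "C1_on e V (f \<circ> \<psi>)" and supp: "\<And>p. p \<in> M - \<psi> ` K \<Longrightarrow> f p = 0"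
  shows "C1M f"
proof (rule C1M_I)
  fix W \<theta> assume d: "(W, \<theta>) \<in> A"
  let ?W1 = "overlap W \<theta> V \<psi>" and ?W2 = "W \<inter> \<theta> -` (M - \<psi> ` K)"
  have "openin (top_of_set W) ?W2"
    by (rule continuous_openin_preimage[OF chart(3)[OF d] _ openin_compl_compact[OF c K]])
      (use chart(6)[OF d] in auto)
  then have W2: "openH e ?W2" using chart(1)[OF d] by (rule openin_trans)
  have "C1_on e ?W2 (f \<circ> \<theta>)"
    by (rule C1_on_cong[OF W2 C1_on_const[of _ _ 0]]) (use openin_imp_subset[OF W2] supp in auto)
  moreover have "C1_on e ?W1 (f \<circ> \<theta>)" by (rule chart_change(1)[OF d c f])
  ultimately have "C1_on e (?W1 \<union> ?W2) (f \<circ> \<theta>)" by (intro C1_on_Un openH_overlap[OF d c] W2)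
  moreover have "?W1 \<union> ?W2 = W" using chart(6)[OF d] K(2) unfolding overlap_def by blast
  ultimately show "C1_on e W (f \<circ> \<theta>)" by simp
qed

text \<open>A radial function in coordinates, extended by zero to the hypersurface. At a boundary
  point the ball is cut by the half-space, which is harmless since only relative openness
  counts.\<close>

lemma bump:
  assumes c: "(V, \<psi>) \<in> A" and r: "0 < r" "cball x r \<inter> halfspace e \<subseteq> V"
  shows "\<exists>b. C1M b \<and> (\<forall>p. 0 \<le> b p) \<and> (\<forall>p\<in>M - \<psi> ` (cball x r \<inter> halfspace e). b p = 0) \<and>
    (\<forall>y\<in>V \<inter> ball x r. 0 < b (\<psi> y))"
proof -
  \<comment> \<open>The positive part is squared because it has a kink on the sphere of radius
    \<open>r\<close>, while its square is continuously differentiable.\<close>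
  define h where "h y = (max 0 (r\<^sup>2 - (y - x) \<bullet> (y - x)))\<^sup>2" for y :: "real^'k"
  define b where "b p = (if p \<in> \<psi> ` V then h (inv_into V \<psi> p) else 0)" for p
  have b_psi: "b (\<psi> y) = h y" if "y \<in> V" for y
    using that inv_into_f_f[OF chart(4)[OF c] that] by (simp add: b_def)
  let ?K = "cball x r \<inter> halfspace e"
  have K: "compact ?K" by (intro compact_Int_closed closed_halfspace compact_cball)
  note V = chart(1)[OF c]
  have "C1_on e V (\<lambda>y. r\<^sup>2 - (y - x) \<bullet> (y - x))"
  proof (rule C1_onI[OF openin_imp_subset[OF V], where D = "\<lambda>y v. - (2 * ((y - x) \<bullet> v))"])
    show "((\<lambda>y. r\<^sup>2 - (y - x) \<bullet> (y - x)) has_derivative (\<lambda>v. - (2 * ((y - x) \<bullet> v)))) (at y within halfspace e)" for y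
      by (auto intro!: derivative_eq_intros simp: inner_commute)
  qed (intro continuous_intros)
  then have "C1_on e V h"
    unfolding h_def
    by (rule C1_on_real_compose[OF V, where h = "\<lambda>t. (max 0 t)\<^sup>2" and h' = "\<lambda>t. 2 * max 0 t"])
      (rule DERIV_max_zero_sq, intro continuous_intros)
  then have C1: "C1_on e V (b \<circ> \<psi>)" by (rule C1_on_cong[OF V]) (simp add: b_psi)
  have sq: "(y - x) \<bullet> (y - x) = (dist x y)\<^sup>2" for y
    unfolding dist_commute[of x y] by (simp add: dist_norm power2_norm_eq_inner)
  have supp: "b p = 0" if "p \<in> M - \<psi> ` ?K" for p
  proof (cases "p \<in> \<psi> ` V")
    case True
    then obtain y where y: "y \<in> V" "p = \<psi> y" by blast
    then have "y \<notin> cball x r" using that openH_subset[OF V] by blast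
    then have "r\<^sup>2 \<le> (dist x y)\<^sup>2" using r(1) by (intro power_mono) auto
    then show ?thesis using b_psi[OF y(1)] y(2) by (simp add: h_def sq)
  qed (simp add: b_def)
  show ?thesis
  proof (intro exI[of _ b] conjI ballI allI)
    show "C1M b" by (rule C1M_extend_zero[OF c K r(2) C1 supp])
    show "0 \<le> b p" for p by (simp add: b_def h_def)
    show "p \<in> M - \<psi> ` ?K \<Longrightarrow> b p = 0" for p by (rule supp)
    fix y assume y: "y \<in> V \<inter> ball x r"
    then have "(dist x y)\<^sup>2 < r\<^sup>2" using r(1) by (intro power_strict_mono) auto
    then show "0 < b (\<psi> y)" using b_psi[of y] y by (simp add: h_def sq)
  qed
qed

lemma openH_ball:
  assumes "openH e V" "x \<in> V" obtains r where "0 < r" "cball x r \<inter> halfspace e \<subseteq> V"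
proof -
  obtain T where T: "open T" "V = halfspace e \<inter> T" using assms(1) unfolding openin_open by blast
  then obtain r where "0 < r" "cball x r \<subseteq> T" using assms(2) by (meson IntD2 open_contains_cball)
  then show thesis using that T(2) by blast
qed

definition chart_partition ::
  "'i set \<Rightarrow> ('i \<Rightarrow> (real^'k) set) \<Rightarrow> ('i \<Rightarrow> real^'k \<Rightarrow> 'm) \<Rightarrow> ('i \<Rightarrow> (real^'k) set) \<Rightarrow> ('i \<Rightarrow> 'm \<Rightarrow> real) \<Rightarrow> bool"
  where "chart_partition I V \<psi> K \<rho> \<longleftrightarrow> finite I \<and> (\<forall>p\<in>M. (\<Sum>i\<in>I. \<rho> i p) = 1) \<and>
    (\<forall>i\<in>I. (V i, \<psi> i) \<in> A \<and> compact (K i) \<and> K i \<subseteq> V i \<and> C1M (\<rho> i) \<and> (\<forall>p\<in>M - \<psi> i ` K i. \<rho> i p = 0))"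

lemma chart_partitionD:
  assumes "chart_partition I V \<psi> K \<rho>"
  shows "finite I" "\<And>i. i \<in> I \<Longrightarrow> (V i, \<psi> i) \<in> A"
    "\<And>i. i \<in> I \<Longrightarrow> compact (K i)" "\<And>i. i \<in> I \<Longrightarrow> K i \<subseteq> V i" "\<And>i. i \<in> I \<Longrightarrow> C1M (\<rho> i)"
    "\<And>i p. i \<in> I \<Longrightarrow> p \<in> M - \<psi> i ` K i \<Longrightarrow> \<rho> i p = 0" "\<And>p. p \<in> M \<Longrightarrow> (\<Sum>i\<in>I. \<rho> i p) = 1"
  using assms unfolding chart_partition_def by blast+

text \<open>By compactness, the positivity sets of finitely many bump functions cover
  \<open>M\<close>. Their sum is then positive on \<open>M\<close>, and dividing by it normalises
  them. The points at which the bumps were chosen serve as indices.\<close>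

lemma ex_chart_partition: "\<exists>(I :: 'm set) V \<psi> K \<rho>. chart_partition I V \<psi> K \<rho>"
proof -
  have "\<exists>V \<psi> K b. (V, \<psi>) \<in> A \<and> compact K \<and> K \<subseteq> V \<and> C1M b \<and> (\<forall>q. 0 \<le> b q) \<and>
      (\<forall>q\<in>M - \<psi> ` K. b q = 0) \<and> 0 < b p" if p: "p \<in> M" for p
  proof -
    obtain V \<psi> x where c: "(V, \<psi>) \<in> A" "x \<in> V" "p = \<psi> x" by (rule chart_at[OF p])
    obtain r where r: "0 < r" "cball x r \<inter> halfspace e \<subseteq> V" by (rule openH_ball[OF chart(1)[OF c(1)] c(2)])
    obtain b where b: "C1M b" "\<forall>p. 0 \<le> b p" "\<forall>p\<in>M - \<psi> ` (cball x r \<inter> halfspace e). b p = 0"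
      "\<forall>y\<in>V \<inter> ball x r. 0 < b (\<psi> y)" using bump[OF c(1) r] by blast
    have "compact (cball x r \<inter> halfspace e)" by (intro compact_Int_closed closed_halfspace compact_cball)
    moreover have "0 < b p" using b(4) c(2,3) r(1) by simp
    ultimately show ?thesis using c(1) r(2) b(1-3) by blast
  qed
  then obtain V \<psi> K b where VK: "\<And>p. p \<in> M \<Longrightarrow> (V p, \<psi> p) \<in> A \<and> compact (K p) \<and> K p \<subseteq> V p \<and> C1M (b p) \<and>
      (\<forall>q. 0 \<le> b p q) \<and> (\<forall>q\<in>M - \<psi> p ` K p. b p q = 0) \<and> 0 < b p p" by metis
  define U where "U p = {q \<in> M. 0 < b p q}" for p
  have op: "openin (top_of_set M) (U p)" if "p \<in> M" for p
  proof -
    have "openin (top_of_set M) (M \<inter> b p -` {0<..})"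
      by (rule continuous_openin_preimage_gen[OF C1M_continuous]) (use VK[OF that] in auto)
    moreover have "M \<inter> b p -` {0<..} = U p" by (auto simp: U_def)
    ultimately show ?thesis by simp
  qed
  have "p \<in> U p" if "p \<in> M" for p using VK[OF that] that by (simp add: U_def)
  then have "M \<subseteq> \<Union>(U ` M)" by blast
  moreover have "\<forall>c\<in>U ` M. openin (top_of_set M) c" using op by blast
  ultimately have "\<exists>C'\<subseteq>U ` M. finite C' \<and> M \<subseteq> \<Union>C'"
    using compact_M[unfolded compact_eq_openin_cover, THEN spec, of "U ` M"] by blast
  then obtain C' where C': "C' \<subseteq> U ` M" "finite C'" "M \<subseteq> \<Union>C'" by blast
  from finite_subset_image[OF C'(2,1)] obtain I where I: "I \<subseteq> M" "finite I" "C' = U ` I" by blast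
  define s where "s q = (\<Sum>i\<in>I. b i q)" for q
  have s_pos: "0 < s q" if "q \<in> M" for q
  proof -
    have "q \<in> \<Union>(U ` I)" using C'(3) that unfolding I(3) by blast
    then obtain i where i: "i \<in> I" "0 < b i q" unfolding U_def by blast
    have "0 \<le> b j q" if "j \<in> I" for j using VK I(1) that by blast
    then show ?thesis
      unfolding s_def using i(2) by (intro sum_pos2[OF I(2) i(1), where f = "\<lambda>i. b i q"])
  qed
  have C1s: "C1M s" unfolding s_def[abs_def] using VK I(1) by (intro C1M_sum[OF I(2)]) blast
  have "chart_partition I V \<psi> K (\<lambda>i q. b i q / s q)"
    unfolding chart_partition_def
  proof (intro conjI ballI)
    show "(\<Sum>i\<in>I. b i p / s p) = 1" if "p \<in> M" for p
      using s_pos[OF that] by (simp add: sum_divide_distrib[symmetric] s_def[symmetric])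
    fix i assume "i \<in> I"
    then have i: "i \<in> M" using I(1) by blast
    show "(V i, \<psi> i) \<in> A" "compact (K i)" "K i \<subseteq> V i" using VK[OF i] by auto
    show "C1M (\<lambda>q. b i q / s q)" using VK[OF i] C1s s_pos by (intro C1M_divide) (auto simp: less_imp_neq[symmetric])
    show "b i p / s p = 0" if "p \<in> M - \<psi> i ` K i" for p using VK[OF i] that by simp
  qed (rule I(2))
  then show ?thesis by blast
qed

section \<open>Integrability of continuous functions\<close>

lemma borel_continuous_M: "continuous_on M f \<Longrightarrow> f \<in> borel_measurable (restrict_space borel M)"
  for f :: "'m \<Rightarrow> real"
  by (rule borel_measurable_continuous_on_restrict)

text \<open>After multiplication by a member of the partition of unity, the function has compact
  support in one chart. Integrability is required before integrals may be distributed over the sums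
  of the partition, since the Bochner integral of a nonintegrable function is zero by
  convention.\<close>

lemma integrable_volume_continuous:
  fixes h :: "'m \<Rightarrow> real"
  assumes h: "continuous_on M h" shows "integrable (volume_measure M A X) h"
proof -
  obtain I :: "'m set" and V \<psi> K \<rho> where "chart_partition I V \<psi> K \<rho>"
    using ex_chart_partition by blast
  note P = chart_partitionD[OF this]
  have sp: "space (volume_measure M A X) = M"
    using sets_eq_imp_space_eq[OF sets_volume_measure] by (simp add: space_restrict_space)
  have "integrable (volume_measure M A X) (\<lambda>p. \<rho> i p * h p)" if i: "i \<in> I" for i
  proof (rule integral_volume_measure(2)[OF P(2)[OF i], THEN iffD2])
    have cont: "continuous_on M (\<lambda>p. \<rho> i p * h p)"
      by (intro continuous_on_mult C1M_continuous[OF P(5)[OF i]] h)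
    then show "(\<lambda>p. \<rho> i p * h p) \<in> borel_measurable (restrict_space borel M)" by (rule borel_continuous_M)
    show "\<rho> i p * h p = 0" if "p \<in> M" "p \<notin> \<psi> i ` V i" for p
      using P(6)[OF i, of p] that P(4)[OF i] by auto
    have c: "continuous_on (V i) (\<lambda>x. \<rho> i (\<psi> i x) * h (\<psi> i x))"
      by (rule continuous_on_compose2[OF cont chart(3)[OF P(2)[OF i]] chart(6)[OF P(2)[OF i]]])
    show "integrable lborel (\<lambda>x. indicator (V i) x * (vdens (\<psi> i) x * (\<rho> i (\<psi> i x) * h (\<psi> i x))))"
    proof (rule integrable_compact_support[OF P(3,4)[OF i] continuous_on_mult[OF chart_context(2)[OF P(2)[OF i]] c]])
      fix x assume x: "x \<in> V i - K i"
      have "\<psi> i x \<in> M - \<psi> i ` K i"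
        using x chart(4,6)[OF P(2)[OF i]] P(4)[OF i] by (auto dest: inj_onD)
      then show "vdens (\<psi> i) x * (\<rho> i (\<psi> i x) * h (\<psi> i x)) = 0" using P(6)[OF i] by simp
    qed
  qed
  then have "integrable (volume_measure M A X) (\<lambda>p. \<Sum>i\<in>I. \<rho> i p * h p)"
    by (rule Bochner_Integration.integrable_sum)
  moreover have "(\<Sum>i\<in>I. \<rho> i p * h p) = h p" if "p \<in> M" for p
    using P(7)[OF that] by (simp add: sum_distrib_right[symmetric])
  ultimately show ?thesis
    by (subst Bochner_Integration.integrable_cong[OF refl, where g = "\<lambda>p. \<Sum>i\<in>I. \<rho> i p * h p"]) (simp_all add: sp)
qed

lemma support_chart:
  assumes c: "(V, \<psi>) \<in> A" and K: "K \<subseteq> V" and x: "x \<in> V - K"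
  shows "\<psi> x \<in> M - \<psi> ` K"
  using x chart(4,6)[OF c] K by (auto dest: inj_onD)

lemma borel_continuous_bd: "continuous_on M f \<Longrightarrow> f \<in> borel_measurable (restrict_space borel bd)"
  for f :: "'m \<Rightarrow> real"
  by (rule borel_measurable_continuous_on_restrict) (rule continuous_on_subset[OF _ mboundary_subset])

lemma integrable_boundary_support:
  fixes h :: "'m \<Rightarrow> real"
  assumes c: "(V, \<psi>) \<in> A" and K: "compact K" "K \<subseteq> V" and h: "continuous_on M h"
    and supp: "\<And>p. p \<in> M - \<psi> ` K \<Longrightarrow> h p = 0"
  shows "integrable (boundary_measure e A X) h"
proof (rule integral_boundary_measure(2)[OF c borel_continuous_bd[OF h], THEN iffD2])
  show "h p = 0" if "p \<in> bd" "p \<notin> \<psi> ` V" for p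
    using supp[of p] that mboundary_subset K(2) by auto
  have cont: "continuous_on V (\<lambda>x. h (\<psi> x))"
    by (rule continuous_on_compose2[OF h chart(3)[OF c] chart(6)[OF c]])
  have Kc: "compact (K \<inter> {x. x $ e = 0})" by (rule compact_Int_closed[OF K(1) closed_face])
  show "integrable (hyperplane_lborel e) (\<lambda>x. indicator (face e V) x * (bdens \<psi> x * h (\<psi> x)))"
  proof (rule integrable_hyperplane_compact_support[OF Kc])
    show "continuous_on (face e V) (\<lambda>x. bdens \<psi> x * h (\<psi> x))"
      by (rule continuous_on_subset[OF continuous_on_mult[OF chart_context(3)[OF c] cont]]) auto
    fix x assume "x \<in> face e V - K \<inter> {x. x $ e = 0}"
    then have "x \<in> V - K" by auto
    then show "bdens \<psi> x * h (\<psi> x) = 0" using supp[OF support_chart[OF c K(2)]] by simp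
  qed (use K(2) in auto)
qed

section \<open>Green's formula and the Laplacian\<close>

text \<open>Enough regularity for the coordinate Laplacian to be continuous in every chart. Smooth
  functions on the hypersurface and restrictions of smooth ambient functions both have it.\<close>

definition C2M :: "('m \<Rightarrow> real) \<Rightarrow> bool" where
  "C2M u \<longleftrightarrow> (\<forall>(V, \<psi>)\<in>A. C1_on e V (u \<circ> \<psi>) \<and> (\<forall>v. C1_on e V (\<lambda>x. dH e (u \<circ> \<psi>) x v)))"

lemma C2M_D:
  assumes "C2M u" "(V, \<psi>) \<in> A"
  shows "C1_on e V (u \<circ> \<psi>)" "C1_on e V (\<lambda>x. dH e (u \<circ> \<psi>) x v)"
  using assms unfolding C2M_def by fast+

lemma C2M_C1M: "C2M u \<Longrightarrow> C1M u"
  by (rule C1M_I) (rule C2M_D)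

text \<open>A component of the gradient of \<open>u\<close>, multiplied by the volume density. With
  this factor included, the Laplacian is an ordinary divergence up to division by the density, and
  integration by parts is done with Lebesgue measure.\<close>

definition flux :: "(real^'k \<Rightarrow> 'm) \<Rightarrow> ('m \<Rightarrow> real) \<Rightarrow> 'k \<Rightarrow> real^'k \<Rightarrow> real" where
  "flux \<psi> u i x = vdens \<psi> x *
     (\<Sum>j\<in>UNIV. matrix_inv (gram (Dpar \<psi> x)) $ i $ j * dH e (u \<circ> \<psi>) x (axis j 1))"

definition lap :: "(real^'k \<Rightarrow> 'm) \<Rightarrow> ('m \<Rightarrow> real) \<Rightarrow> real^'k \<Rightarrow> real" where
  "lap \<psi> u x = (\<Sum>i\<in>UNIV. dH e (flux \<psi> u i) x (axis i 1)) / vdens \<psi> x"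

text \<open>The inner product of the gradients of \<open>f\<close> and \<open>u\<close>, expressed
  through their differentials.\<close>

definition pairing :: "(real^'k \<Rightarrow> 'm) \<Rightarrow> ('m \<Rightarrow> real) \<Rightarrow> ('m \<Rightarrow> real) \<Rightarrow> real^'k \<Rightarrow> real" where
  "pairing \<psi> f u x = copair (Dpar \<psi> x) (dH e (f \<circ> \<psi>) x) (dH e (u \<circ> \<psi>) x)"

lemma C1_flux:
  assumes c: "(V, \<psi>) \<in> A" and u: "C2M u" shows "C1_on e V (flux \<psi> u i)"
proof -
  note V = chart(1)[OF c]
  have "C1_on e V (\<lambda>x. matrix_inv (gram (Dpar \<psi> x)) $ i $ j)" for j
    by (rule C1_on_matrix_inv[OF V C1_gram(1)[OF c]]) (use dens_pos(1)[OF c] in fastforce)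
  then show ?thesis
    unfolding flux_def[abs_def]
    by (intro C1_on_mult[OF V] C1_dens(1)[OF c] C1_on_sum[OF V] C2M_D(2)[OF u c]) auto
qed

lemma local_laplacian_eq:
  assumes c: "(V, \<psi>) \<in> A" and x: "x \<in> V"
  shows "local_laplacian V (X \<circ> \<psi>) (u \<circ> \<psi>) x = lap \<psi> u x"
proof -
  note V = chart(1)[OF c]
  have "partial V (\<lambda>y. sqrt (det (induced_metric V (X \<circ> \<psi>) y)) *
      (\<Sum>j\<in>UNIV. matrix_inv (induced_metric V (X \<circ> \<psi>) y) $ i $ j * partial V (u \<circ> \<psi>) j y)) i x =
    dH e (flux \<psi> u i) x (axis i 1)" for i
  proof -
    have "dH e (\<lambda>y. sqrt (det (induced_metric V (X \<circ> \<psi>) y)) *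
      (\<Sum>j\<in>UNIV. matrix_inv (induced_metric V (X \<circ> \<psi>) y) $ i $ j * partial V (u \<circ> \<psi>) j y)) x =
      dH e (flux \<psi> u i) x"
      by (rule dH_cong[OF V x]) (simp add: flux_def vdens_def induced_metric_eq[OF c] partial_eq_dH[OF V])
    then show ?thesis by (simp add: partial_eq_dH[OF V x])
  qed
  then show ?thesis by (simp add: local_laplacian_def lap_def vdens_def induced_metric_eq[OF c x])
qed

lemma continuous_lap:
  assumes c: "(V, \<psi>) \<in> A" and u: "C2M u" shows "continuous_on V (lap \<psi> u)"
  unfolding lap_def[abs_def]
  by (intro continuous_on_divide continuous_on_sum C1_on_continuous_dH[OF C1_flux[OF c u]] chart_context(2)[OF c])
    (use dens_pos(3)[OF c] in fastforce)

lemma continuous_pairing: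
  assumes c: "(V, \<psi>) \<in> A" and f: "C1M f" and u: "C1M u" shows "continuous_on V (pairing \<psi> f u)"
proof -
  note V = chart(1)[OF c]
  have "C1_on e V (\<lambda>x. matrix_inv (gram (Dpar \<psi> x)) $ i $ j)" for i j
    by (rule C1_on_matrix_inv[OF V C1_gram(1)[OF c]]) (use dens_pos(1)[OF c] in fastforce)
  then have "continuous_on V (\<lambda>x. matrix_inv (gram (Dpar \<psi> x)) $ i $ j)" for i j
    by (rule C1_on_continuous[OF V])
  then show ?thesis
    unfolding pairing_def[abs_def] copair_def
    by (intro continuous_on_sum continuous_on_mult C1_on_continuous_dH[OF C1M_D[OF f c]]
       C1_on_continuous_dH[OF C1M_D[OF u c]])
qed

text \<open>Only first derivatives occur, so the chain rule and \<open>copair_compose\<close>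
  suffice. The chart independence of the Laplacian is deduced from this fact.\<close>

lemma pairing_change:
  assumes c: "(V, \<psi>) \<in> A" and d: "(W, \<theta>) \<in> A" and x: "x \<in> overlap V \<psi> W \<theta>"
    and f: "C1M f" and u: "C1M u"
  shows "pairing \<psi> f u x = pairing \<theta> f u (transition W \<theta> \<psi> x)"
proof -
  note y = transition_apply(1)[OF c d x]
  show ?thesis
    unfolding pairing_def Dpar_def chart_change(2)[OF c d C1_param(1)[OF d] x]
      chart_change(2)[OF c d C1M_D[OF f d] x] chart_change(2)[OF c d C1M_D[OF u d] x]
    by (rule copair_compose[OF C1_param(3,4)[OF d y] C1_on_linear[OF C1M_D[OF f d] y]
       C1_on_linear[OF C1M_D[OF u d] y] dH_transition[OF c d x]])
qed

lemma pairing_sym: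
  assumes c: "(V, \<psi>) \<in> A" and x: "x \<in> V" and f: "C1M f" and u: "C1M u"
  shows "pairing \<psi> f u x = pairing \<psi> u f x"
  unfolding pairing_def
  by (rule copair_sym[OF Dpar[OF c x] C1_on_linear[OF C1M_D[OF f c] x] C1_on_linear[OF C1M_D[OF u c] x]])

lemma flux_pairing:
  "(\<Sum>i\<in>UNIV. dH e (f \<circ> \<psi>) x (axis i 1) * flux \<psi> u i x) = vdens \<psi> x * pairing \<psi> f u x"
  by (simp add: flux_def pairing_def copair_def sum_distrib_left mult_ac)

text \<open>The divergence theorem in the half-space for the field \<open>f\<close> times
  \<open>flux \<psi> u\<close>. The product rule splits its divergence into the Laplacian term and
  the gradient term, and among the components only the one normal to the hyperplane leaves a
  boundary integral.\<close>

lemma green_local: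
  assumes c: "(V, \<psi>) \<in> A" and K: "compact K" "K \<subseteq> V" and f: "C1M f" and u: "C2M u"
    and supp: "\<And>p. p \<in> M - \<psi> ` K \<Longrightarrow> f p = 0"
  shows "(\<integral>x. indicator V x * (vdens \<psi> x * (f (\<psi> x) * lap \<psi> u x)) \<partial>lborel) +
      (\<integral>x. indicator V x * (vdens \<psi> x * pairing \<psi> f u x) \<partial>lborel) =
    - (\<integral>x. indicator V x * (f (\<psi> x) * flux \<psi> u e x) \<partial>hyperplane_lborel e)"
proof -
  note V = chart(1)[OF c]
  let ?Y = "\<lambda>i x. (f \<circ> \<psi>) x * flux \<psi> u i x"
  have C1f: "C1_on e V (f \<circ> \<psi>)" by (rule C1M_D[OF f c])
  have C1Y: "C1_on e V (?Y i)" for i by (rule C1_on_mult[OF V C1f C1_flux[OF c u]])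
  have f0: "(f \<circ> \<psi>) x = 0" if "x \<in> V - K" for x using supp[OF support_chart[OF c K(2) that]] by simp
  have Y0: "?Y i x = 0" if "x \<in> V - K" for i x using f0[OF that] by simp
  have sumY: "(\<Sum>i\<in>UNIV. dH e (?Y i) x (axis i 1)) =
      vdens \<psi> x * (f (\<psi> x) * lap \<psi> u x) + vdens \<psi> x * pairing \<psi> f u x" if x: "x \<in> V" for x
  proof -
    have "(\<Sum>i\<in>UNIV. dH e (?Y i) x (axis i 1)) = (\<Sum>i\<in>UNIV. (f \<circ> \<psi>) x * dH e (flux \<psi> u i) x (axis i 1)) +
        (\<Sum>i\<in>UNIV. dH e (f \<circ> \<psi>) x (axis i 1) * flux \<psi> u i x)"
      by (simp only: dH_mult[OF V C1f C1_flux[OF c u] x] sum.distrib)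
    also have "(\<Sum>i\<in>UNIV. (f \<circ> \<psi>) x * dH e (flux \<psi> u i) x (axis i 1)) = vdens \<psi> x * (f (\<psi> x) * lap \<psi> u x)"
      using dens_pos(3)[OF c x] by (simp add: lap_def sum_distrib_left[symmetric])
    finally show ?thesis unfolding flux_pairing .
  qed
  have int: "integrable lborel (\<lambda>x. indicator V x * dH e (?Y i) x (axis i 1))" for i
    by (rule integrable_compact_support[OF K C1_on_continuous_dH[OF C1Y]])
      (use dH_zero_off_support[OF V K(1) Y0] in simp)
  have cf: "continuous_on V (\<lambda>x. f (\<psi> x))" using C1_on_continuous[OF V C1f] by (simp add: comp_def)
  have int1: "integrable lborel (\<lambda>x. indicator V x * (vdens \<psi> x * (f (\<psi> x) * lap \<psi> u x)))"
    by (rule integrable_compact_support[OF K continuous_on_mult[OF chart_context(2)[OF c]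
      continuous_on_mult[OF cf continuous_lap[OF c u]]]]) (use f0 in simp)
  have int2: "integrable lborel (\<lambda>x. indicator V x * (vdens \<psi> x * pairing \<psi> f u x))"
  proof (rule integrable_compact_support[OF K continuous_on_mult[OF chart_context(2)[OF c]
      continuous_pairing[OF c f C2M_C1M[OF u]]]])
    fix x assume x: "x \<in> V - K"
    have "dH e (f \<circ> \<psi>) x = (\<lambda>v. 0)" by (rule dH_zero_off_support[OF V K(1) _ x]) (rule f0)
    then show "vdens \<psi> x * pairing \<psi> f u x = 0" by (simp add: pairing_def copair_def)
  qed
  have "(\<integral>x. indicator V x * (vdens \<psi> x * (f (\<psi> x) * lap \<psi> u x)) \<partial>lborel) +
      (\<integral>x. indicator V x * (vdens \<psi> x * pairing \<psi> f u x) \<partial>lborel) =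
      (\<integral>x. indicator V x * (vdens \<psi> x * (f (\<psi> x) * lap \<psi> u x)) +
        indicator V x * (vdens \<psi> x * pairing \<psi> f u x) \<partial>lborel)"
    by (rule Bochner_Integration.integral_add[OF int1 int2, symmetric])
  also have "\<dots> = (\<integral>x. (\<Sum>i\<in>UNIV. indicator V x * dH e (?Y i) x (axis i 1)) \<partial>lborel)"
  proof (rule Bochner_Integration.integral_cong[OF refl])
    fix x
    show "indicator V x * (vdens \<psi> x * (f (\<psi> x) * lap \<psi> u x)) + indicator V x * (vdens \<psi> x * pairing \<psi> f u x) =
      (\<Sum>i\<in>UNIV. indicator V x * dH e (?Y i) x (axis i 1))"
      using sumY[of x] by (simp add: sum_distrib_left[symmetric] indicator_def)
  qed
  also have "\<dots> = (\<Sum>i\<in>UNIV. \<integral>x. indicator V x * dH e (?Y i) x (axis i 1) \<partial>lborel)"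
    by (rule Bochner_Integration.integral_sum[OF int])
  also have "\<dots> = (\<Sum>i\<in>UNIV. if i = e then - (\<integral>x. indicator V x * ?Y i x \<partial>hyperplane_lborel e) else 0)"
    by (rule sum.cong[OF refl]) (rule integral_partial_openH[OF V C1Y K Y0])
  also have "\<dots> = - (\<integral>x. indicator V x * (f (\<psi> x) * flux \<psi> u e x) \<partial>hyperplane_lborel e)"
    by simp
  finally show ?thesis .
qed

text \<open>The gradient term as a function on \<open>M\<close>, evaluated in a chosen chart like
  \<open>laplace_beltrami\<close>. It is needed to say that the gradient terms computed in different
  charts are the same integral.\<close>

definition gpair :: "('m \<Rightarrow> real) \<Rightarrow> ('m \<Rightarrow> real) \<Rightarrow> 'm \<Rightarrow> real" where
  "gpair f u p = (let (V, \<psi>) = (SOME c. c \<in> A \<and> p \<in> snd c ` fst c) in pairing \<psi> f u (inv_into V \<psi> p))"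

lemma some_chart:
  assumes c: "(V, \<psi>) \<in> A" and x: "x \<in> V"
  obtains W \<theta> where "(SOME c. c \<in> A \<and> \<psi> x \<in> snd c ` fst c) = (W, \<theta>)" "(W, \<theta>) \<in> A"
    "x \<in> overlap V \<psi> W \<theta>" "inv_into W \<theta> (\<psi> x) = transition W \<theta> \<psi> x"
proof -
  let ?P = "\<lambda>c :: ('m, 'k) chart. c \<in> A \<and> \<psi> x \<in> snd c ` fst c"
  have "?P (V, \<psi>)" using c x by simp
  then have P: "?P (SOME c. ?P c)" by (rule someI)
  obtain W \<theta> where W: "(SOME c. ?P c) = (W, \<theta>)" by (rule prod.exhaust)
  have "(W, \<theta>) \<in> A" "\<psi> x \<in> \<theta> ` W" using P unfolding W by simp_all
  moreover from this have "x \<in> overlap V \<psi> W \<theta>" using x by (simp add: overlap_def)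
  ultimately show thesis using that W by (simp add: transition_def)
qed

lemma gpair_chart:
  assumes c: "(V, \<psi>) \<in> A" and x: "x \<in> V" and f: "C1M f" and u: "C1M u"
  shows "gpair f u (\<psi> x) = pairing \<psi> f u x"
proof -
  obtain W \<theta> where W: "(SOME c. c \<in> A \<and> \<psi> x \<in> snd c ` fst c) = (W, \<theta>)" "(W, \<theta>) \<in> A"
    "x \<in> overlap V \<psi> W \<theta>" "inv_into W \<theta> (\<psi> x) = transition W \<theta> \<psi> x"
    by (rule some_chart[OF c x])
  show ?thesis
    unfolding gpair_def W(1) Let_def prod.case W(4) pairing_change[OF c W(2,3) f u] ..
qed

lemma gpair_continuous:
  assumes f: "C1M f" and u: "C1M u" shows "continuous_on M (gpair f u)"
proof (rule continuous_on_M)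
  fix V \<psi> assume c: "(V, \<psi>) \<in> A"
  show "continuous_on V (gpair f u \<circ> \<psi>)"
    by (rule continuous_on_eq[OF continuous_pairing[OF c f u]]) (simp add: gpair_chart[OF c _ f u])
qed

lemma gpair_sym:
  assumes "p \<in> M" and f: "C1M f" and u: "C1M u" shows "gpair f u p = gpair u f p"
proof -
  obtain V \<psi> x where c: "(V, \<psi>) \<in> A" "x \<in> V" "p = \<psi> x" by (rule chart_at[OF assms(1)])
  show ?thesis unfolding c(3) gpair_chart[OF c(1,2) f u] gpair_chart[OF c(1,2) u f]
    by (rule pairing_sym[OF c(1,2) f u])
qed

text \<open>Linearity in the first argument. The decomposition of \<open>g\<close> is required on
  \<open>M\<close> only, as nothing else is seen in charts. It serves for partitions of unity and
  for splitting the constant 1 into 1 - F and F.\<close>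

lemma gpair_sum:
  assumes p: "p \<in> M" and I: "finite I" and f: "\<And>i. i \<in> I \<Longrightarrow> C1M (f i)" and u: "C1M u"
    and g: "C1M g" and eq: "\<And>q. q \<in> M \<Longrightarrow> g q = (\<Sum>i\<in>I. f i q)"
  shows "gpair g u p = (\<Sum>i\<in>I. gpair (f i) u p)"
proof -
  obtain V \<psi> x where c: "(V, \<psi>) \<in> A" "x \<in> V" "p = \<psi> x" by (rule chart_at[OF p])
  note V = chart(1)[OF c(1)]
  have "dH e (g \<circ> \<psi>) x = dH e (\<lambda>y. \<Sum>i\<in>I. (f i \<circ> \<psi>) y) x"
    by (rule dH_cong[OF V c(2)]) (use eq chart(6)[OF c(1)] in auto)
  also have "\<dots> = (\<lambda>v. \<Sum>i\<in>I. dH e (f i \<circ> \<psi>) x v)"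
    by (rule dH_sum[OF V I _ c(2)]) (rule C1M_D[OF f c(1)])
  finally have d: "dH e (g \<circ> \<psi>) x = (\<lambda>v. \<Sum>i\<in>I. dH e (f i \<circ> \<psi>) x v)" .
  have "pairing \<psi> g u x = (\<Sum>i\<in>I. pairing \<psi> (f i) u x)"
    unfolding pairing_def copair_def d sum_distrib_right by (rule sum.swap)
  also have "\<dots> = (\<Sum>i\<in>I. gpair (f i) u p)"
    by (rule sum.cong[OF refl]) (simp add: c(3) gpair_chart[OF c(1,2) f u])
  finally show ?thesis unfolding c(3) gpair_chart[OF c(1,2) g u] .
qed

text \<open>The complement of the support is relatively open, so the differential of
  \<open>f\<close> vanishes there along with \<open>f\<close>. Hence \<open>gpair f u\<close> lives
  in the chart.\<close>

lemma integral_gpair: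
  assumes c: "(V, \<psi>) \<in> A" and K: "compact K" "K \<subseteq> V" and f: "C1M f" and u: "C1M u"
    and supp: "\<And>p. p \<in> M - \<psi> ` K \<Longrightarrow> f p = 0"
  shows "(\<integral>p. gpair f u p \<partial>volume_measure M A X) = (\<integral>x. indicator V x * (vdens \<psi> x * pairing \<psi> f u x) \<partial>lborel)"
proof -
  have "gpair f u p = 0" if p: "p \<in> M" "p \<notin> \<psi> ` V" for p
  proof -
    obtain W \<theta> y where d: "(W, \<theta>) \<in> A" "y \<in> W" "p = \<theta> y" by (rule chart_at[OF p(1)])
    let ?W2 = "W \<inter> \<theta> -` (M - \<psi> ` K)"
    have "openin (top_of_set W) ?W2"
      by (rule continuous_openin_preimage[OF chart(3)[OF d(1)] _ openin_compl_compact[OF c K]])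
        (use chart(6)[OF d(1)] in auto)
    then have W2: "openH e ?W2" using chart(1)[OF d(1)] by (rule openin_trans)
    have y: "y \<in> ?W2" using d p K(2) by auto
    have "dH e (f \<circ> \<theta>) y = dH e (\<lambda>_. 0) y"
      by (rule dH_cong[OF W2 y]) (use supp in auto)
    then have "dH e (f \<circ> \<theta>) y = (\<lambda>v. 0)" using dH_const[OF openH_subset[OF W2 y]] by simp
    then show ?thesis unfolding d(3) gpair_chart[OF d(1,2) f u] by (simp add: pairing_def copair_def)
  qed
  from integral_volume_measure(1)[OF c borel_continuous_M[OF gpair_continuous[OF f u]] this]
  have "(\<integral>p. gpair f u p \<partial>volume_measure M A X) = (\<integral>x. indicator V x * (vdens \<psi> x * gpair f u (\<psi> x)) \<partial>lborel)"
    by simp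
  also have "\<dots> = (\<integral>x. indicator V x * (vdens \<psi> x * pairing \<psi> f u x) \<partial>lborel)"
    by (rule Bochner_Integration.integral_cong[OF refl]) (simp add: indicator_def gpair_chart[OF c _ f u])
  finally show ?thesis .
qed

text \<open>\<open>hyperplane_lborel\<close> is concentrated on the hyperplane, so only the values
  with vanishing normal coordinate count.\<close>

lemma flux_integral_zero:
  assumes "\<And>x. x \<in> V \<Longrightarrow> x $ e = 0 \<Longrightarrow> f (\<psi> x) = 0"
  shows "(\<integral>x. indicator V x * (f (\<psi> x) * flux \<psi> u e x) \<partial>hyperplane_lborel e) = 0"
proof (rule integral_eq_zero_AE)
  show "AE x in hyperplane_lborel e. indicator V x * (f (\<psi> x) * flux \<psi> u e x) = 0"
    using AE_hyperplane_lborel by (rule AE_mp) (use assms in \<open>auto simp: indicator_def\<close>)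
qed

text \<open>Tested against bump functions, every term of Green's formula except the Laplacian is
  independent of the chart. Hence so is the Laplacian.\<close>

lemma lap_change:
  assumes c: "(V, \<psi>) \<in> A" and d: "(W, \<theta>) \<in> A" and x0: "x0 \<in> overlap V \<psi> W \<theta>" and u: "C2M u"
  shows "lap \<psi> u x0 = lap \<theta> u (transition W \<theta> \<psi> x0)"
proof (rule ccontr)
  let ?O = "overlap V \<psi> W \<theta>" and ?t = "transition W \<theta> \<psi>"
  assume neq: "lap \<psi> u x0 \<noteq> lap \<theta> u (?t x0)"
  note O = openH_overlap[OF c d]
  have OV: "?O \<subseteq> V" by (auto simp: overlap_def)
  have tc: "continuous_on ?O ?t" by (rule C1_on_continuous[OF O C1_transition[OF c d]])
  have tW: "?t ` ?O \<subseteq> W" using transition_apply(1)[OF c d] by auto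
  \<comment> \<open>The sign \<open>s\<close> makes the difference \<open>\<delta>\<close> positive
    at \<open>x0\<close>, hence on the relatively open set \<open>N\<close> around it.\<close>
  define s where "s = sgn (lap \<psi> u x0 - lap \<theta> u (?t x0))"
  define \<delta> where "\<delta> x = s * (lap \<psi> u x - lap \<theta> u (?t x))" for x
  have \<delta>c: "continuous_on ?O \<delta>"
    unfolding \<delta>_def
    by (intro continuous_intros continuous_on_subset[OF continuous_lap[OF c u] OV]
        continuous_on_compose2[OF continuous_lap[OF d u] tc tW])
  have "0 < \<delta> x0" using neq by (auto simp: \<delta>_def s_def sgn_if)
  define N where "N = ?O \<inter> \<delta> -` {0<..}"
  have "openin (top_of_set ?O) N"
    unfolding N_def by (rule continuous_openin_preimage_gen[OF \<delta>c]) simp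
  then have N: "openH e N" using O by (rule openin_trans)
  have x0N: "x0 \<in> N" using x0 \<open>0 < \<delta> x0\<close> by (simp add: N_def)
  have pos: "open {x :: real^'k. 0 < x $ e}" by (intro open_Collect_less continuous_intros)
  obtain r0 where r0: "0 < r0" "cball x0 r0 \<inter> halfspace e \<subseteq> N" by (rule openH_ball[OF N x0N])
  \<comment> \<open>\<open>x0\<close> may be a boundary point. The test function is centred further
    inside, at a point where \<open>\<delta>\<close> is still positive and small balls avoid the
    hyperplane.\<close>
  define x1 where "x1 = x0 + (r0 / 2) *\<^sub>R axis e 1"
  have x0H: "x0 \<in> halfspace e" by (rule openH_subset[OF N x0N])
  have x1: "0 < x1 $ e" using x0H r0(1) by (simp add: x1_def halfspace_def)
  have "dist x0 x1 = r0 / 2" using r0(1) by (simp add: x1_def dist_norm)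
  then have "x1 \<in> cball x0 r0 \<inter> halfspace e" using r0(1) x1 by (simp add: halfspace_def)
  then have "x1 \<in> N \<inter> {x. 0 < x $ e}" using r0(2) x1 by auto
  moreover have "openH e (N \<inter> {x. 0 < x $ e})" by (rule openin_Int_open[OF N pos])
  ultimately obtain r where r: "0 < r" "cball x1 r \<inter> halfspace e \<subseteq> N \<inter> {x. 0 < x $ e}"
    using openH_ball by blast
  define K where "K = cball x1 r \<inter> halfspace e"
  have K: "compact K" unfolding K_def by (intro compact_Int_closed closed_halfspace compact_cball)
  have KN: "K \<subseteq> N" "\<And>x. x \<in> K \<Longrightarrow> 0 < x $ e" using r(2) unfolding K_def by auto
  have KO: "K \<subseteq> ?O" using KN(1) by (auto simp: N_def)
  then have KV: "K \<subseteq> V" using OV by blast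
  obtain b where b: "C1M b" "\<forall>p. 0 \<le> b p" "\<forall>p\<in>M - \<psi> ` K. b p = 0" "\<forall>y\<in>V \<inter> ball x1 r. 0 < b (\<psi> y)"
    using bump[OF c r(1), of x1] KV unfolding K_def by blast
  define K' where "K' = ?t ` K"
  have K': "compact K'" unfolding K'_def by (rule compact_continuous_image[OF continuous_on_subset[OF tc KO] K])
  have K'W: "K' \<subseteq> W" unfolding K'_def using tW KO by blast
  have tK: "\<theta> (?t x) = \<psi> x" if "x \<in> K" for x using transition_apply(2)[OF c d] KO that by blast
  have im: "\<theta> ` K' = \<psi> ` K" unfolding K'_def image_image using tK by simp
  have bc: "b p = 0" if "p \<in> M - \<psi> ` K" for p using b(3) that by blast
  have bd': "b p = 0" if "p \<in> M - \<theta> ` K'" for p using b(3) that unfolding im by blast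
  have uC1: "C1M u" by (rule C2M_C1M[OF u])
  have fc: "(\<integral>x. indicator V x * (b (\<psi> x) * flux \<psi> u e x) \<partial>hyperplane_lborel e) = 0"
  proof (rule flux_integral_zero)
    fix x assume "x \<in> V" "x $ e = 0"
    then have "x \<in> V - K" using KN(2)[of x] by auto
    then show "b (\<psi> x) = 0" using bc[OF support_chart[OF c KV]] by blast
  qed
  have fd: "(\<integral>x. indicator W x * (b (\<theta> x) * flux \<theta> u e x) \<partial>hyperplane_lborel e) = 0"
  proof (rule flux_integral_zero)
    fix y assume y: "y \<in> W" "y $ e = 0"
    have K'pos: "0 < z $ e" if z: "z \<in> K'" for z
    proof -
      obtain x where "x \<in> K" "z = ?t x" using z unfolding K'_def by blast
      then show ?thesis using transition_interior[OF c d subsetD[OF KO] KN(2)] by simp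
    qed
    have "y \<in> W - K'" using y K'pos[of y] by auto
    then show "b (\<theta> y) = 0" using bd'[OF support_chart[OF d K'W]] by blast
  qed
  \<comment> \<open>Green's formula for the same bump function in both charts: the boundary terms
    vanish, and both gradient terms equal the integral of \<open>gpair b u\<close>.\<close>
  have same: "(\<integral>x. indicator V x * (vdens \<psi> x * (b (\<psi> x) * lap \<psi> u x)) \<partial>lborel) =
     (\<integral>y. indicator W y * (vdens \<theta> y * (b (\<theta> y) * lap \<theta> u y)) \<partial>lborel)"
    using green_local[OF c K KV b(1) u bc] green_local[OF d K' K'W b(1) u bd']
      integral_gpair[OF c K KV b(1) uC1 bc] integral_gpair[OF d K' K'W b(1) uC1 bd'] fc fd by simp
  \<comment> \<open>The integrand of chart \<open>\<theta>\<close> as a function on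
    \<open>M\<close>. Evaluating its integral over the volume measure in either chart takes the
    place of an explicit change of variables.\<close>
  define h where "h p = (if p \<in> \<theta> ` W then b p * lap \<theta> u (inv_into W \<theta> p) else 0)" for p
  have h_theta: "h (\<theta> y) = b (\<theta> y) * lap \<theta> u y" if "y \<in> W" for y
    using that inv_into_f_f[OF chart(4)[OF d] that] by (simp add: h_def)
  have hc: "continuous_on M h"
  proof (rule continuous_on_openin_cover)
    fix p assume p: "p \<in> M"
    show "\<exists>T. openin (top_of_set M) T \<and> p \<in> T \<and> continuous_on T h"
    proof (cases "p \<in> \<theta> ` W")
      case True
      have "continuous_on W (\<lambda>y. b (\<theta> y) * lap \<theta> u y)"
        by (intro continuous_on_mult continuous_lap[OF d u]
          continuous_on_compose2[OF C1M_continuous[OF b(1)] chart(3)[OF d] chart(6)[OF d]])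
      then have "continuous_on W (h \<circ> \<theta>)" by (rule continuous_on_eq) (simp add: h_theta)
      then show ?thesis using True chart(2)[OF d] continuous_on_chart_image[OF d] by blast
    next
      case False
      have "continuous_on (M - \<theta> ` K') h"
        by (rule continuous_on_eq[OF continuous_on_const[of _ 0]]) (use bd' in \<open>auto simp: h_def\<close>)
      then show ?thesis using False p K'W openin_compl_compact[OF d K' K'W] by blast
    qed
  qed
  have h0: "h p = 0" if "p \<in> M" "p \<notin> \<psi> ` V" for p
    using bc[of p] that KV by (auto simp: h_def)
  have "(\<integral>y. indicator W y * (vdens \<theta> y * (b (\<theta> y) * lap \<theta> u y)) \<partial>lborel) =
      (\<integral>y. indicator W y * (vdens \<theta> y * h (\<theta> y)) \<partial>lborel)"
    by (rule Bochner_Integration.integral_cong[OF refl]) (simp add: indicator_def h_theta)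
  also have "\<dots> = integral\<^sup>L (volume_measure M A X) h"
    by (rule integral_volume_measure(1)[OF d borel_continuous_M[OF hc], symmetric]) (simp add: h_def)
  also have "\<dots> = (\<integral>x. indicator V x * (vdens \<psi> x * h (\<psi> x)) \<partial>lborel)"
    by (rule integral_volume_measure(1)[OF c borel_continuous_M[OF hc] h0])
  finally have eq: "(\<integral>x. indicator V x * (vdens \<psi> x * (b (\<psi> x) * lap \<psi> u x)) \<partial>lborel) =
      (\<integral>x. indicator V x * (vdens \<psi> x * h (\<psi> x)) \<partial>lborel)" using same by simp
  \<comment> \<open>Up to the sign \<open>s\<close>, the difference of the two integrands in chart
    \<open>\<psi>\<close>. It is nonnegative and has integral zero, but it is nonzero on a nonempty
    open set.\<close>
  define g where "g x = indicator ?O x * (vdens \<psi> x * (b (\<psi> x) * \<delta> x))" for x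
  have b_off: "b (\<psi> x) = 0" if "x \<in> V - K" for x using bc[OF support_chart[OF c KV that]] .
  have h_off: "h (\<psi> x) = 0" if "x \<in> V - K" for x using b_off[OF that] by (simp add: h_def)
  have h_on: "h (\<psi> x) = b (\<psi> x) * lap \<theta> u (?t x)" if "x \<in> K" for x
    using h_theta[of "?t x"] tK[OF that] tW KO that by auto
  have cV: "continuous_on V (\<lambda>x. b (\<psi> x))" "continuous_on V (\<lambda>x. h (\<psi> x))"
    by (rule continuous_on_compose2[OF C1M_continuous[OF b(1)] chart(3)[OF c] chart(6)[OF c]],
        rule continuous_on_compose2[OF hc chart(3)[OF c] chart(6)[OF c]])
  have i1: "integrable lborel (\<lambda>x. indicator V x * (vdens \<psi> x * (b (\<psi> x) * lap \<psi> u x)))"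
    by (rule integrable_compact_support[OF K KV]) (use b_off in \<open>auto intro!: continuous_on_mult chart_context(2)[OF c] cV continuous_lap[OF c u]\<close>)
  have i2: "integrable lborel (\<lambda>x. indicator V x * (vdens \<psi> x * h (\<psi> x)))"
    by (rule integrable_compact_support[OF K KV]) (use h_off in \<open>auto intro!: continuous_on_mult chart_context(2)[OF c] cV\<close>)
  have g_eq: "g x = s * (indicator V x * (vdens \<psi> x * (b (\<psi> x) * lap \<psi> u x)) - indicator V x * (vdens \<psi> x * h (\<psi> x)))" for x
  proof -
    consider "x \<in> K" | "x \<in> V - K" | "x \<notin> V" by blast
    then show ?thesis
    proof cases
      case 1
      then have "x \<in> ?O" "x \<in> V" using KO KV by auto
      then show ?thesis using h_on[OF 1] by (simp add: g_def \<delta>_def algebra_simps)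
    next
      case 2
      then show ?thesis using h_off[OF 2] b_off[OF 2] by (simp add: g_def)
    next
      case 3
      then show ?thesis using OV by (auto simp: g_def indicator_def)
    qed
  qed
  have gi: "integrable lborel g" unfolding g_eq[abs_def] using i1 i2 by simp
  have g0: "integral\<^sup>L lborel g = 0" unfolding g_eq[abs_def] using i1 i2 eq by simp
  have gn: "0 \<le> g x" for x
  proof -
    consider "x \<in> K" | "x \<in> V - K" | "x \<notin> V" by blast
    then show ?thesis
    proof cases
      case 1
      then have "0 < \<delta> x" "x \<in> V" using KN(1) KV by (auto simp: N_def)
      then show ?thesis using b(2) dens_pos(3)[OF c, of x] by (simp add: g_def less_imp_le)
    next
      case 2
      then show ?thesis using b_off[OF 2] by (simp add: g_def)
    next
      case 3
      then show ?thesis using OV by (auto simp: g_def indicator_def)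
    qed
  qed
  \<comment> \<open>Positivity of the normal coordinate makes \<open>U\<close> open in the whole
    space, so that it cannot be a null set.\<close>
  define U where "U = ball x1 r \<inter> {x. 0 < x $ e}"
  have U: "open U" "x1 \<in> U" using pos x1 r(1) by (auto simp: U_def)
  have gU: "g x \<noteq> 0" if "x \<in> U" for x
  proof -
    have "x \<in> K" using that by (auto simp: U_def K_def halfspace_def)
    then have "0 < \<delta> x" "x \<in> V" "x \<in> ?O" using KN(1) KV KO by (auto simp: N_def)
    moreover have "0 < b (\<psi> x)" using b(4) \<open>x \<in> V\<close> that by (auto simp: U_def)
    ultimately show ?thesis using dens_pos(3)[OF c, of x] by (simp add: g_def)
  qed
  have "AE x in lborel. g x = 0"
    using integral_nonneg_eq_0_iff_AE[OF gi] gn g0 by simp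
  then have "AE x in lborel. x \<notin> U" by (rule AE_mp) (use gU in auto)
  then have "U \<in> null_sets lborel" using U(1) by (subst AE_iff_null_sets) auto
  then have "negligible U" by (simp add: negligible_iff_null_sets null_sets_completionI)
  then show False using open_not_negligible[OF U(1)] U(2) by blast
qed

lemma laplace_beltrami_chart:
  assumes c: "(V, \<psi>) \<in> A" and x: "x \<in> V" and u: "C2M u"
  shows "laplace_beltrami A X u (\<psi> x) = lap \<psi> u x"
proof -
  obtain W \<theta> where W: "(SOME c. c \<in> A \<and> \<psi> x \<in> snd c ` fst c) = (W, \<theta>)" "(W, \<theta>) \<in> A"
    "x \<in> overlap V \<psi> W \<theta>" "inv_into W \<theta> (\<psi> x) = transition W \<theta> \<psi> x"
    by (rule some_chart[OF c x])
  show ?thesis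
    unfolding laplace_beltrami_def W(1) Let_def prod.case W(4)
      local_laplacian_eq[OF W(2) transition_apply(1)[OF c W(2,3)]] lap_change[OF c W(2,3) u] ..
qed

lemma laplace_beltrami_continuous:
  assumes u: "C2M u" shows "continuous_on M (laplace_beltrami A X u)"
proof (rule continuous_on_M)
  fix V \<psi> assume c: "(V, \<psi>) \<in> A"
  show "continuous_on V (laplace_beltrami A X u \<circ> \<psi>)"
    by (rule continuous_on_eq[OF continuous_lap[OF c u]]) (simp add: laplace_beltrami_chart[OF c _ u])
qed

text \<open>Summing \<open>green_local\<close> over the products of \<open>f\<close> with the
  partition functions. The boundary term is left as a sum of chart integrals, because its two uses
  evaluate it differently: by the conormal derivative, or by the vanishing of \<open>f\<close> on
  the boundary.\<close>

lemma green_partition: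
  fixes I :: "'i set"
  assumes P: "chart_partition I V \<psi> K \<rho>" and f: "C1M f" and u: "C2M u"
  shows "(\<integral>p. f p * laplace_beltrami A X u p \<partial>volume_measure M A X) + (\<integral>p. gpair f u p \<partial>volume_measure M A X) =
    (\<Sum>i\<in>I. - (\<integral>x. indicator (V i) x * (\<rho> i (\<psi> i x) * f (\<psi> i x) * flux (\<psi> i) u e x) \<partial>hyperplane_lborel e))"
proof -
  note P = chart_partitionD[OF P]
  let ?\<mu> = "volume_measure M A X" and ?L = "laplace_beltrami A X u"
  let ?f = "\<lambda>i p. \<rho> i p * f p"
  have uC1: "C1M u" by (rule C2M_C1M[OF u])
  have sp: "space ?\<mu> = M"
    using sets_eq_imp_space_eq[OF sets_volume_measure] by (simp add: space_restrict_space)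
  have fi: "C1M (?f i)" if "i \<in> I" for i by (rule C1M_mult[OF P(5)[OF that] f])
  have sum: "(\<Sum>i\<in>I. ?f i p) = f p" if "p \<in> M" for p
    using P(7)[OF that] by (simp add: sum_distrib_right[symmetric])
  have cL: "continuous_on M (\<lambda>p. ?f i p * ?L p)" if "i \<in> I" for i
    by (intro continuous_on_mult C1M_continuous[OF fi[OF that]] laplace_beltrami_continuous[OF u])
  have "(\<integral>p. f p * ?L p \<partial>?\<mu>) = (\<integral>p. (\<Sum>i\<in>I. ?f i p * ?L p) \<partial>?\<mu>)"
  proof (rule Bochner_Integration.integral_cong[OF refl])
    fix p assume "p \<in> space ?\<mu>"
    then have "(\<Sum>i\<in>I. ?f i p) = f p" by (intro sum) (simp add: sp)
    then show "f p * ?L p = (\<Sum>i\<in>I. ?f i p * ?L p)" by (simp only: sum_distrib_right[symmetric])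
  qed
  also have "\<dots> = (\<Sum>i\<in>I. \<integral>p. ?f i p * ?L p \<partial>?\<mu>)"
    by (rule Bochner_Integration.integral_sum[OF integrable_volume_continuous[OF cL]])
  finally have 1: "(\<integral>p. f p * ?L p \<partial>?\<mu>) = (\<Sum>i\<in>I. \<integral>p. ?f i p * ?L p \<partial>?\<mu>)" .
  have "(\<integral>p. gpair f u p \<partial>?\<mu>) = (\<integral>p. (\<Sum>i\<in>I. gpair (?f i) u p) \<partial>?\<mu>)"
    by (rule Bochner_Integration.integral_cong[OF refl])
      (use gpair_sum[OF _ P(1) fi uC1 f] sum in \<open>simp add: sp\<close>)
  also have "\<dots> = (\<Sum>i\<in>I. \<integral>p. gpair (?f i) u p \<partial>?\<mu>)"
    by (rule Bochner_Integration.integral_sum[OF integrable_volume_continuous[OF gpair_continuous[OF fi uC1]]])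
  finally have 2: "(\<integral>p. gpair f u p \<partial>?\<mu>) = (\<Sum>i\<in>I. \<integral>p. gpair (?f i) u p \<partial>?\<mu>)" .
  have "(\<integral>p. ?f i p * ?L p \<partial>?\<mu>) + (\<integral>p. gpair (?f i) u p \<partial>?\<mu>) =
      - (\<integral>x. indicator (V i) x * (\<rho> i (\<psi> i x) * f (\<psi> i x) * flux (\<psi> i) u e x) \<partial>hyperplane_lborel e)"
    if i: "i \<in> I" for i
  proof -
    note c = P(2)[OF i] and K = P(3,4)[OF i]
    have supp: "?f i p = 0" if "p \<in> M - \<psi> i ` K i" for p using P(6)[OF i that] by simp
    have off: "?f i p * ?L p = 0" if "p \<in> M" "p \<notin> \<psi> i ` V i" for p
      using supp[of p] that K(2) by auto
    have "(\<integral>p. ?f i p * ?L p \<partial>?\<mu>) = (\<integral>x. indicator (V i) x * (vdens (\<psi> i) x * (?f i (\<psi> i x) * ?L (\<psi> i x))) \<partial>lborel)"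
      by (rule integral_volume_measure(1)[OF c borel_continuous_M[OF cL[OF i]] off])
    also have "\<dots> = (\<integral>x. indicator (V i) x * (vdens (\<psi> i) x * (?f i (\<psi> i x) * lap (\<psi> i) u x)) \<partial>lborel)"
      by (rule Bochner_Integration.integral_cong[OF refl]) (simp add: indicator_def laplace_beltrami_chart[OF c _ u])
    finally show ?thesis
      using green_local[OF c K fi[OF i] u supp] integral_gpair[OF c K fi[OF i] uC1 supp] by simp
  qed
  then show ?thesis unfolding 1 2 sum.distrib[symmetric] by (rule sum.cong[OF refl])
qed

end

section \<open>Free boundary hypersurfaces\<close>

lemma smooth_on_UNIV:
  fixes F :: "'a::real_normed_vector \<Rightarrow> 'b::real_normed_vector"
  assumes F: "smooth_on UNIV F"
  shows "F differentiable (at x)" and "continuous_on UNIV F"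
    and "smooth_on UNIV (\<lambda>x. frechet_derivative F (at x) v)"
proof -
  have loc: "\<exists>U g. open U \<and> x \<in> U \<and> (\<forall>k. Ck_on k U g) \<and> (\<forall>y\<in>U. g y = F y) \<and>
      (\<forall>y\<in>U. (F has_derivative frechet_derivative g (at y)) (at y))" for x
  proof -
    obtain U g where U: "open U" "x \<in> U" "\<And>k. Ck_on k U g" and g: "\<And>y. y \<in> U \<Longrightarrow> g y = F y"
      using F unfolding smooth_on_def by (metis IntI UNIV_I)
    have "(F has_derivative frechet_derivative g (at y)) (at y)" if y: "y \<in> U" for y
    proof -
      have "g differentiable at y" using U(3)[of 1] y by simp
      then have "(g has_derivative frechet_derivative g (at y)) (at y)"
        by (simp add: frechet_derivative_works)
      then show ?thesis by (rule has_derivative_transform_within_open[OF _ U(1) y g])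
    qed
    then show ?thesis using U g by blast
  qed
  show d: "F differentiable (at x)" for x
    using loc[of x] unfolding differentiable_def by blast
  then show "continuous_on UNIV F"
    by (simp add: continuous_on_eq_continuous_at differentiable_imp_continuous_within)
  show "smooth_on UNIV (\<lambda>x. frechet_derivative F (at x) v)"
    unfolding smooth_on_def
  proof
    fix x :: 'a
    from loc[of x] obtain U g where U: "open U" "x \<in> U" "\<And>k. Ck_on k U g"
      "\<And>y. y \<in> U \<Longrightarrow> (F has_derivative frechet_derivative g (at y)) (at y)" by blast
    show "\<exists>U g. open U \<and> x \<in> U \<and> (\<forall>k. Ck_on k U g) \<and> (\<forall>y\<in>U \<inter> UNIV. g y = frechet_derivative F (at y) v)"
    proof (intro exI conjI allI ballI)
      show "Ck_on k U (\<lambda>x. frechet_derivative g (at x) v)" for k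
        using U(3)[of "Suc k"] by simp
      fix y assume "y \<in> U \<inter> UNIV"
      then show "frechet_derivative g (at y) v = frechet_derivative F (at y) v"
        using frechet_derivative_at[OF U(4)[of y]] by simp
    qed (use U in auto)
  qed
qed

lemma C1_on_compose_smooth:
  fixes F :: "real^'n \<Rightarrow> real"
  assumes V: "openH e V" and P: "C1_on e V P" and F: "smooth_on UNIV F"
  shows "C1_on e V (\<lambda>x. F (P x))"
    and "x \<in> V \<Longrightarrow> dH e (\<lambda>x. F (P x)) x = (\<lambda>v. frechet_derivative F (at (P x)) (dH e P x v))"
proof -
  let ?D = "\<lambda>x v. frechet_derivative F (at (P x)) (dH e P x v)"
  have dF: "(F has_derivative frechet_derivative F (at z)) (at z)" for z
    using smooth_on_UNIV(1)[OF F] by (simp add: frechet_derivative_works)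
  have der: "((\<lambda>x. F (P x)) has_derivative ?D x) (at x within halfspace e)" if "x \<in> V" for x
    by (rule has_derivative_compose[OF C1_on_deriv[OF P that] dF])
  show "C1_on e V (\<lambda>x. F (P x))"
  proof (rule C1_onI[OF openin_imp_subset[OF V] der])
    fix v
    have "continuous_on V (\<lambda>x. \<Sum>j\<in>UNIV. dH e P x v $ j *\<^sub>R frechet_derivative F (at (P x)) (axis j 1))"
      by (intro continuous_intros C1_on_continuous_dH[OF P]
          continuous_on_compose2[OF smooth_on_UNIV(2)[OF smooth_on_UNIV(3)[OF F]] C1_on_continuous[OF V P]]) auto
    then show "continuous_on V (\<lambda>x. ?D x v)"
      by (rule continuous_on_eq) (rule linear_axis_expand[OF has_derivative_linear[OF dF], symmetric])
  qed
  show "dH e (\<lambda>x. F (P x)) x = ?D x" if "x \<in> V"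
    by (rule dH_eqI[OF der[OF that] openH_subset[OF V that]])
qed

text \<open>The vector of partial derivatives satisfies the definite description behind
  \<open>grad\<close>, and it is the only one to do so since a vector is determined by its inner
  products.\<close>

lemma grad_inner:
  fixes F :: "real^'n \<Rightarrow> real"
  assumes "F differentiable (at x)"
  shows "grad F x \<bullet> v = frechet_derivative F (at x) v"
    and "grad F x = (\<chi> j. frechet_derivative F (at x) (axis j 1))"
proof -
  let ?D = "\<chi> j. frechet_derivative F (at x) (axis j 1)"
  have dF: "(F has_derivative frechet_derivative F (at x)) (at x)"
    using assms by (simp add: frechet_derivative_works)
  have D: "?D \<bullet> v = frechet_derivative F (at x) v" for v
    using linear_axis_expand[OF has_derivative_linear[OF dF], of v] by (simp add: inner_vec_def mult.commute)
  have "GDERIV F x :> ?D"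
    using dF unfolding gderiv_def by (simp add: D inner_commute[of _ ?D])
  moreover have "D' = ?D" if "GDERIV F x :> D'" for D'
  proof -
    have "(\<lambda>h. h \<bullet> D') = frechet_derivative F (at x)"
      by (rule has_derivative_unique[OF that[unfolded gderiv_def] dF])
    then have "h \<bullet> D' = h \<bullet> ?D" for h
      using D[of h] inner_commute[of h ?D] fun_cong[of _ _ h] by metis
    then show ?thesis using vector_eq_ldot[of D' ?D] by blast
  qed
  ultimately show g: "grad F x = ?D" unfolding grad_def by (rule the_equality)
  show "grad F x \<bullet> v = frechet_derivative F (at x) v" unfolding g by (rule D)
qed

text \<open>Cramer's lemma for the identity matrix. It yields the Jacobian of a map that replaces
  one coordinate vector.\<close>

lemma det_replace_column:
  fixes u :: "real^'k::finite"
  shows "det (\<chi> i j. if j = k then u $ i else mat 1 $ i $ j) = u $ k"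
  using cramer_lemma[of k "mat 1 :: real^'k^'k" u] by (simp only: matrix_vector_mul_lid det_I mult_1_right)

section \<open>The ambient function on the hypersurface and its flux through the boundary\<close>

context immersed_hypersurface
begin

lemma C2M_smooth_map:
  assumes "smooth_map A u" shows "C2M u"
  unfolding C2M_def
proof (intro ballI, clarify)
  fix V \<psi> assume c: "(V, \<psi>) \<in> A"
  have s: "smooth_on V (u \<circ> \<psi>)" using assms c unfolding smooth_map_def by fast
  note V = chart(1)[OF c]
  show "C1_on e V (u \<circ> \<psi>) \<and> (\<forall>v. C1_on e V (\<lambda>x. dH e (u \<circ> \<psi>) x v))"
    using smooth_on_dH(1)[OF V s] smooth_on_dH(1)[OF V smooth_on_dH(2)[OF V s]] by blast
qed

text \<open>The differential is a sum over the ambient coordinates of partial derivatives of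
  \<open>F\<close> along \<open>X\<close> times components of the differential of
  \<open>X \<circ> \<psi>\<close>; all factors are continuously differentiable.\<close>

lemma C2M_ambient:
  fixes F :: "real^'n \<Rightarrow> real"
  assumes F: "smooth_on UNIV F" shows "C2M (F \<circ> X)"
  unfolding C2M_def
proof (intro ballI, clarify, intro conjI allI)
  fix V \<psi> v assume c: "(V, \<psi>) \<in> A"
  note V = chart(1)[OF c]
  have dF: "linear (frechet_derivative F (at z))" for z
    using smooth_on_UNIV(1)[OF F] frechet_derivative_works has_derivative_linear by blast
  have comp: "F \<circ> X \<circ> \<psi> = (\<lambda>x. F ((X \<circ> \<psi>) x))" by (simp add: fun_eq_iff)
  show "C1_on e V (F \<circ> X \<circ> \<psi>)"
    unfolding comp by (rule C1_on_compose_smooth(1)[OF V C1_param(1)[OF c] F])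
  show "C1_on e V (\<lambda>x. dH e (F \<circ> X \<circ> \<psi>) x v)"
  proof (rule C1_on_cong[OF V])
    show "C1_on e V (\<lambda>x. \<Sum>j\<in>UNIV. (dH e (X \<circ> \<psi>) x v \<bullet> axis j 1) *
        frechet_derivative F (at ((X \<circ> \<psi>) x)) (axis j 1))"
      by (intro C1_on_sum[OF V] C1_on_mult[OF V] C1_on_inner[OF V] C1_param[OF c]
          C1_on_const openin_imp_subset[OF V]
          C1_on_compose_smooth(1)[OF V C1_param(1)[OF c] smooth_on_UNIV(3)[OF F]]) simp
    fix x assume x: "x \<in> V"
    show "(\<Sum>j\<in>UNIV. (dH e (X \<circ> \<psi>) x v \<bullet> axis j 1) * frechet_derivative F (at ((X \<circ> \<psi>) x)) (axis j 1)) =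
        dH e (F \<circ> X \<circ> \<psi>) x v"
      unfolding comp C1_on_compose_smooth(2)[OF V C1_param(1)[OF c] F x]
      using linear_axis_expand[OF dF, of "(X \<circ> \<psi>) x" "dH e (X \<circ> \<psi>) x v"] by (simp add: inner_axis)
  qed
qed

text \<open>If \<open>P\<close> replaces the normal coordinate vector by \<open>v\<close>, then \<open>D \<circ> P\<close> has the same Gram matrix
  as the block diagonal map, and \<open>det P = v $ e\<close>.\<close>

lemma bdens_conormal:
  assumes D: "linear D" and v: "norm (D v) = 1" "\<And>w. w $ e = 0 \<Longrightarrow> D v \<bullet> D w = 0"
  shows "sqrt (det (gram (boundary_extend e D))) = \<bar>v $ e\<bar> * sqrt (det (gram D))"
proof -
  define P where "P w = drop_coord e w + w $ e *\<^sub>R v" for w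
  have P: "linear P"
    unfolding P_def[abs_def] using linear_drop_coord[of e]
    by (intro linearI) (simp_all add: linear_add linear_cmul algebra_simps)
  have DP: "D (P w) = D (drop_coord e w) + w $ e *\<^sub>R D v" for w
    by (simp add: P_def linear_add[OF D] linear_cmul[OF D])
  have vv: "D v \<bullet> D v = 1" using v(1) by (simp add: power2_norm_eq_inner[symmetric])
  have orth: "D v \<bullet> D (drop_coord e w) = 0" for w using v(2) by simp
  then have orth': "D (drop_coord e w) \<bullet> D v = 0" for w by (simp add: inner_commute)
  have "(D \<circ> P) w \<bullet> (D \<circ> P) w' = boundary_extend e D w \<bullet> boundary_extend e D w'" for w w'
    by (simp add: DP inner_add_left inner_add_right vv boundary_extend_def orth orth')
  then have "gram (boundary_extend e D) = gram (D \<circ> P)" by (simp add: gram_def)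
  moreover have "matrix P = (\<chi> i j. if j = e then v $ i else mat 1 $ i $ j)"
    by (auto simp: matrix_def P_def drop_coord_def axis_def mat_def vec_eq_iff)
  then have "det (matrix P) = v $ e" using det_replace_column[of e v] by simp
  ultimately show ?thesis using sqrt_det_gram_compose[OF D P] by simp
qed

text \<open>The conormal is the image of a coordinate vector \<open>v\<close> with negative normal
  component, and by hypothesis it is also the normalised gradient of \<open>F\<close>. So the
  gradient of \<open>F\<close> is tangent to the hypersurface, and its coordinate vector is
  \<open>v\<close> scaled by the norm of the gradient. The normal component of \<open>v\<close>
  gives the minus sign, and by \<open>bdens_conormal\<close> it converts the volume density into the
  boundary density.\<close>

lemma flux_conormal:
  fixes F :: "real^'n \<Rightarrow> real"
  assumes c: "(V, \<psi>) \<in> A" and x: "x \<in> V" "x $ e = 0" and F: "smooth_on UNIV F"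
    and free: "outward_unit_conormal e V (X \<circ> \<psi>) x (grad F (X (\<psi> x)) /\<^sub>R norm (grad F (X (\<psi> x))))"
  shows "- flux \<psi> (F \<circ> X) e x = bdens \<psi> x * norm (grad F (X (\<psi> x)))"
proof -
  let ?D = "Dpar \<psi> x" and ?g = "grad F (X (\<psi> x))"
  note V = chart(1)[OF c] and D = Dpar[OF c x(1)]
  have D_eq: "frechet_derivative (X \<circ> \<psi>) (at x within V) = ?D"
    by (simp add: Dpar_def at_within_openH[OF V x(1)])
  define n where "n = ?g /\<^sub>R norm ?g"
  have "norm n = 1 \<and> (\<exists>v. v $ e < 0 \<and> n = ?D v) \<and> (\<forall>w. w $ e = 0 \<longrightarrow> n \<bullet> ?D w = 0)"
    using free unfolding outward_unit_conormal_def Let_def n_def[symmetric] D_eq .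
  then obtain v where v: "norm n = 1" "v $ e < 0" "n = ?D v" "\<And>w. w $ e = 0 \<Longrightarrow> n \<bullet> ?D w = 0"
    by blast
  have comp: "F \<circ> X \<circ> \<psi> = (\<lambda>x. F ((X \<circ> \<psi>) x))" by (simp add: fun_eq_iff)
  have du: "dH e (F \<circ> X \<circ> \<psi>) x w = ?g \<bullet> ?D w" for w
    unfolding comp C1_on_compose_smooth(2)[OF V C1_param(1)[OF c] F x(1)] grad_inner(1)[OF smooth_on_UNIV(1)[OF F]]
    by (simp add: Dpar_def)
  have lin: "linear (dH e (F \<circ> X \<circ> \<psi>) x)"
    by (rule C1_on_linear[OF C2M_D(1)[OF C2M_ambient[OF F] c] x(1)])
  have g: "?g = norm ?g *\<^sub>R ?D v" unfolding v(3)[symmetric] n_def by (cases "?g = 0") simp_all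
  have "?D (norm ?g *\<^sub>R v) \<bullet> ?D w = dH e (F \<circ> X \<circ> \<psi>) x w" for w
    unfolding du linear_cmul[OF D(1)] g[symmetric] ..
  then have "norm ?g *\<^sub>R v = sharp ?D (dH e (F \<circ> X \<circ> \<psi>) x)"
    by (rule sharp_unique[OF D lin])
  then have "flux \<psi> (F \<circ> X) e x = vdens \<psi> x * (norm ?g * v $ e)"
    by (simp add: flux_def sharp_def vec_eq_iff)
  moreover have "bdens \<psi> x = - v $ e * vdens \<psi> x"
    using bdens_conormal[OF D(1), of v] v(1,2,4) unfolding v(3) bdens_def vdens_def by simp
  ultimately show ?thesis by simp
qed

text \<open>\<open>green_partition\<close> is used for \<open>f\<close> against
  \<open>F \<circ> X\<close>, where \<open>flux_conormal\<close> identifies the boundary term, and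
  for 1 - F against \<open>f\<close>, where it vanishes. Working with \<open>C2M\<close> functions
  admits constants directly.\<close>

lemma green_free_boundary:
  fixes F :: "real^'n \<Rightarrow> real"
  assumes F: "smooth_on UNIV F"
    and free: "free_boundary e A X N"
    and N: "\<And>p. p \<in> bd \<Longrightarrow> N (X p) = grad F (X p) /\<^sub>R norm (grad F (X p))"
    and F1: "\<And>p. p \<in> bd \<Longrightarrow> F (X p) = 1"
    and f: "C2M f"
  shows "(\<integral>p. norm (grad F (X p)) * f p \<partial>boundary_measure e A X) =
    (\<integral>p. f p * laplace_beltrami A X (F \<circ> X) p \<partial>volume_measure M A X) +
    (\<integral>p. (1 - F (X p)) * laplace_beltrami A X f p \<partial>volume_measure M A X)"
proof -
  let ?\<mu> = "volume_measure M A X" and ?\<sigma> = "boundary_measure e A X" and ?u = "F \<circ> X"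
  let ?n = "\<lambda>p. norm (grad F (X p))"
  obtain I :: "'m set" and V \<psi> K \<rho> where part: "chart_partition I V \<psi> K \<rho>"
    using ex_chart_partition by blast
  note P = chart_partitionD[OF part]
  have u2: "C2M ?u" by (rule C2M_ambient[OF F])
  note f1 = C2M_C1M[OF f] and u1 = C2M_C1M[OF u2]
  \<comment> \<open>1 - F is written with a sum and a product, the operations under which
    \<open>C1M\<close> is known to be closed.\<close>
  have w1: "C1M (\<lambda>p. 1 + (-1) * ?u p)" by (intro C1M_add C1M_mult C1M_const u1)
  have w_eq: "1 + (-1) * ?u p = 1 - F (X p)" for p by simp
  have sp: "space ?\<mu> = M"
    using sets_eq_imp_space_eq[OF sets_volume_measure] by (simp add: space_restrict_space)
  have spb: "space ?\<sigma> = bd"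
    using sets_eq_imp_space_eq[OF sets_boundary_measure] by (simp add: space_restrict_space)
  have cX: "continuous_on M X"
  proof (rule continuous_on_openin_cover)
    fix p assume "p \<in> M"
    then obtain V \<psi> x where c: "(V, \<psi>) \<in> A" "x \<in> V" "p = \<psi> x" by (rule chart_at)
    have "continuous_on (\<psi> ` V) (\<lambda>p. (X \<circ> \<psi>) (inv_into V \<psi> p))"
      by (rule continuous_on_compose2[OF C1_on_continuous[OF chart(1)[OF c(1)] C1_param(1)[OF c(1)]] chart(5)[OF c(1)]])
        (auto intro: inv_into_into)
    then have "continuous_on (\<psi> ` V) X"
      by (rule continuous_on_eq) (use f_inv_into_f[of _ \<psi> V] in auto)
    then show "\<exists>T. openin (top_of_set M) T \<and> p \<in> T \<and> continuous_on T X"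
      using chart(2)[OF c(1)] c by blast
  qed
  have cg: "continuous_on UNIV (grad F)"
    unfolding grad_inner(2)[OF smooth_on_UNIV(1)[OF F], abs_def]
    by (intro continuous_on_vec_lambda smooth_on_UNIV(2)[OF smooth_on_UNIV(3)[OF F]])
  have cn: "continuous_on M ?n"
    by (intro continuous_on_norm continuous_on_compose2[OF cg cX]) auto
  have h: "continuous_on M (\<lambda>p. \<rho> i p * (?n p * f p))" if "i \<in> I" for i
    by (intro continuous_on_mult cn C1M_continuous P(5)[OF that] f1)
  have bint: "(\<integral>p. \<rho> i p * (?n p * f p) \<partial>?\<sigma>) =
      - (\<integral>x. indicator (V i) x * (\<rho> i (\<psi> i x) * f (\<psi> i x) * flux (\<psi> i) ?u e x) \<partial>hyperplane_lborel e)"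
    "integrable ?\<sigma> (\<lambda>p. \<rho> i p * (?n p * f p))" if i: "i \<in> I" for i
  proof -
    note c = P(2)[OF i] and K = P(3,4)[OF i]
    have supp: "\<rho> i p * (?n p * f p) = 0" if "p \<in> M - \<psi> i ` K i" for p using P(6)[OF i that] by simp
    show "integrable ?\<sigma> (\<lambda>p. \<rho> i p * (?n p * f p))"
      by (rule integrable_boundary_support[OF c K h[OF i] supp])
    have "(\<integral>p. \<rho> i p * (?n p * f p) \<partial>?\<sigma>) =
      (\<integral>x. indicator (face e (V i)) x * (bdens (\<psi> i) x * (\<rho> i (\<psi> i x) * (?n (\<psi> i x) * f (\<psi> i x)))) \<partial>hyperplane_lborel e)"
      by (rule integral_boundary_measure(1)[OF c borel_continuous_bd[OF h[OF i]]])
        (use supp mboundary_subset K(2) in blast)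
    also have "\<dots> = (\<integral>x. indicator (face e (V i)) x * (- (\<rho> i (\<psi> i x) * f (\<psi> i x) * flux (\<psi> i) ?u e x)) \<partial>hyperplane_lborel e)"
    proof (rule Bochner_Integration.integral_cong[OF refl])
      fix x
      show "indicator (face e (V i)) x * (bdens (\<psi> i) x * (\<rho> i (\<psi> i x) * (?n (\<psi> i x) * f (\<psi> i x)))) =
        indicator (face e (V i)) x * (- (\<rho> i (\<psi> i x) * f (\<psi> i x) * flux (\<psi> i) ?u e x))"
      proof (cases "x \<in> face e (V i)")
        case True
        then have x: "x \<in> V i" "x $ e = 0" by auto
        have "\<psi> i x \<in> bd" using mboundary_iff[OF c x(1)] x(2) by simp
        moreover have "outward_unit_conormal e (V i) (X \<circ> \<psi> i) x (N (X (\<psi> i x)))"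
          using free c x unfolding free_boundary_def by fast
        ultimately have "- flux (\<psi> i) ?u e x = bdens (\<psi> i) x * ?n (\<psi> i x)"
          using flux_conormal[OF c x F] N by simp
        then have "flux (\<psi> i) ?u e x = - (bdens (\<psi> i) x * ?n (\<psi> i x))" by simp
        then show ?thesis by (simp only: mult_ac mult_minus_right mult_minus_left minus_minus)
      qed simp
    qed
    \<comment> \<open>The face may be replaced by the whole chart domain, since almost every point
      for the hyperplane measure has vanishing normal coordinate.\<close>
    also have "\<dots> = (\<integral>x. - (indicator (V i) x * (\<rho> i (\<psi> i x) * f (\<psi> i x) * flux (\<psi> i) ?u e x)) \<partial>hyperplane_lborel e)"
    proof -
      let ?a = "\<lambda>x. indicator (V i) x *\<^sub>R (\<rho> i (\<psi> i x) * f (\<psi> i x) * flux (\<psi> i) ?u e x)"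
      have cc: "continuous_on (V i) (\<lambda>x. \<rho> i (\<psi> i x) * f (\<psi> i x) * flux (\<psi> i) ?u e x)"
        by (intro continuous_on_mult C1_on_continuous[OF chart(1)[OF c] C1_flux[OF c u2]]
          continuous_on_compose2[OF C1M_continuous[OF P(5)[OF i]] chart(3)[OF c] chart(6)[OF c]]
          continuous_on_compose2[OF C1M_continuous[OF f1] chart(3)[OF c] chart(6)[OF c]])
      have "?a \<in> borel_measurable borel"
        by (rule borel_measurable_continuous_on_indicator[OF chart_context(1)[OF c] cc])
      then have m1: "(\<lambda>x. - (indicator (V i) x * (\<rho> i (\<psi> i x) * f (\<psi> i x) * flux (\<psi> i) ?u e x))) \<in> borel_measurable (hyperplane_lborel e)"
        by simp
      have "(\<lambda>x. indicator (face e (V i)) x *\<^sub>R (\<rho> i (\<psi> i x) * f (\<psi> i x) * flux (\<psi> i) ?u e x)) \<in> borel_measurable borel"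
        by (rule borel_measurable_continuous_on_indicator[OF face_context(1)[OF c] continuous_on_subset[OF cc]]) auto
      then have m2: "(\<lambda>x. indicator (face e (V i)) x * (- (\<rho> i (\<psi> i x) * f (\<psi> i x) * flux (\<psi> i) ?u e x))) \<in> borel_measurable (hyperplane_lborel e)"
        by simp
      show ?thesis
        by (rule integral_cong_AE[OF m2 m1], rule AE_mp[OF AE_hyperplane_lborel]) (auto simp: indicator_def)
    qed
    finally show "(\<integral>p. \<rho> i p * (?n p * f p) \<partial>?\<sigma>) =
      - (\<integral>x. indicator (V i) x * (\<rho> i (\<psi> i x) * f (\<psi> i x) * flux (\<psi> i) ?u e x) \<partial>hyperplane_lborel e)"
      by simp
  qed
  have "(\<integral>p. ?n p * f p \<partial>?\<sigma>) = (\<integral>p. (\<Sum>i\<in>I. \<rho> i p * (?n p * f p)) \<partial>?\<sigma>)"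
  proof (rule Bochner_Integration.integral_cong[OF refl])
    fix p assume "p \<in> space ?\<sigma>"
    then have "(\<Sum>i\<in>I. \<rho> i p) = 1" using mboundary_subset by (intro P(7)) (auto simp: spb)
    then show "?n p * f p = (\<Sum>i\<in>I. \<rho> i p * (?n p * f p))" by (simp add: sum_distrib_right[symmetric])
  qed
  also have "\<dots> = (\<Sum>i\<in>I. \<integral>p. \<rho> i p * (?n p * f p) \<partial>?\<sigma>)"
    by (rule Bochner_Integration.integral_sum[OF bint(2)])
  also have "\<dots> = (\<integral>p. f p * laplace_beltrami A X ?u p \<partial>?\<mu>) + (\<integral>p. gpair f ?u p \<partial>?\<mu>)"
    unfolding green_partition[OF part f1 u2] by (rule sum.cong[OF refl bint(1)])
  finally have A: "(\<integral>p. ?n p * f p \<partial>?\<sigma>) =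
    (\<integral>p. f p * laplace_beltrami A X ?u p \<partial>?\<mu>) + (\<integral>p. gpair f ?u p \<partial>?\<mu>)" .
  have "(\<integral>x. indicator (V i) x * (\<rho> i (\<psi> i x) * (1 + (-1) * ?u (\<psi> i x)) * flux (\<psi> i) f e x) \<partial>hyperplane_lborel e) = 0"
    if i: "i \<in> I" for i
  proof (rule flux_integral_zero[of "V i" "\<lambda>p. \<rho> i p * (1 + (-1) * ?u p)"])
    fix x assume "x \<in> V i" "x $ e = 0"
    then have "\<psi> i x \<in> bd" using mboundary_iff[OF P(2)[OF i]] by simp
    then show "\<rho> i (\<psi> i x) * (1 + (-1) * ?u (\<psi> i x)) = 0" using F1 by simp
  qed
  then have B: "(\<integral>p. (1 + (-1) * ?u p) * laplace_beltrami A X f p \<partial>?\<mu>) +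
      (\<integral>p. gpair (\<lambda>p. 1 + (-1) * ?u p) f p \<partial>?\<mu>) = 0"
    unfolding green_partition[OF part w1 f] by simp
  have "gpair (\<lambda>p. 1 + (-1) * ?u p) f p = - gpair f ?u p" if p: "p \<in> M" for p
  proof -
    \<comment> \<open>The constant 1, whose differential is zero, is the sum of 1 - F and F; the
      type \<open>bool\<close> indexes the two summands.\<close>
    have "gpair (\<lambda>_. 1) f p = (\<Sum>b\<in>UNIV. gpair (if b then (\<lambda>p. 1 + (-1) * ?u p) else ?u) f p)"
      by (rule gpair_sum[OF p finite _ f1 C1M_const]) (use w1 u1 in \<open>auto simp: UNIV_bool\<close>)
    moreover have "gpair (\<lambda>_. 1) f p = 0"
    proof -
      obtain V \<psi> x where c: "(V, \<psi>) \<in> A" "x \<in> V" "p = \<psi> x" by (rule chart_at[OF p])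
      show ?thesis
        unfolding c(3) gpair_chart[OF c(1,2) C1M_const f1]
        by (simp add: pairing_def copair_def comp_def dH_const openH_subset[OF chart(1)[OF c(1)] c(2)])
    qed
    ultimately have "gpair (\<lambda>p. 1 + (-1) * ?u p) f p = - gpair ?u f p" by (simp add: UNIV_bool)
    then show ?thesis using gpair_sym[OF p f1 u1] by simp
  qed
  then have "(\<integral>p. gpair (\<lambda>p. 1 + (-1) * ?u p) f p \<partial>?\<mu>) = (\<integral>p. - gpair f ?u p \<partial>?\<mu>)"
    by (intro Bochner_Integration.integral_cong[OF refl]) (simp add: sp)
  then have "(\<integral>p. gpair (\<lambda>p. 1 + (-1) * ?u p) f p \<partial>?\<mu>) = - (\<integral>p. gpair f ?u p \<partial>?\<mu>)" by simp
  then show ?thesis using A B unfolding w_eq by simp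
qed

lemma C2M_const: "C2M (\<lambda>p. c)"
  unfolding C2M_def
proof (intro ballI, clarify, intro conjI allI)
  fix V and \<psi> :: "real^'k \<Rightarrow> 'm" and v assume c: "(V, \<psi>) \<in> A"
  note V = chart(1)[OF c]
  show "C1_on e V ((\<lambda>p. c) \<circ> \<psi>)" by (rule C1M_D[OF C1M_const c])
  show "C1_on e V (\<lambda>x. dH e ((\<lambda>p. c) \<circ> \<psi>) x v)"
    by (rule C1_on_cong[OF V C1_on_const[OF openin_imp_subset[OF V], of 0]])
      (simp add: comp_def dH_const openH_subset[OF V])
qed

lemma laplace_beltrami_const:
  assumes "p \<in> M" shows "laplace_beltrami A X (\<lambda>_. c) p = 0"
proof -
  obtain V \<psi> x where ch: "(V, \<psi>) \<in> A" "x \<in> V" "p = \<psi> x" by (rule chart_at[OF assms])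
  note V = chart(1)[OF ch(1)]
  have "dH e (flux \<psi> (\<lambda>_. c) i) x = dH e (\<lambda>_. 0) x" for i
    by (rule dH_cong[OF V ch(2)]) (simp add: flux_def comp_def dH_const openH_subset[OF V])
  then show ?thesis
    unfolding ch(3) laplace_beltrami_chart[OF ch(1,2) C2M_const]
    by (simp add: lap_def dH_const openH_subset[OF V ch(2)])
qed

end

theorem proposition1:
  fixes \<Omega> :: "(real^'n) set"
    and F :: "real^'n \<Rightarrow> real"
    and N :: "real^'n \<Rightarrow> real^'n"
    and e :: "'k::finite"
    and M :: "'m::t2_space set"
    and A :: "('m, 'k) chart set"
    and X :: "'m \<Rightarrow> real^'n"
  assumes "is_domain \<Omega>"
    and "smooth_on UNIV F"
    and "regular_value F 1"
    and "frontier \<Omega> = F -` {1}"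
    and "\<And>q. q \<in> frontier \<Omega> \<Longrightarrow> outward_unit_normal \<Omega> q (N q)"
    and "\<And>q. q \<in> frontier \<Omega> \<Longrightarrow> N q = grad F q /\<^sub>R norm (grad F q)"
    and "compact_immersed_hypersurface e M A X"
    and "X ` M \<subseteq> closure \<Omega>"
    and "X ` mboundary e A \<subseteq> frontier \<Omega>"
    and "free_boundary e A X N"
  shows "(\<forall>\<phi>. smooth_map A \<phi> \<longrightarrow>
            (LINT p|boundary_measure e A X. norm (grad F (X p)) * \<phi> p) =
            (LINT p|volume_measure M A X. \<phi> p * laplace_beltrami A X (F \<circ> X) p) +
            (LINT p|volume_measure M A X. (1 - F (X p)) * laplace_beltrami A X \<phi> p))
       \<and> (LINT p|boundary_measure e A X. norm (grad F (X p))) =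
            (LINT p|volume_measure M A X. laplace_beltrami A X (F \<circ> X) p)"
proof -
  interpret immersed_hypersurface e M A X by standard (rule assms(7))
  have bdF: "X p \<in> frontier \<Omega>" if "p \<in> mboundary e A" for p using assms(9) that by blast
  then have F1: "F (X p) = 1" if "p \<in> mboundary e A" for p using that assms(4) by blast
  have green: "(LINT p|boundary_measure e A X. norm (grad F (X p)) * f p) =
      (LINT p|volume_measure M A X. f p * laplace_beltrami A X (F \<circ> X) p) +
      (LINT p|volume_measure M A X. (1 - F (X p)) * laplace_beltrami A X f p)" if "C2M f" for f
    by (rule green_free_boundary[OF assms(2,10) _ _ that]) (use assms(6) bdF F1 in blast)+
  have sp: "space (volume_measure M A X) = M"
    using sets_eq_imp_space_eq[OF sets_volume_measure] by (simp add: space_restrict_space)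
  \<comment> \<open>The Laplacian of a constant vanishes on \<open>M\<close>, so for \<phi> = 1 only
    the first volume integral remains.\<close>
  have "(LINT p|volume_measure M A X. (1 - F (X p)) * laplace_beltrami A X (\<lambda>_. 1) p) = 0"
    by (rule integral_eq_zero_AE) (auto intro!: AE_I2 simp: sp laplace_beltrami_const)
  then show ?thesis using green[OF C2M_smooth_map] green[OF C2M_const[of 1]] by simp
qed

end
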